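(* Let $(A,\tau)$ be a countably generated tracial $*$-algebra, and let $\omega$ be a non-principal ultrafilter on $\mathbb{N}=\{1,2,\dots\}$. Then there exist positive traces $\tau_k$ on $A_k$ ($k\in\mathbb{N}$), where $A_k$ is the algebra of generic self-adjoint $k\times k$-matrices, and a tracial $*$-algebra homomorphism into the metric ultraproduct $$\varphi\colon(A,\tau)\to\prod_{k\to\omega}(A_k,\tau_k).$$
   Context: A tracial $*$-algebra $(A,\tau)$ is a unital complex algebra $A$ with involution together with a $\mathbb{C}$-linear functional $\tau\colon A\to\mathbb{C}$ (a "positive trace") with $\tau(1)=1$, $\tau(a^*a)\ge 0$ and $\tau(ab)=\tau(ba)$ for all $a,b\in A$. A homomorphism of tracial $*$-algebras $(A,\tau)\to(B,\rho)$ is a $*$-algebra homomorphism $\varphi$ with $\rho(\varphi(a))=\tau(a)$ for all $a\in A$. $\mathbb{C}\langle X_\infty\rangle$ is the algebra of non-commutative polynomials in countably many letters $X_1,X_2,\dots$, with the involution determined by $X_i^*=X_i$ and $\lambda^*=\overline\lambda$ for $\lambda\in\mathbb{C}$. $J_{k,\infty}$ is the two-sided $*$-ideal of all $P\in\mathbb{C}\langle X_\infty\rangle$ vanishing under every substitution of self-adjoint complex $k\times k$-matrices for the letters. The algebra of generic self-adjoint $k\times k$-matrices is the quotient $*$-algebra $A_k:=\mathbb{C}\langle X_\infty\rangle/J_{k,\infty}$. For even $p\ge 2$ put $\|a\|_p=\tau((a^*a)^{p/2})^{1/p}$. Metric ultraproduct: given tracial $*$-algebras $(A_i,\tau_i)$,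 $i\in I$, and an ultrafilter $\omega$ on $I$, let $\widetilde{\prod}_{i}(A_i,\tau_i)$ be the $*$-algebra of all $(a_i)_i\in\prod_i A_i$ such that $(\|a_i\|_p)_{i\in I}$ is bounded for every even $p$. On it, $\tau_\omega((a_i)_i)=\lim_{i\to\omega}\tau_i(a_i)$ is a positive trace, $Z_{\tau_\omega}=\{x : \tau_\omega(x^*x)=0\}$ is a two-sided $*$-ideal on which $\tau_\omega$ vanishes, and the metric ultraproduct is $\prod_{i\to\omega}(A_i,\tau_i):=\widetilde{\prod}_i(A_i,\tau_i)/Z_{\tau_\omega}$ with the trace induced by $\tau_\omega$. *)

theory Defs
  imports
    "HOL-Analysis.Analysis"
    "HOL-Library.Poly_Mapping"
    "HOL-Algebra.QuotRing"
    "Jordan_Normal_Form.Schur_Decomposition"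
begin

section \<open>Tracial \<open>*\<close>-algebras\<close>

abbreviation complex_ring :: "complex ring"
  where "complex_ring \<equiv> class_ring"

record 'a star_algebra = "(complex, 'a) module" +
  invol :: "'a \<Rightarrow> 'a"

locale star_algebra = module complex_ring A + ring A for A :: "'a star_algebra" (structure) +
  assumes smult_mult_left:
      "\<lbrakk>x \<in> carrier A; y \<in> carrier A\<rbrakk> \<Longrightarrow> (c \<odot>\<^bsub>A\<^esub> x) \<otimes>\<^bsub>A\<^esub> y = c \<odot>\<^bsub>A\<^esub> (x \<otimes>\<^bsub>A\<^esub> y)"
    and smult_mult_right:
      "\<lbrakk>x \<in> carrier A; y \<in> carrier A\<rbrakk> \<Longrightarrow> x \<otimes>\<^bsub>A\<^esub> (c \<odot>\<^bsub>A\<^esub> y) = c \<odot>\<^bsub>A\<^esub> (x \<otimes>\<^bsub>A\<^esub> y)"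
    and invol_closed: "x \<in> carrier A \<Longrightarrow> invol A x \<in> carrier A"
    and invol_invol: "x \<in> carrier A \<Longrightarrow> invol A (invol A x) = x"
    and invol_add:
      "\<lbrakk>x \<in> carrier A; y \<in> carrier A\<rbrakk> \<Longrightarrow> invol A (x \<oplus>\<^bsub>A\<^esub> y) = invol A x \<oplus>\<^bsub>A\<^esub> invol A y"
    and invol_smult: "x \<in> carrier A \<Longrightarrow> invol A (c \<odot>\<^bsub>A\<^esub> x) = cnj c \<odot>\<^bsub>A\<^esub> invol A x"
    and invol_mult:
      "\<lbrakk>x \<in> carrier A; y \<in> carrier A\<rbrakk> \<Longrightarrow> invol A (x \<otimes>\<^bsub>A\<^esub> y) = invol A y \<otimes>\<^bsub>A\<^esub> invol A x"

locale tracial_star_algebra = star_algebra A for A :: "'a star_algebra" (structure) +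
  fixes \<tau> :: "'a \<Rightarrow> complex"
  assumes trace_add: "\<lbrakk>x \<in> carrier A; y \<in> carrier A\<rbrakk> \<Longrightarrow> \<tau> (x \<oplus>\<^bsub>A\<^esub> y) = \<tau> x + \<tau> y"
    and trace_smult: "x \<in> carrier A \<Longrightarrow> \<tau> (c \<odot>\<^bsub>A\<^esub> x) = c * \<tau> x"
    and trace_one: "\<tau> \<one>\<^bsub>A\<^esub> = 1"
    and trace_pos: "x \<in> carrier A \<Longrightarrow> \<tau> (invol A x \<otimes>\<^bsub>A\<^esub> x) \<in> \<real>\<^sub>\<ge>\<^sub>0"
    and trace_commute: "\<lbrakk>x \<in> carrier A; y \<in> carrier A\<rbrakk> \<Longrightarrow> \<tau> (x \<otimes>\<^bsub>A\<^esub> y) = \<tau> (y \<otimes>\<^bsub>A\<^esub> x)"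

locale tracial_hom =
  A: tracial_star_algebra A \<tau> + B: tracial_star_algebra B \<rho> for A :: "'a star_algebra" and \<tau> and B :: "'b star_algebra" and \<rho> +
  fixes \<phi> :: "'a \<Rightarrow> 'b"
  assumes ring_hom: "\<phi> \<in> Ring.ring_hom A B"
    and hom_smult: "x \<in> carrier A \<Longrightarrow> \<phi> (c \<odot>\<^bsub>A\<^esub> x) = c \<odot>\<^bsub>B\<^esub> \<phi> x"
    and hom_invol: "x \<in> carrier A \<Longrightarrow> \<phi> (invol A x) = invol B (\<phi> x)"
    and hom_trace: "x \<in> carrier A \<Longrightarrow> \<rho> (\<phi> x) = \<tau> x"

inductive_set generate_star_algebra :: "'a star_algebra \<Rightarrow> 'a set \<Rightarrow> 'a set"
  for A S where
    one: "\<one>\<^bsub>A\<^esub> \<in> generate_star_algebra A S"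
  | incl: "x \<in> S \<Longrightarrow> x \<in> generate_star_algebra A S"
  | add: "\<lbrakk>x \<in> generate_star_algebra A S; y \<in> generate_star_algebra A S\<rbrakk>
      \<Longrightarrow> x \<oplus>\<^bsub>A\<^esub> y \<in> generate_star_algebra A S"
  | smult: "x \<in> generate_star_algebra A S \<Longrightarrow> c \<odot>\<^bsub>A\<^esub> x \<in> generate_star_algebra A S"
  | mult: "\<lbrakk>x \<in> generate_star_algebra A S; y \<in> generate_star_algebra A S\<rbrakk>
      \<Longrightarrow> x \<otimes>\<^bsub>A\<^esub> y \<in> generate_star_algebra A S"
  | invol: "x \<in> generate_star_algebra A S \<Longrightarrow> invol A x \<in> generate_star_algebra A S"

definition countably_generated :: "'a star_algebra \<Rightarrow> bool"
  where "countably_generated A \<longleftrightarrow>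
    (\<exists>S. countable S \<and> S \<subseteq> carrier A \<and> generate_star_algebra A S = carrier A)"


section \<open>Quotients by \<open>*\<close>-ideals\<close>

text \<open>As in \<^const>\<open>rcoset_mult\<close>, the operations on cosets are given by the union of the cosets of
  the results over all representatives; for a \<open>*\<close>-ideal these cosets all coincide.\<close>

definition quotient_star_algebra :: "'a star_algebra \<Rightarrow> 'a set \<Rightarrow> 'a set star_algebra"
  where "quotient_star_algebra A J = ring.extend (A Quot J)
    \<lparr>smult = (\<lambda>c U. \<Union>x\<in>U. J +>\<^bsub>A\<^esub> (c \<odot>\<^bsub>A\<^esub> x)),
     invol = (\<lambda>U. \<Union>x\<in>U. J +>\<^bsub>A\<^esub> invol A x)\<rparr>"

text \<open>The functional induced on cosets by a functional vanishing on the ideal.\<close>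

definition quotient_trace :: "('a \<Rightarrow> complex) \<Rightarrow> 'a set \<Rightarrow> complex"
  where "quotient_trace \<tau> U = the_elem (\<tau> ` U)"


section \<open>Generic self-adjoint matrices\<close>

text \<open>Words in the letters \<open>X\<^sub>0, X\<^sub>1, \<dots>\<close> (indexed from zero) form the free monoid, so that
  \<^typ>\<open>nat list \<Rightarrow>\<^sub>0 complex\<close> with its convolution product is the algebra of non-commutative
  polynomials in countably many letters.\<close>

instantiation list :: (type) monoid_add
begin

definition zero_list :: "'a list" where "zero_list = []"
definition plus_list :: "'a list \<Rightarrow> 'a list \<Rightarrow> 'a list" where "plus_list = (@)"

instance by standard (simp_all add: zero_list_def plus_list_def)

end

type_synonym ncpoly = "nat list \<Rightarrow>\<^sub>0 complex"

text \<open>The anti-multiplicative, conjugate-linear map fixing every letter reverses the words.\<close>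

definition ncpoly_star :: "ncpoly \<Rightarrow> ncpoly"
  where "ncpoly_star P =
    (\<Sum>w\<in>Poly_Mapping.keys P. Poly_Mapping.single (rev w) (cnj (Poly_Mapping.lookup P w)))"

definition ncpoly_algebra :: "ncpoly star_algebra"
  where "ncpoly_algebra = ring.extend class_ring
    \<lparr>smult = (\<lambda>c P. Poly_Mapping.single [] c * P), invol = ncpoly_star\<rparr>"

definition matrix_algebra :: "nat \<Rightarrow> complex mat star_algebra"
  where "matrix_algebra k =
    ring_mat TYPE(complex) k \<lparr>smult = (\<cdot>\<^sub>m), invol = mat_adjoint\<rparr>"

definition ncpoly_eval :: "'a star_algebra \<Rightarrow> (nat \<Rightarrow> 'a) \<Rightarrow> ncpoly \<Rightarrow> 'a"
  where "ncpoly_eval A x P =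
    (\<Oplus>\<^bsub>A\<^esub>w\<in>Poly_Mapping.keys P.
      Poly_Mapping.lookup P w \<odot>\<^bsub>A\<^esub> foldr (\<lambda>i a. x i \<otimes>\<^bsub>A\<^esub> a) w \<one>\<^bsub>A\<^esub>)"

definition matrix_identities :: "nat \<Rightarrow> ncpoly set"
  where "matrix_identities k =
    {P. \<forall>x. (\<forall>i. x i \<in> carrier_mat k k \<and> mat_adjoint (x i) = x i) \<longrightarrow>
      ncpoly_eval (matrix_algebra k) x P = 0\<^sub>m k k}"

definition generic_matrix_algebra :: "nat \<Rightarrow> ncpoly set star_algebra"
  where "generic_matrix_algebra k = quotient_star_algebra ncpoly_algebra (matrix_identities k)"


section \<open>Metric ultraproducts\<close>

text \<open>An ultrafilter on a subset \<open>I\<close> of a type is represented by the filter on the whole type that it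
  generates; it contains \<open>I\<close>.\<close>

definition ultrafilter_on :: "'i set \<Rightarrow> 'i filter \<Rightarrow> bool"
  where "ultrafilter_on I \<omega> \<longleftrightarrow>
    \<omega> \<noteq> bot \<and> (\<forall>\<^sub>F i in \<omega>. i \<in> I) \<and>
    (\<forall>P. (\<forall>\<^sub>F i in \<omega>. P i) \<or> (\<forall>\<^sub>F i in \<omega>. \<not> P i))"

definition nonprincipal_on :: "'i set \<Rightarrow> 'i filter \<Rightarrow> bool"
  where "nonprincipal_on I \<omega> \<longleftrightarrow> (\<forall>i\<in>I. \<omega> \<noteq> principal {i})"

definition trace_norm :: "'a star_algebra \<Rightarrow> ('a \<Rightarrow> complex) \<Rightarrow> nat \<Rightarrow> 'a \<Rightarrow> real"
  where "trace_norm A \<tau> p a = root p (Re (\<tau> ((invol A a \<otimes>\<^bsub>A\<^esub> a) [^]\<^bsub>A\<^esub> (p div 2))))"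

definition bounded_product ::
    "'i set \<Rightarrow> ('i \<Rightarrow> 'a star_algebra) \<Rightarrow> ('i \<Rightarrow> 'a \<Rightarrow> complex) \<Rightarrow> ('i \<Rightarrow> 'a) star_algebra"
  where "bounded_product I A \<tau> =
    \<lparr>carrier = {a \<in> (\<Pi>\<^sub>E i\<in>I. carrier (A i)).
       \<forall>p\<ge>2. even p \<longrightarrow> bounded ((\<lambda>i. trace_norm (A i) (\<tau> i) p (a i)) ` I)},
     mult = (\<lambda>a b. \<lambda>i\<in>I. a i \<otimes>\<^bsub>A i\<^esub> b i),
     one = (\<lambda>i\<in>I. \<one>\<^bsub>A i\<^esub>),
     zero = (\<lambda>i\<in>I. \<zero>\<^bsub>A i\<^esub>),
     add = (\<lambda>a b. \<lambda>i\<in>I. a i \<oplus>\<^bsub>A i\<^esub> b i),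
     smult = (\<lambda>c a. \<lambda>i\<in>I. c \<odot>\<^bsub>A i\<^esub> a i),
     invol = (\<lambda>a. \<lambda>i\<in>I. invol (A i) (a i))\<rparr>"

definition limit_trace :: "'i filter \<Rightarrow> ('i \<Rightarrow> 'a \<Rightarrow> complex) \<Rightarrow> ('i \<Rightarrow> 'a) \<Rightarrow> complex"
  where "limit_trace \<omega> \<tau> a = Lim \<omega> (\<lambda>i. \<tau> i (a i))"

definition null_ideal :: "'a star_algebra \<Rightarrow> ('a \<Rightarrow> complex) \<Rightarrow> 'a set"
  where "null_ideal A \<tau> = {x \<in> carrier A. \<tau> (invol A x \<otimes>\<^bsub>A\<^esub> x) = 0}"

definition metric_ultraproduct ::
    "'i set \<Rightarrow> 'i filter \<Rightarrow> ('i \<Rightarrow> 'a star_algebra) \<Rightarrow> ('i \<Rightarrow> 'a \<Rightarrow> complex)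
      \<Rightarrow> ('i \<Rightarrow> 'a) set star_algebra"
  where "metric_ultraproduct I \<omega> A \<tau> =
    quotient_star_algebra (bounded_product I A \<tau>)
      (null_ideal (bounded_product I A \<tau>) (limit_trace \<omega> \<tau>))"

definition metric_ultraproduct_trace ::
    "'i filter \<Rightarrow> ('i \<Rightarrow> 'a \<Rightarrow> complex) \<Rightarrow> ('i \<Rightarrow> 'a) set \<Rightarrow> complex"
  where "metric_ultraproduct_trace \<omega> \<tau> = quotient_trace (limit_trace \<omega> \<tau>)"

end

theory Submission
  imports Defs "HOL-Library.Nat_Bijection"
begin

text \<open>Choosing self-adjoint generators of \<open>A\<close> pulls \<open>\<tau>\<close> back to a positive trace \<open>\<sigma>\<close> on noncommutative
  polynomials. A polynomial of small weight which vanishes on all self-adjoint \<open>k \<times> k\<close> matrices is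
  zero, so \<open>\<sigma>\<close> truncated to weight \<open>\<le> d\<close> descends to \<open>A\<^sub>k\<close> for large \<open>k\<close>. The truncation is not positive,
  but adding to it a suitable functional \<open>P \<mapsto> \<Sum>m. c m * tr (P\<^sub>m x)\<close>, where \<open>P\<^sub>m\<close> is the component of
  weight \<open>m\<close> and \<open>x\<close> is a tuple of matrices without relations of weight \<open>\<le> d\<close>, makes it positive:
  if \<open>c\<close> grows fast enough, then the Gram matrix of the components is diagonally dominant, and \<open>c m\<close>
  can still be arbitrarily small for \<open>m \<le> d\<close>. The resulting positive traces on \<open>A\<^sub>k\<close> converge pointwise to
  \<open>\<sigma>\<close>. Hence the classes of constant sequences define a trace-preserving map from polynomials to the
  ultraproduct, and it factors through \<open>A\<close> because every \<open>P\<close> which vanishes in \<open>A\<close> satisfies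
  \<open>\<sigma> (P\<^sup>* P) = 0\<close>.\<close>

section \<open>Tracial star algebras and their quotients\<close>

text \<open>Elements may be unbounded for their trace: there is no operator norm and no functional
  calculus, so all estimates go through Cauchy-Schwarz and cyclicity. This is felt twice. Closure of
  the bounded product under sums and products would usually come from the Hoelder inequality; the
  chessboard estimate takes its place. And the approximating traces are built as functionals, with
  positivity enforced by hand. In the Gram matrix of the components, the block of weights i with 2 i
  \<le> d is untouched by the truncation and remains positive. Outside it the truncation leaves
  stray entries with i + j \<le> d < 2 max i j. None is on the diagonal, and each shares its row or
  column with a diagonal entry of weight above d, whose coefficient may be as large as desired
  because nothing has to be approximated there. Acting on each weight with a separate coefficient is
  compatible with passing to the quotient only because the ideal of matrix identities is graded;
  vanishing on identities in weights \<le> d, where \<sigma> itself is kept, is bought with matrices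
  having no identities there.\<close>

lemma star_algebraI:
  fixes A :: "'a star_algebra" (structure)
  assumes "ring A"
    and "\<And>c x. x \<in> carrier A \<Longrightarrow> c \<odot> x \<in> carrier A"
    and "\<And>a b x. x \<in> carrier A \<Longrightarrow> (a + b) \<odot> x = a \<odot> x \<oplus> b \<odot> x"
    and "\<And>c x y. \<lbrakk>x \<in> carrier A; y \<in> carrier A\<rbrakk> \<Longrightarrow> c \<odot> (x \<oplus> y) = c \<odot> x \<oplus> c \<odot> y"
    and "\<And>a b x. x \<in> carrier A \<Longrightarrow> (a * b) \<odot> x = a \<odot> (b \<odot> x)"
    and "\<And>x. x \<in> carrier A \<Longrightarrow> 1 \<odot> x = x"
    and "\<And>c x y. \<lbrakk>x \<in> carrier A; y \<in> carrier A\<rbrakk> \<Longrightarrow> (c \<odot> x) \<otimes> y = c \<odot> (x \<otimes> y)"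
    and "\<And>c x y. \<lbrakk>x \<in> carrier A; y \<in> carrier A\<rbrakk> \<Longrightarrow> x \<otimes> (c \<odot> y) = c \<odot> (x \<otimes> y)"
    and "\<And>x. x \<in> carrier A \<Longrightarrow> invol A x \<in> carrier A"
    and "\<And>x. x \<in> carrier A \<Longrightarrow> invol A (invol A x) = x"
    and "\<And>x y. \<lbrakk>x \<in> carrier A; y \<in> carrier A\<rbrakk> \<Longrightarrow> invol A (x \<oplus> y) = invol A x \<oplus> invol A y"
    and "\<And>c x. x \<in> carrier A \<Longrightarrow> invol A (c \<odot> x) = cnj c \<odot> invol A x"
    and "\<And>x y. \<lbrakk>x \<in> carrier A; y \<in> carrier A\<rbrakk> \<Longrightarrow> invol A (x \<otimes> y) = invol A y \<otimes> invol A x"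
  shows "star_algebra A"
proof -
  interpret ring A by (rule assms(1))
  have "module complex_ring A"
  proof (rule moduleI)
    show "cring complex_ring" by (rule class_cring.is_cring)
    show "abelian_group A" by (rule abelian_group_axioms)
  qed (simp_all only: class_ring_simps assms(2-6))
  then show ?thesis
    by (rule star_algebra.intro[OF _ assms(1) star_algebra_axioms.intro]) (rule assms; assumption)+
qed

context star_algebra
begin

lemma scale_closed [simp, intro]: "x \<in> carrier A \<Longrightarrow> c \<odot> x \<in> carrier A"
  using smult_closed[of c x] by (simp add: class_ring_simps)

lemma scale_add_left: "x \<in> carrier A \<Longrightarrow> (a + b) \<odot> x = a \<odot> x \<oplus> b \<odot> x"
  using smult_l_distr[of a b x] by (simp add: class_ring_simps)

lemma scale_add_right: "\<lbrakk>x \<in> carrier A; y \<in> carrier A\<rbrakk> \<Longrightarrow> c \<odot> (x \<oplus> y) = c \<odot> x \<oplus> c \<odot> y"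
  using smult_r_distr[of c x y] by (simp add: class_ring_simps)

lemma scale_scale: "x \<in> carrier A \<Longrightarrow> (a * b) \<odot> x = a \<odot> (b \<odot> x)"
  using smult_assoc1[of a b x] by (simp add: class_ring_simps)

lemma scale_one: "x \<in> carrier A \<Longrightarrow> 1 \<odot> x = x"
  using smult_one[of x] by (simp add: class_ring_simps)

lemma scale_zero_left: "x \<in> carrier A \<Longrightarrow> 0 \<odot> x = \<zero>"
  using smult_l_null[of x] by (simp add: class_ring_simps)

lemma minus_eq_scale: "x \<in> carrier A \<Longrightarrow> \<ominus> x = (- 1) \<odot> x"
  using smult_l_minus[of 1 x] by (simp add: class_ring_simps scale_one)

lemma scale_eq_mult: "x \<in> carrier A \<Longrightarrow> c \<odot> x = (c \<odot> \<one>) \<otimes> x"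
  by (simp add: smult_mult_left)

declare invol_closed [simp, intro] invol_invol [simp]

lemma invol_zero [simp]: "invol A \<zero> = \<zero>"
  using invol_smult[of \<zero> 0] by (simp add: scale_zero_left)

lemma invol_one [simp]: "invol A \<one> = \<one>"
proof -
  have "invol A (invol A \<one> \<otimes> \<one>) = invol A \<one> \<otimes> invol A (invol A \<one>)"
    by (rule invol_mult) auto
  then show ?thesis by simp
qed

end

section \<open>Hermitian symmetry, Cauchy-Schwarz and the null ideal of a positive trace\<close>

context tracial_star_algebra
begin

lemma trace_zero [simp]: "\<tau> \<zero> = 0"
  using trace_smult[of \<zero> 0] by (simp add: scale_zero_left)

lemma trace_pos_Re:
  "x \<in> carrier A \<Longrightarrow> 0 \<le> Re (\<tau> (invol A x \<otimes> x)) \<and> Im (\<tau> (invol A x \<otimes> x)) = 0"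
  using trace_pos[of x] by (auto simp: complex_nonneg_Reals_iff)

lemma trace_square_add_scale:
  assumes [simp]: "x \<in> carrier A" "y \<in> carrier A"
  shows "\<tau> (invol A (x \<oplus> c \<odot> y) \<otimes> (x \<oplus> c \<odot> y)) =
    \<tau> (invol A x \<otimes> x) + c * \<tau> (invol A x \<otimes> y) + cnj c * \<tau> (invol A y \<otimes> x)
    + c * cnj c * \<tau> (invol A y \<otimes> y)"
  by (simp add: invol_add invol_smult l_distr r_distr trace_add trace_smult smult_mult_left
      smult_mult_right flip: scale_scale) (simp add: algebra_simps)

text \<open>Polarization: the trace of the square of x + c y is real for every c, hence so is the
  sum of its cross terms. The value c = 1 relates the imaginary parts and c = i the real
  parts.\<close>

lemma trace_invol_mult_commute:
  assumes [simp]: "x \<in> carrier A" "y \<in> carrier A"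
  shows "\<tau> (invol A y \<otimes> x) = cnj (\<tau> (invol A x \<otimes> y))"
proof -
  have "Im (c * \<tau> (invol A x \<otimes> y) + cnj c * \<tau> (invol A y \<otimes> x)) = 0" for c
    using trace_pos_Re[of "x \<oplus> c \<odot> y"] trace_pos_Re[of x] trace_pos_Re[of y]
    by (simp add: trace_square_add_scale)
  from this[of 1] this[of \<i>] show ?thesis
    by (auto simp: complex_eq_iff)
qed

lemma trace_invol: "x \<in> carrier A \<Longrightarrow> \<tau> (invol A x) = cnj (\<tau> x)"
  using trace_invol_mult_commute[of \<one> x] by simp

lemma trace_Cauchy_Schwarz:
  assumes [simp]: "x \<in> carrier A" "y \<in> carrier A"
  shows "(cmod (\<tau> (invol A x \<otimes> y)))\<^sup>2 \<le> Re (\<tau> (invol A x \<otimes> x)) * Re (\<tau> (invol A y \<otimes> y))"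
proof -
  define b where "b = \<tau> (invol A x \<otimes> y)"
  define X where "X = Re (\<tau> (invol A x \<otimes> x))"
  define Y where "Y = Re (\<tau> (invol A y \<otimes> y))"
  have quad: "0 \<le> X + 2 * Re (c * b) + (cmod c)\<^sup>2 * Y" for c
  proof -
    have "Re (c * cnj c * \<tau> (invol A y \<otimes> y)) = (cmod c)\<^sup>2 * Y"
      using trace_pos_Re[of y] by (simp add: Y_def complex_norm_square[symmetric] cmod_power2)
    moreover have "0 \<le> Re (\<tau> (invol A (x \<oplus> c \<odot> y) \<otimes> (x \<oplus> c \<odot> y)))"
      using trace_pos_Re[of "x \<oplus> c \<odot> y"] by simp
    moreover have "Re (cnj c * cnj b) = Re (c * b)" by simp
    ultimately show ?thesis
      by (simp add: trace_square_add_scale trace_invol_mult_commute[of x y] X_def b_def)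
  qed
  have Y0: "0 \<le> Y" and X0: "0 \<le> X" using trace_pos_Re by (auto simp: X_def Y_def)
  \<comment> \<open>Taking c = - t * cnj b aligns the phase, so only a real quadratic in t is left.
    For Y > 0 it is evaluated at its minimizer t = 1 / Y.\<close>
  have real_quad: "0 \<le> X - 2 * t * (cmod b)\<^sup>2 + t\<^sup>2 * (cmod b)\<^sup>2 * Y" for t :: real
  proof -
    have "Re (complex_of_real (- t) * cnj b * b) = - t * (cmod b)\<^sup>2"
      unfolding cmod_power2 by (simp add: power2_eq_square algebra_simps)
    then show ?thesis
      using quad[of "of_real (- t) * cnj b"] by (simp add: norm_mult power_mult_distrib)
  qed
  have "(cmod b)\<^sup>2 \<le> X * Y"
  proof (cases "Y = 0")
    case True
    show ?thesis
    proof (cases "b = 0")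
      case False
      then have "0 < (cmod b)\<^sup>2" by simp
      \<comment> \<open>For Y = 0 the expression is affine in t, and this t gives it the value
        -1.\<close>
      with real_quad[of "(X + 1) / (2 * (cmod b)\<^sup>2)"] True show ?thesis by simp
    qed (use X0 Y0 in simp)
  next
    case False
    then have "0 < Y" using Y0 by simp
    then show ?thesis
      using real_quad[of "1 / Y"] by (simp add: power2_eq_square field_simps)
  qed
  then show ?thesis by (simp add: b_def X_def Y_def)
qed

lemma trace_null_mult_left:
  assumes "x \<in> carrier A" "y \<in> carrier A" "\<tau> (invol A x \<otimes> x) = 0"
  shows "\<tau> (invol A x \<otimes> y) = 0"
  using trace_Cauchy_Schwarz[OF assms(1,2)] assms(3) by simp

lemma trace_null_mult_right:
  assumes "x \<in> carrier A" "y \<in> carrier A" "\<tau> (invol A y \<otimes> y) = 0"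
  shows "\<tau> (x \<otimes> y) = 0"
  using trace_Cauchy_Schwarz[of "invol A x" y] assms by simp

text \<open>Cauchy-Schwarz against the unit. This makes the trace well defined on cosets of the null
  ideal.\<close>

lemma trace_cong:
  assumes "x \<in> carrier A" "y \<in> carrier A" "x \<ominus> y \<in> null_ideal A \<tau>"
  shows "\<tau> x = \<tau> y"
proof -
  have "\<tau> (\<one> \<otimes> (x \<ominus> y)) = 0"
    by (rule trace_null_mult_right) (use assms in \<open>auto simp: null_ideal_def\<close>)
  then show ?thesis
    using assms by (simp add: a_minus_def minus_eq_scale trace_add trace_smult)
qed

lemma invol_null_ideal: "x \<in> null_ideal A \<tau> \<Longrightarrow> invol A x \<in> null_ideal A \<tau>"
  by (auto simp: null_ideal_def trace_commute)

text \<open>By Cauchy-Schwarz a null element is orthogonal to everything, which gives sums and left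
  multiples. Right multiples follow by applying the involution, which preserves null elements
  because the trace is cyclic.\<close>

lemma ideal_null_ideal: "ideal (null_ideal A \<tau>) A"
proof (rule idealI)
  show "ring A" by (rule ring_axioms)
  show "subgroup (null_ideal A \<tau>) (add_monoid A)"
  proof (rule subgroup.intro, simp_all)
    show "null_ideal A \<tau> \<subseteq> carrier A" "\<zero> \<in> null_ideal A \<tau>"
      by (auto simp: null_ideal_def)
    show "x \<oplus> y \<in> null_ideal A \<tau>" if "x \<in> null_ideal A \<tau>" "y \<in> null_ideal A \<tau>" for x y
      using that by (auto simp: null_ideal_def invol_add l_distr r_distr trace_add
          trace_null_mult_left)
    show "inv\<^bsub>add_monoid A\<^esub> x \<in> null_ideal A \<tau>" if "x \<in> null_ideal A \<tau>" for x
    proof -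
      have "\<ominus> x \<in> null_ideal A \<tau>"
        using that by (auto simp: null_ideal_def minus_eq_scale invol_smult smult_mult_left
            smult_mult_right trace_smult)
      then show ?thesis by (simp add: a_inv_def)
    qed
  qed
  have left: "a \<otimes> x \<in> null_ideal A \<tau>" if "x \<in> null_ideal A \<tau>" "a \<in> carrier A" for x a
    using that by (auto simp: null_ideal_def invol_mult m_assoc trace_null_mult_left)
  show "a \<otimes> x \<in> null_ideal A \<tau>" if "x \<in> null_ideal A \<tau>" "a \<in> carrier A" for x a
    using left that .
  show "x \<otimes> a \<in> null_ideal A \<tau>" if "x \<in> null_ideal A \<tau>" "a \<in> carrier A" for x a
  proof -
    have "invol A (invol A a \<otimes> invol A x) \<in> null_ideal A \<tau>"
      using that by (intro invol_null_ideal left) auto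
    moreover have "x \<in> carrier A" using that by (simp add: null_ideal_def)
    ultimately show ?thesis using that by (simp add: invol_mult)
  qed
qed

end

section \<open>Quotients by star-ideals and the induced traces\<close>

locale star_ideal = star_algebra A + ideal J A for A :: "'a star_algebra" (structure) and J +
  assumes invol_ideal: "x \<in> J \<Longrightarrow> invol A x \<in> J"
begin

abbreviation Q where "Q \<equiv> quotient_star_algebra A J"

lemma carrier_quotient: "carrier Q = (+>) J ` carrier A"
  by (auto simp: quotient_star_algebra_def Ring.ring.defs FactRing_simps)

lemma coset_mult: "\<lbrakk>x \<in> carrier A; y \<in> carrier A\<rbrakk> \<Longrightarrow> (J +> x) \<otimes>\<^bsub>Q\<^esub> (J +> y) = J +> (x \<otimes> y)"
  by (simp add: quotient_star_algebra_def Ring.ring.defs FactRing_def rcoset_mult_add)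

lemma coset_add: "\<lbrakk>x \<in> carrier A; y \<in> carrier A\<rbrakk> \<Longrightarrow> (J +> x) \<oplus>\<^bsub>Q\<^esub> (J +> y) = J +> (x \<oplus> y)"
  by (simp add: quotient_star_algebra_def Ring.ring.defs FactRing_def a_rcos_sum)

lemma coset_one: "\<one>\<^bsub>Q\<^esub> = J +> \<one>"
  by (simp add: quotient_star_algebra_def Ring.ring.defs FactRing_def)

lemma coset_zero: "\<zero>\<^bsub>Q\<^esub> = J"
  by (simp add: quotient_star_algebra_def Ring.ring.defs FactRing_def)

lemma coset_eq_iff: "\<lbrakk>x \<in> carrier A; y \<in> carrier A\<rbrakk> \<Longrightarrow> J +> x = J +> y \<longleftrightarrow> x \<ominus> y \<in> J"
  by (rule quotient_eq_iff_same_a_r_cos[OF ideal_axioms, symmetric])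

lemma coset_carrier: "\<lbrakk>x \<in> carrier A; z \<in> J +> x\<rbrakk> \<Longrightarrow> z \<in> carrier A"
  using a_r_coset_subset_G[OF a_subset, of x] by (rule subsetD)

lemma coset_eqI: "\<lbrakk>x \<in> carrier A; z \<in> J +> x\<rbrakk> \<Longrightarrow> J +> z = J +> x"
  by (rule a_repr_independence[symmetric]) (auto simp: a_subgroup)

lemma coset_diff: "\<lbrakk>x \<in> carrier A; z \<in> J +> x\<rbrakk> \<Longrightarrow> z \<ominus> x \<in> J"
  using coset_eq_iff[of z x] coset_carrier[of x z] coset_eqI[of x z] by blast

lemma scale_ideal: "x \<in> J \<Longrightarrow> c \<odot> x \<in> J"
  using I_l_closed[of x "c \<odot> \<one>"] a_Hcarr[of x] by (simp add: scale_eq_mult[of x])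

lemma coset_scale:
  assumes "x \<in> carrier A" shows "c \<odot>\<^bsub>Q\<^esub> (J +> x) = J +> (c \<odot> x)"
proof -
  have "J +> (c \<odot> z) = J +> (c \<odot> x)" if "z \<in> J +> x" for z
  proof -
    have z: "z \<in> carrier A" "z \<ominus> x \<in> J"
      by (fact coset_carrier[OF assms that] coset_diff[OF assms that])+
    have "c \<odot> z \<ominus> c \<odot> x = c \<odot> (z \<ominus> x)"
      using z assms by (simp add: a_minus_def minus_eq_scale scale_add_right mult.commute flip: scale_scale)
    then show ?thesis using z assms by (simp add: coset_eq_iff scale_ideal)
  qed
  then have "(\<Union>z\<in>J +> x. J +> (c \<odot> z)) = J +> (c \<odot> x)"
    using a_rcos_self[OF assms] by (intro SUP_eq_const) blast+
  then show ?thesis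
    by (simp add: quotient_star_algebra_def Ring.ring.defs)
qed

lemma coset_invol:
  assumes "x \<in> carrier A" shows "invol Q (J +> x) = J +> invol A x"
proof -
  have "J +> invol A z = J +> invol A x" if "z \<in> J +> x" for z
  proof -
    have z: "z \<in> carrier A" "z \<ominus> x \<in> J"
      by (fact coset_carrier[OF assms that] coset_diff[OF assms that])+
    have "invol A z \<ominus> invol A x = invol A (z \<ominus> x)"
      using z assms by (simp add: a_minus_def minus_eq_scale invol_add invol_smult)
    then show ?thesis using z assms by (simp add: coset_eq_iff invol_ideal)
  qed
  then have "(\<Union>z\<in>J +> x. J +> invol A z) = J +> invol A x"
    using a_rcos_self[OF assms] by (intro SUP_eq_const) blast+
  then show ?thesis
    by (simp add: quotient_star_algebra_def Ring.ring.defs)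
qed

lemmas coset_simps = coset_mult coset_add coset_one coset_scale coset_invol

lemma coset_zero_eq: "\<zero>\<^bsub>Q\<^esub> = J +> \<zero>"
  using a_coset_add_zero[OF a_subset] by (simp add: coset_zero)

lemma ring_quotient: "ring Q"
proof (rule ringI)
  show "abelian_group Q"
  proof (rule abelian_groupI)
    fix U assume "U \<in> carrier Q"
    then obtain x where x: "x \<in> carrier A" "U = J +> x" by (auto simp: carrier_quotient)
    then have "(J +> \<ominus> x) \<oplus>\<^bsub>Q\<^esub> U = \<zero>\<^bsub>Q\<^esub>" "J +> \<ominus> x \<in> carrier Q"
      by (simp_all add: coset_add coset_zero_eq l_neg carrier_quotient)
    then show "\<exists>V\<in>carrier Q. V \<oplus>\<^bsub>Q\<^esub> U = \<zero>\<^bsub>Q\<^esub>" by blast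
  qed (auto simp: carrier_quotient coset_add coset_zero_eq a_ac)
  show "Group.monoid Q"
    by (rule monoidI) (auto simp: carrier_quotient coset_mult coset_one m_assoc)
qed (auto simp: carrier_quotient coset_mult coset_add l_distr r_distr)

lemma star_algebra_quotient: "star_algebra Q"
  by (rule star_algebraI) 
    (auto simp: ring_quotient carrier_quotient coset_simps scale_add_left scale_add_right
      scale_scale scale_one smult_mult_left smult_mult_right invol_add invol_smult invol_mult)

lemma coset_pow:
  assumes "x \<in> carrier A"
  shows "(J +> x) [^]\<^bsub>Q\<^esub> (n::nat) = J +> (x [^] n)"
proof -
  interpret Q: star_algebra Q by (rule star_algebra_quotient)
  show ?thesis
    by (induction n) (simp_all add: assms coset_one coset_mult)
qed

lemma quotient_trace_coset:
  assumes x: "x \<in> carrier A"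
    and \<sigma>: "\<And>y z. \<lbrakk>y \<in> carrier A; z \<in> carrier A; y \<ominus> z \<in> J\<rbrakk> \<Longrightarrow> \<sigma> y = \<sigma> z"
  shows "quotient_trace \<sigma> (J +> x) = \<sigma> x"
proof -
  have "\<sigma> z = \<sigma> x" if "z \<in> J +> x" for z
    using that x by (intro \<sigma> coset_carrier[of x z] coset_diff)
  then have "\<sigma> ` (J +> x) = {\<sigma> x}"
    using a_rcos_self[OF x] by blast
  then show ?thesis by (simp add: quotient_trace_def)
qed

lemma tracial_star_algebra_quotient:
  assumes "tracial_star_algebra A \<sigma>"
    and \<sigma>: "\<And>y z. \<lbrakk>y \<in> carrier A; z \<in> carrier A; y \<ominus> z \<in> J\<rbrakk> \<Longrightarrow> \<sigma> y = \<sigma> z"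
  shows "tracial_star_algebra Q (quotient_trace \<sigma>)"
proof -
  interpret T: tracial_star_algebra A \<sigma> by fact
  show ?thesis
    by (intro tracial_star_algebra.intro star_algebra_quotient tracial_star_algebra_axioms.intro)
      (auto simp: carrier_quotient coset_simps quotient_trace_coset[OF _ \<sigma>] T.trace_add
        T.trace_smult T.trace_one T.trace_pos intro: T.trace_commute)
qed

end

lemma (in tracial_star_algebra) star_ideal_null_ideal: "star_ideal A (null_ideal A \<tau>)"
  by (intro star_ideal.intro star_algebra_axioms ideal_null_ideal star_ideal_axioms.intro
      invol_null_ideal)

text \<open>Since both maps preserve the trace of C, the kernel of \<open>\<pi>\<close> is sent by
  \<open>\<psi>\<close> into the null ideal of B. So the factorization through A exists only after
  dividing by that ideal, not for \<open>\<psi>\<close> itself in general.\<close>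

lemma tracial_hom_factor:
  assumes "tracial_star_algebra A \<tau>" "tracial_star_algebra B \<rho>"
    and \<pi>: "tracial_hom C \<sigma> A \<tau> \<pi>" and \<psi>: "tracial_hom C \<sigma> B \<rho> \<psi>"
    and surj: "\<pi> ` carrier C = carrier A"
  shows "\<exists>\<phi>. tracial_hom A \<tau> (quotient_star_algebra B (null_ideal B \<rho>)) (quotient_trace \<rho>) \<phi>"
proof -
  interpret A: tracial_star_algebra A \<tau> by fact
  interpret B: tracial_star_algebra B \<rho> by fact
  interpret C: tracial_hom C \<sigma> A \<tau> \<pi> by fact
  interpret C': tracial_hom C \<sigma> B \<rho> \<psi> by fact
  interpret J: star_ideal B "null_ideal B \<rho>" by (rule B.star_ideal_null_ideal)
  have hom [simp]: "\<pi> x \<in> carrier A" "\<psi> x \<in> carrier B" if "x \<in> carrier C" for x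
    using that C.ring_hom C'.ring_hom by (auto simp: Ring.ring_hom_def)
  note hom_rules [simp] = Ring.ring_hom_add[OF C.ring_hom] Ring.ring_hom_mult[OF C.ring_hom]
    Ring.ring_hom_one[OF C.ring_hom] Ring.ring_hom_add[OF C'.ring_hom]
    Ring.ring_hom_mult[OF C'.ring_hom] Ring.ring_hom_one[OF C'.ring_hom]
    C.hom_smult C'.hom_smult C.hom_invol C'.hom_invol
  define q where "q = (\<lambda>b. null_ideal B \<rho> +>\<^bsub>B\<^esub> b)"
  have eq: "q (\<psi> x) = q (\<psi> y)" if xy: "x \<in> carrier C" "y \<in> carrier C" "\<pi> x = \<pi> y" for x y
  proof -
    define z where "z = x \<oplus>\<^bsub>C\<^esub> (- 1) \<odot>\<^bsub>C\<^esub> y"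
    have z: "z \<in> carrier C" using xy by (simp add: z_def)
    have "\<pi> z = \<zero>\<^bsub>A\<^esub>"
      using xy by (simp add: z_def A.r_neg A.minus_eq_scale[symmetric])
    then have 0: "\<tau> (invol A (\<pi> z) \<otimes>\<^bsub>A\<^esub> \<pi> z) = 0" by simp
    have "\<rho> (invol B (\<psi> z) \<otimes>\<^bsub>B\<^esub> \<psi> z) = \<sigma> (invol C z \<otimes>\<^bsub>C\<^esub> z)"
      using z C'.hom_trace[of "invol C z \<otimes>\<^bsub>C\<^esub> z"] by simp
    also have "\<dots> = \<tau> (invol A (\<pi> z) \<otimes>\<^bsub>A\<^esub> \<pi> z)"
      using z C.hom_trace[of "invol C z \<otimes>\<^bsub>C\<^esub> z"] by simp
    also note 0
    finally have null: "\<psi> z \<in> null_ideal B \<rho>"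
      unfolding null_ideal_def using hom(2)[OF z] by blast
    have "\<psi> z = \<psi> x \<oplus>\<^bsub>B\<^esub> (- 1) \<odot>\<^bsub>B\<^esub> \<psi> y"
      using xy(1,2) by (simp add: z_def)
    also have "\<dots> = \<psi> x \<ominus>\<^bsub>B\<^esub> \<psi> y"
      using xy(1,2) by (simp only: a_minus_def B.minus_eq_scale[OF hom(2)])
    finally have "\<psi> z = \<psi> x \<ominus>\<^bsub>B\<^esub> \<psi> y" .
    with null show ?thesis
      unfolding q_def by (subst J.coset_eq_iff[OF hom(2) hom(2), OF xy(1,2)]) simp
  qed
  have surj': "\<exists>x. x \<in> carrier C \<and> \<pi> x = a" if "a \<in> carrier A" for a
    using that unfolding surj[symmetric] by blast
  \<comment> \<open>An arbitrary choice of preimages, not assumed compatible with any operation;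
    \<open>eq\<close> makes the resulting class independent of it.\<close>
  define r where "r = (\<lambda>a. SOME x. x \<in> carrier C \<and> \<pi> x = a)"
  have r: "r a \<in> carrier C" "\<pi> (r a) = a" if "a \<in> carrier A" for a
    using someI_ex[OF surj'[OF that]] by (auto simp: r_def)
  define \<phi> where "\<phi> = (\<lambda>a. q (\<psi> (r a)))"
  have \<phi>: "\<phi> (\<pi> x) = q (\<psi> x)" if "x \<in> carrier C" for x
    unfolding \<phi>_def by (rule eq) (use that r[of "\<pi> x"] in simp_all)
  have "tracial_hom A \<tau> J.Q (quotient_trace \<rho>) \<phi>"
  proof (intro tracial_hom.intro tracial_hom_axioms.intro assms)
    show "tracial_star_algebra J.Q (quotient_trace \<rho>)"
      by (rule J.tracial_star_algebra_quotient[OF B.tracial_star_algebra_axioms B.trace_cong])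
    show "\<phi> \<in> Ring.ring_hom A J.Q"
    proof (rule ring_hom_memI)
      fix a b assume a: "a \<in> carrier A" and b: "b \<in> carrier A"
      from surj'[OF a] surj'[OF b] obtain x y where [simp]: "x \<in> carrier C" "y \<in> carrier C"
        and xy: "a = \<pi> x" "b = \<pi> y" by blast
      show "\<phi> (a \<otimes>\<^bsub>A\<^esub> b) = \<phi> a \<otimes>\<^bsub>J.Q\<^esub> \<phi> b"
        using \<phi>[of "x \<otimes>\<^bsub>C\<^esub> y"] by (simp add: \<phi> xy q_def J.coset_simps)
      show "\<phi> (a \<oplus>\<^bsub>A\<^esub> b) = \<phi> a \<oplus>\<^bsub>J.Q\<^esub> \<phi> b"
        using \<phi>[of "x \<oplus>\<^bsub>C\<^esub> y"] by (simp add: \<phi> xy q_def J.coset_simps)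
    next
      show "\<phi> a \<in> carrier J.Q" if "a \<in> carrier A" for a
        using that hom(2)[OF r(1)] by (simp add: \<phi>_def J.carrier_quotient q_def)
      show "\<phi> \<one>\<^bsub>A\<^esub> = \<one>\<^bsub>J.Q\<^esub>"
        using \<phi>[of "\<one>\<^bsub>C\<^esub>"] by (simp add: q_def J.coset_simps)
    qed
    fix a assume a: "a \<in> carrier A"
    from surj'[OF a] obtain x where x [simp]: "x \<in> carrier C" and a: "a = \<pi> x" by blast
    show "\<phi> (c \<odot>\<^bsub>A\<^esub> a) = c \<odot>\<^bsub>J.Q\<^esub> \<phi> a" for c
      using \<phi>[of "c \<odot>\<^bsub>C\<^esub> x"] by (simp add: a \<phi> q_def J.coset_simps)
    show "\<phi> (invol A a) = invol J.Q (\<phi> a)"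
      using \<phi>[of "invol C x"] by (simp add: a \<phi> q_def J.coset_simps)
    show "quotient_trace \<rho> (\<phi> a) = \<tau> a"
      using C.hom_trace[of x] C'.hom_trace[of x]
      by (simp add: a \<phi> q_def J.quotient_trace_coset[OF _ B.trace_cong])
  qed
  then show ?thesis by blast
qed

section \<open>A chessboard estimate\<close>

definition list_mult :: "('a, 'b) monoid_scheme \<Rightarrow> 'a list \<Rightarrow> 'a"
  where "list_mult G w = foldr (\<lambda>x y. x \<otimes>\<^bsub>G\<^esub> y) w \<one>\<^bsub>G\<^esub>"

lemma list_mult_Nil [simp]: "list_mult G [] = \<one>\<^bsub>G\<^esub>"
  by (simp add: list_mult_def)

lemma list_mult_Cons [simp]: "list_mult G (x # w) = x \<otimes>\<^bsub>G\<^esub> list_mult G w"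
  by (simp add: list_mult_def)

context Group.monoid
begin

lemma list_mult_closed [simp, intro]: "w \<in> lists (carrier G) \<Longrightarrow> list_mult G w \<in> carrier G"
  by (induction w) auto

lemma list_mult_append:
  "\<lbrakk>u \<in> lists (carrier G); v \<in> lists (carrier G)\<rbrakk>
    \<Longrightarrow> list_mult G (u @ v) = list_mult G u \<otimes> list_mult G v"
  by (induction u) (auto simp: m_assoc list_mult_closed)

lemma list_mult_concat_replicate:
  assumes "u \<in> lists (carrier G)"
  shows "list_mult G (concat (replicate q u)) = list_mult G u [^] q"
proof (induction q)
  case (Suc q)
  have "concat (replicate q u) \<in> lists (carrier G)" using assms by (induction q) auto
  then show ?case
    using Suc assms by (simp add: list_mult_append nat_pow_comm[of "list_mult G u" q 1, simplified])
qed simp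

lemma nat_pow_mult_rotate:
  assumes [simp]: "x \<in> carrier G" "y \<in> carrier G"
  shows "(x \<otimes> y) [^] Suc q = x \<otimes> ((y \<otimes> x) [^] q \<otimes> y)"
proof (induction q)
  case (Suc q)
  have "(x \<otimes> y) [^] Suc (Suc q) = (x \<otimes> ((y \<otimes> x) [^] q \<otimes> y)) \<otimes> (x \<otimes> y)"
    using Suc by simp
  also have "\<dots> = x \<otimes> ((y \<otimes> x) [^] Suc q \<otimes> y)"
    by (simp add: m_assoc)
  finally show ?case .
qed simp

end

context star_algebra
begin

lemma invol_list_mult:
  "w \<in> lists (carrier A) \<Longrightarrow> invol A (list_mult A w) = list_mult A (rev (map (invol A) w))"
proof (induction w)
  case (Cons x w)
  moreover have "rev (map (invol A) w) \<in> lists (carrier A)" using Cons by auto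
  ultimately show ?case
    by (simp add: invol_mult list_mult_append)
qed simp

lemma invol_pow: "x \<in> carrier A \<Longrightarrow> invol A (x [^] (n::nat)) = invol A x [^] n"
proof (induction n)
  case (Suc n)
  then show ?case using nat_pow_comm[of "invol A x" n 1] by (simp add: invol_mult)
qed simp

fun alternating :: "nat \<Rightarrow> 'a \<Rightarrow> 'a list" where
  "alternating 0 z = []"
| "alternating (Suc m) z = z # alternating m (invol A z)"

lemma length_alternating [simp]: "length (alternating m z) = m"
  by (induction m arbitrary: z) auto

lemma alternating_in_lists:
  "\<lbrakk>z \<in> F; \<And>z. z \<in> F \<Longrightarrow> invol A z \<in> F\<rbrakk> \<Longrightarrow> alternating m z \<in> lists F"
  by (induction m arbitrary: z) auto

lemma alternating_add:
  "z \<in> carrier A \<Longrightarrow>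
    alternating (m + n) z = alternating m z @ alternating n (if even m then z else invol A z)"
  by (induction m arbitrary: z) auto

lemma alternating_reflect:
  assumes "z \<in> carrier A"
  shows "rev (map (invol A) (alternating m z)) = alternating m (if even m then z else invol A z)"
  using assms
proof (induction m arbitrary: z)
  case (Suc m)
  let ?z = "if even m then invol A z else z"
  have "rev (map (invol A) (alternating (Suc m) z)) = alternating m ?z @ [invol A z]"
    using Suc by simp
  also have "\<dots> = alternating (m + 1) ?z"
    using Suc.prems by (subst alternating_add) auto
  finally show ?case by simp
qed simp

text \<open>The reflected run ends in the adjoint of the letter with which the run starts, so the
  alternation continues across the seam.\<close>

lemma alternating_reflect_append:
  assumes "z \<in> carrier A"
  shows "rev (map (invol A) (alternating m z)) @ alternating m z =
    alternating (2 * m) (if even m then z else invol A z)"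
  using assms alternating_add[of "if even m then z else invol A z" m m]
  by (simp add: alternating_reflect mult_2)

lemma list_mult_alternating:
  "z \<in> carrier A \<Longrightarrow> list_mult A (alternating (2 * m) z) = (z \<otimes> invol A z) [^] m"
proof (induction m)
  case (Suc m)
  have *: "alternating (2 * m) z \<in> lists (carrier A)"
    using Suc.prems by (intro alternating_in_lists) auto
  have "alternating (2 * Suc m) z = [z, invol A z] @ alternating (2 * m) z"
    using Suc.prems by simp
  then show ?case
    using Suc * nat_pow_comm[of "z \<otimes> invol A z" m 1] by (simp add: m_assoc)
qed simp

end

context tracial_star_algebra
begin

lemma trace_rotate:
  "\<lbrakk>u \<in> lists (carrier A); v \<in> lists (carrier A)\<rbrakk>
    \<Longrightarrow> \<tau> (list_mult A (u @ v)) = \<tau> (list_mult A (v @ u))"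
  by (simp add: list_mult_append trace_commute)

lemma trace_pow_mult_commute:
  assumes "x \<in> carrier A" "y \<in> carrier A"
  shows "\<tau> ((x \<otimes> y) [^] (q::nat)) = \<tau> ((y \<otimes> x) [^] q)"
proof (cases q)
  case (Suc n)
  have "\<tau> ((x \<otimes> y) [^] Suc n) = \<tau> (((y \<otimes> x) [^] n \<otimes> y) \<otimes> x)"
    unfolding nat_pow_mult_rotate[OF assms] using assms by (intro trace_commute) auto
  also have "\<dots> = \<tau> ((y \<otimes> x) [^] Suc n)"
    using assms by (simp add: m_assoc)
  finally show ?thesis using Suc by simp
qed simp

text \<open>By Cauchy-Schwarz, replacing a word of maximal absolute trace by the reflection of its first half
  followed by this half keeps the trace maximal, and up to rotation it doubles an alternating run
  at the beginning.\<close>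

lemma chessboard_estimate:
  assumes "finite F" "F \<subseteq> carrier A" and F: "\<And>z. z \<in> F \<Longrightarrow> invol A z \<in> F"
    and "h \<ge> 1" "F \<noteq> {}"
  obtains z where "z \<in> F"
    "\<And>w. \<lbrakk>w \<in> lists F; length w = 2 * h\<rbrakk>
      \<Longrightarrow> cmod (\<tau> (list_mult A w)) \<le> cmod (\<tau> ((invol A z \<otimes> z) [^] h))"
proof -
  define W where "W = {w \<in> lists F. length w = 2 * h}"
  define t where "t = (\<lambda>w. cmod (\<tau> (list_mult A w)))"
  define M where "M = Max (t ` W)"
  have lists: "lists F \<subseteq> lists (carrier A)" using assms(2) by (rule lists_mono)
  have finW: "finite W"
    using finite_lists_length_eq[OF assms(1), of "2 * h"] by (simp add: W_def in_lists_conv_set subset_eq)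
  obtain z0 where z0: "z0 \<in> F" using assms by auto
  then have "replicate (2 * h) z0 \<in> W" by (auto simp: W_def)
  then have W_ne: "W \<noteq> {}" by blast
  have le_M: "t w \<le> M" if "w \<in> W" for w
    unfolding M_def using that finW by simp
  have M0: "0 \<le> M"
    using W_ne le_M by (force simp: t_def intro: order_trans[OF norm_ge_zero])
  have rev_F: "rev (map (invol A) u) \<in> lists F" if "u \<in> lists F" for u
    using that F by auto
  \<comment> \<open>\<open>P r\<close> says that some word of maximal absolute trace begins with an
    alternating run of r letters; the letter z may change from one r to the next.\<close>
  define P where "P = (\<lambda>r. \<exists>z v. z \<in> F \<and> v \<in> lists F \<and> r + length v = 2 * h \<and>
    t (alternating r z @ v) = M)"
  have reflect: "t (rev (map (invol A) u) @ u) = M"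
    if u: "u \<in> lists F" "length u = h" and v: "v \<in> lists F" "length v = h"
      and M: "t (u @ v) = M" for u v
  proof -
    let ?U = "list_mult A u" and ?V = "list_mult A v"
    have c: "u \<in> lists (carrier A)" "v \<in> lists (carrier A)" using lists u v by blast+
    then have [simp]: "?U \<in> carrier A" "?V \<in> carrier A" by auto
    have inW: "rev (map (invol A) u) @ u \<in> W" "rev (map (invol A) v) @ v \<in> W"
      using u v rev_F by (auto simp: W_def)
    have sq: "t (rev (map (invol A) x) @ x) = cmod (\<tau> (invol A (list_mult A x) \<otimes> list_mult A x))"
      if "x \<in> lists F" for x
      using that lists rev_F[of x] by (subst invol_list_mult) (auto simp: t_def list_mult_append subset_eq)
    \<comment> \<open>Cauchy-Schwarz is applied to the adjoint of U, so that the mixed term is U V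
      itself; cyclicity then exchanges the factors in the square of that adjoint.\<close>
    have "M\<^sup>2 = (cmod (\<tau> (invol A (invol A ?U) \<otimes> ?V)))\<^sup>2"
      using c by (simp add: M[symmetric] t_def list_mult_append)
    also have "\<dots> \<le> Re (\<tau> (invol A (invol A ?U) \<otimes> invol A ?U)) * Re (\<tau> (invol A ?V \<otimes> ?V))"
      by (rule trace_Cauchy_Schwarz) auto
    also have "\<tau> (invol A (invol A ?U) \<otimes> invol A ?U) = \<tau> (invol A ?U \<otimes> ?U)"
      by (simp add: trace_commute)
    also have "Re (\<tau> (invol A ?U \<otimes> ?U)) * Re (\<tau> (invol A ?V \<otimes> ?V)) \<le>
      t (rev (map (invol A) u) @ u) * t (rev (map (invol A) v) @ v)"
      unfolding sq[OF u(1)] sq[OF v(1)] using trace_pos_Re[of ?U] trace_pos_Re[of ?V]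
      by (intro mult_mono complex_Re_le_cmod) auto
    also have "\<dots> \<le> t (rev (map (invol A) u) @ u) * M"
      using le_M[OF inW(2)] by (intro mult_left_mono) (auto simp: t_def)
    finally have "M * M \<le> t (rev (map (invol A) u) @ u) * M" by (simp add: power2_eq_square)
    moreover have "0 \<le> t (rev (map (invol A) u) @ u)" by (simp add: t_def)
    ultimately have "M \<le> t (rev (map (invol A) u) @ u)"
      using M0 by (cases "M = 0") auto
    with le_M[OF inW(1)] show ?thesis by simp
  qed
  \<comment> \<open>The first half is completed to a v1 with the run a in front. Its reflection
    gives v1* a* a v1, and rotating v1* to the end puts the run a* a, twice as long, in
    front.\<close>
  have double: "P (2 * r)" if "P r" "r \<le> h" for r
  proof -
    obtain z v where z: "z \<in> F" and v: "v \<in> lists F" "r + length v = 2 * h"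
      and M: "t (alternating r z @ v) = M"
      using \<open>P r\<close> by (auto simp: P_def)
    define v1 where "v1 = take (h - r) v"
    define v2 where "v2 = drop (h - r) v"
    let ?a = "alternating r z"
    let ?z = "if even r then z else invol A z"
    have a: "?a \<in> lists F" using z F by (intro alternating_in_lists) auto
    have v12: "v1 \<in> lists F" "v2 \<in> lists F"
      using v(1) by (auto simp: v1_def v2_def dest: in_set_takeD in_set_dropD)
    have "t (rev (map (invol A) (?a @ v1)) @ (?a @ v1)) = M"
      by (rule reflect[of _ v2]) (use a v12 v \<open>r \<le> h\<close> M in \<open>auto simp: v1_def v2_def\<close>)
    moreover have "t (rev (map (invol A) (?a @ v1)) @ (?a @ v1)) =
        t ((rev (map (invol A) ?a) @ ?a @ v1) @ rev (map (invol A) v1))"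
    proof -
      have "rev (map (invol A) v1) \<in> lists (carrier A)"
        "rev (map (invol A) ?a) @ ?a @ v1 \<in> lists (carrier A)"
        using rev_F[OF v12(1)] rev_F[OF a] a v12 lists by auto
      from trace_rotate[OF this] show ?thesis by (simp add: t_def)
    qed
    moreover have "rev (map (invol A) ?a) @ ?a = alternating (2 * r) ?z"
      using z assms(2) by (intro alternating_reflect_append) auto
    then have "(rev (map (invol A) ?a) @ ?a @ v1) @ rev (map (invol A) v1) =
        alternating (2 * r) ?z @ v1 @ rev (map (invol A) v1)"
      by (metis append.assoc)
    ultimately have "t (alternating (2 * r) ?z @ v1 @ rev (map (invol A) v1)) = M"
      by (simp only:)
    moreover have "?z \<in> F" using z F by simp
    moreover have "v1 @ rev (map (invol A) v1) \<in> lists F" using v12 rev_F by auto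
    moreover have "2 * r + length (v1 @ rev (map (invol A) v1)) = 2 * h"
      using v \<open>r \<le> h\<close> by (simp add: v1_def)
    ultimately show ?thesis unfolding P_def by blast
  qed
  have shrink: "P r" if P: "P (r + s)" for r s
  proof -
    obtain z v where z: "z \<in> F" and v: "v \<in> lists F" "r + s + length v = 2 * h"
      and M: "t (alternating (r + s) z @ v) = M"
      using P unfolding P_def by blast
    let ?b = "alternating s (if even r then z else invol A z)"
    have "alternating (r + s) z = alternating r z @ ?b"
      using z assms(2) by (intro alternating_add) auto
    moreover have "?b \<in> lists F" using z F by (intro alternating_in_lists) auto
    ultimately show ?thesis
      unfolding P_def using z v M by (intro exI[of _ z] exI[of _ "?b @ v"]) auto
  qed
  \<comment> \<open>Doubling needs a run of at most h letters, and h need not be a power of two.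
    Doubling and then shrinking gains one letter at a time up to h; one last doubling fills the
    whole word.\<close>
  have P_le: "P (Suc r)" if "Suc r \<le> h" for r
    using that
  proof (induction r)
    case 0
    have "M \<in> t ` W" unfolding M_def using finW W_ne by (intro Max_in) auto
    then obtain w where w: "w \<in> W" "t w = M" by auto
    then obtain x v where "w = x # v" using \<open>h \<ge> 1\<close> by (cases w) (auto simp: W_def)
    then show ?case
      using w by (auto simp: P_def W_def intro!: exI[of _ x] exI[of _ v])
  next
    case (Suc r)
    then have "P (2 * Suc r)" by (intro double) auto
    also have "2 * Suc r = Suc (Suc r) + r" by simp
    finally show ?case by (rule shrink)
  qed
  have "P (2 * h)" using P_le[of "h - 1"] \<open>h \<ge> 1\<close> by (intro double) auto
  then obtain z where z: "z \<in> F" and zM: "t (alternating (2 * h) z) = M" by (auto simp: P_def)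
  have zc: "z \<in> carrier A" using z assms(2) by auto
  have "M = cmod (\<tau> ((invol A (invol A z) \<otimes> invol A z) [^] h))"
    using zc by (simp add: zM[symmetric] t_def list_mult_alternating)
  moreover have "invol A z \<in> F" using z by (rule F)
  ultimately show ?thesis
    using le_M by (intro that[of "invol A z"]) (auto simp: W_def t_def)
qed

end

section \<open>Metric ultraproducts\<close>

lemma (in tracial_star_algebra) trace_pow_real:
  assumes [simp]: "x \<in> carrier A"
  shows "\<tau> ((invol A x \<otimes> x) [^] (q::nat)) = of_real (Re (\<tau> ((invol A x \<otimes> x) [^] q)))"
proof -
  have "cnj (\<tau> ((invol A x \<otimes> x) [^] q)) = \<tau> ((invol A x \<otimes> x) [^] q)"
    by (simp add: trace_invol[symmetric] invol_pow invol_mult)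
  then show ?thesis by (simp add: complex_eq_iff)
qed

text \<open>\<open>root p\<close> is an odd function even for even p, so it commutes with absolute
  values; it is enough to know that the moment is real.\<close>

lemma (in tracial_star_algebra) abs_trace_norm_power:
  assumes x: "x \<in> carrier A" and p: "0 < p"
  shows "\<bar>trace_norm A \<tau> p x\<bar> ^ p = cmod (\<tau> ((invol A x \<otimes> x) [^] (p div 2)))"
proof -
  have "\<bar>trace_norm A \<tau> p x\<bar> = root p \<bar>Re (\<tau> ((invol A x \<otimes> x) [^] (p div 2)))\<bar>"
    using p by (simp add: trace_norm_def real_root_abs)
  then show ?thesis
    using p trace_pow_real[OF x, of "p div 2"] by (metis abs_ge_zero norm_of_real real_root_pow_pos2)
qed

lemma bounded_image_power_iff:
  fixes f :: "'i \<Rightarrow> real"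
  assumes "0 < p"
  shows "bounded (f ` I) \<longleftrightarrow> (\<exists>C. \<forall>i\<in>I. \<bar>f i\<bar> ^ p \<le> C)"
proof
  assume "bounded (f ` I)"
  then obtain B where "\<forall>i\<in>I. \<bar>f i\<bar> \<le> B" by (auto simp: bounded_iff)
  then have "\<forall>i\<in>I. \<bar>f i\<bar> ^ p \<le> B ^ p" by (auto intro!: power_mono)
  then show "\<exists>C. \<forall>i\<in>I. \<bar>f i\<bar> ^ p \<le> C" by blast
next
  assume "\<exists>C. \<forall>i\<in>I. \<bar>f i\<bar> ^ p \<le> C"
  then obtain C where C: "\<forall>i\<in>I. \<bar>f i\<bar> ^ p \<le> C" by blast
  have "\<bar>f i\<bar> \<le> max 1 C" if "i \<in> I" for i
  proof (cases "\<bar>f i\<bar> \<le> 1")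
    case False
    then have "\<bar>f i\<bar> ^ 1 \<le> \<bar>f i\<bar> ^ p" using assms by (intro power_increasing) auto
    then show ?thesis using C that by fastforce
  qed simp
  then show "bounded (f ` I)" by (auto simp: bounded_iff)
qed

text \<open>Compactness gives a cluster point, and an ultrafilter converges to each of its cluster
  points.\<close>

lemma ultrafilter_on_tendsto:
  fixes f :: "'i \<Rightarrow> 'b::heine_borel"
  assumes \<omega>: "ultrafilter_on I \<omega>" and "bounded (f ` I)"
  obtains l where "(f \<longlongrightarrow> l) \<omega>"
proof -
  let ?K = "closure (f ` I)"
  have "compact ?K" using assms(2) by (simp add: compact_closure)
  moreover have "filtermap f \<omega> \<noteq> bot"
    using \<omega> by (simp add: ultrafilter_on_def filtermap_bot_iff)
  moreover have "eventually (\<lambda>x. x \<in> ?K) (filtermap f \<omega>)"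
  proof -
    have "\<forall>\<^sub>F i in \<omega>. i \<in> I" using \<omega> by (simp add: ultrafilter_on_def)
    then have "\<forall>\<^sub>F i in \<omega>. f i \<in> ?K"
      by eventually_elim (use closure_subset in fast)
    then show ?thesis by (simp add: eventually_filtermap)
  qed
  ultimately obtain l where l: "inf (nhds l) (filtermap f \<omega>) \<noteq> bot"
    using compact_filter by blast
  have "eventually P (filtermap f \<omega>)" if P: "eventually P (nhds l)" for P
  proof (rule ccontr)
    assume "\<not> eventually P (filtermap f \<omega>)"
    then have "eventually (\<lambda>x. \<not> P x) (filtermap f \<omega>)"
      using \<omega> unfolding ultrafilter_on_def eventually_filtermap by meson
    then have "eventually (\<lambda>x. False) (inf (nhds l) (filtermap f \<omega>))"
      using P unfolding eventually_inf by blast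
    then show False using l by (simp add: trivial_limit_def)
  qed
  then have "(f \<longlongrightarrow> l) \<omega>"
    unfolding filterlim_def le_filter_def by blast
  then show ?thesis by (rule that)
qed

section \<open>The bounded product of a family and its limit trace\<close>

locale tracial_family =
  fixes I :: "'i set" and A :: "'i \<Rightarrow> 'a star_algebra" and \<tau> :: "'i \<Rightarrow> 'a \<Rightarrow> complex"
  assumes tracial: "i \<in> I \<Longrightarrow> tracial_star_algebra (A i) (\<tau> i)"
begin

abbreviation B where "B \<equiv> bounded_product I A \<tau>"

text \<open>The bounds on the p-norms with the roots removed and p = 2 * q: this is the form in
  which the chessboard estimate can be used.\<close>

definition moment_bounded :: "('i \<Rightarrow> 'a) \<Rightarrow> bool"
  where "moment_bounded a \<longleftrightarrow>
    (\<forall>q\<ge>1. \<exists>C. \<forall>i\<in>I. cmod (\<tau> i ((invol (A i) (a i) \<otimes>\<^bsub>A i\<^esub> a i) [^]\<^bsub>A i\<^esub> (q::nat))) \<le> C)"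

lemma carrier_bounded_product:
  "a \<in> carrier B \<longleftrightarrow> a \<in> (\<Pi>\<^sub>E i\<in>I. carrier (A i)) \<and> moment_bounded a"
proof -
  have "(\<forall>p\<ge>2. even p \<longrightarrow> bounded ((\<lambda>i. trace_norm (A i) (\<tau> i) p (a i)) ` I)) \<longleftrightarrow> moment_bounded a"
    if a: "a \<in> (\<Pi>\<^sub>E i\<in>I. carrier (A i))"
  proof -
    define R where "R = (\<lambda>q::nat. \<exists>C. \<forall>i\<in>I.
      cmod (\<tau> i ((invol (A i) (a i) \<otimes>\<^bsub>A i\<^esub> a i) [^]\<^bsub>A i\<^esub> q)) \<le> C)"
    have eq: "bounded ((\<lambda>i. trace_norm (A i) (\<tau> i) p (a i)) ` I) \<longleftrightarrow> R (p div 2)" if "p \<ge> 2" for p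
    proof -
      have "\<bar>trace_norm (A i) (\<tau> i) p (a i)\<bar> ^ p =
          cmod (\<tau> i ((invol (A i) (a i) \<otimes>\<^bsub>A i\<^esub> a i) [^]\<^bsub>A i\<^esub> (p div 2)))" if "i \<in> I" for i
        using a that \<open>p \<ge> 2\<close>
        by (intro tracial_star_algebra.abs_trace_norm_power[OF tracial]) (auto simp: PiE_mem)
      then show ?thesis
        using that by (simp add: bounded_image_power_iff[of p] R_def cong: ball_cong)
    qed
    have "(\<forall>p\<ge>2. even p \<longrightarrow> R (p div 2)) \<longleftrightarrow> (\<forall>q\<ge>1. R q)"
    proof safe
      fix q :: nat assume "\<forall>p\<ge>2. even p \<longrightarrow> R (p div 2)" "1 \<le> q"
      from this(1)[rule_format, of "2 * q"] this(2) show "R q" by simp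
    qed auto
    moreover have "moment_bounded a \<longleftrightarrow> (\<forall>q\<ge>1. R q)" by (simp add: moment_bounded_def R_def)
    ultimately show ?thesis using eq by simp
  qed
  then show ?thesis by (auto simp: bounded_product_def)
qed

text \<open>The chessboard estimate, applied for each index to the same four letters, ends in a
  moment of one of them. A letter and its adjoint have equal moments, so the moments of a and b
  provide a bound uniform in the index.\<close>

lemma words_bounded:
  assumes "a \<in> carrier B" "b \<in> carrier B" "1 \<le> h"
  obtains C where "\<And>i w. \<lbrakk>i \<in> I; w \<in> lists {a i, b i, invol (A i) (a i), invol (A i) (b i)};
      length w = 2 * h\<rbrakk> \<Longrightarrow> cmod (\<tau> i (list_mult (A i) w)) \<le> C"
proof -
  obtain C1 C2
    where C1: "\<And>i. i \<in> I \<Longrightarrow> cmod (\<tau> i ((invol (A i) (a i) \<otimes>\<^bsub>A i\<^esub> a i) [^]\<^bsub>A i\<^esub> h)) \<le> C1"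
      and C2: "\<And>i. i \<in> I \<Longrightarrow> cmod (\<tau> i ((invol (A i) (b i) \<otimes>\<^bsub>A i\<^esub> b i) [^]\<^bsub>A i\<^esub> h)) \<le> C2"
    using assms unfolding carrier_bounded_product moment_bounded_def by meson
  have "cmod (\<tau> i (list_mult (A i) w)) \<le> max C1 C2"
    if i: "i \<in> I" and w: "w \<in> lists {a i, b i, invol (A i) (a i), invol (A i) (b i)}" "length w = 2 * h"
    for i w
  proof -
    interpret tracial_star_algebra "A i" "\<tau> i" using tracial i .
    have [simp]: "a i \<in> carrier (A i)" "b i \<in> carrier (A i)"
      using assms i by (auto simp: carrier_bounded_product)
    let ?F = "{a i, b i, invol (A i) (a i), invol (A i) (b i)}"
    obtain z where z: "z \<in> ?F" and "\<And>w. \<lbrakk>w \<in> lists ?F; length w = 2 * h\<rbrakk>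
        \<Longrightarrow> cmod (\<tau> i (list_mult (A i) w)) \<le> cmod (\<tau> i ((invol (A i) z \<otimes>\<^bsub>A i\<^esub> z) [^]\<^bsub>A i\<^esub> h))"
      by (rule chessboard_estimate[of ?F h]) (use assms in auto)
    from this(2)[OF w] z C1[OF i] C2[OF i] show ?thesis
      by (auto simp: trace_pow_mult_commute[of "a i"] trace_pow_mult_commute[of "b i"])
  qed
  then show ?thesis by (rule that)
qed

lemma bounded_product_simps:
  "a \<otimes>\<^bsub>B\<^esub> b = (\<lambda>i\<in>I. a i \<otimes>\<^bsub>A i\<^esub> b i)"
  "a \<oplus>\<^bsub>B\<^esub> b = (\<lambda>i\<in>I. a i \<oplus>\<^bsub>A i\<^esub> b i)"
  "c \<odot>\<^bsub>B\<^esub> a = (\<lambda>i\<in>I. c \<odot>\<^bsub>A i\<^esub> a i)"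
  "invol B a = (\<lambda>i\<in>I. invol (A i) (a i))"
  "\<one>\<^bsub>B\<^esub> = (\<lambda>i\<in>I. \<one>\<^bsub>A i\<^esub>)" "\<zero>\<^bsub>B\<^esub> = (\<lambda>i\<in>I. \<zero>\<^bsub>A i\<^esub>)"
  by (simp_all add: bounded_product_def)

lemma bounded_product_component [simp]: "\<lbrakk>a \<in> carrier B; i \<in> I\<rbrakk> \<Longrightarrow> a i \<in> carrier (A i)"
  by (auto simp: carrier_bounded_product)

lemma bounded_product_eqI:
  assumes "a \<in> carrier B" "b \<in> carrier B" "\<And>i. i \<in> I \<Longrightarrow> a i = b i"
  shows "a = b"
  using assms by (intro extensionalityI[of _ I]) (auto simp: carrier_bounded_product PiE_def)

lemma bounded_productI:
  assumes "\<And>i. i \<in> I \<Longrightarrow> f i \<in> carrier (A i)"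
    and "\<And>q. 1 \<le> q \<Longrightarrow>
      \<exists>C. \<forall>i\<in>I. cmod (\<tau> i ((invol (A i) (f i) \<otimes>\<^bsub>A i\<^esub> f i) [^]\<^bsub>A i\<^esub> (q::nat))) \<le> C"
  shows "(\<lambda>i\<in>I. f i) \<in> carrier B"
  using assms by (simp add: carrier_bounded_product moment_bounded_def cong: ball_cong)

lemma moments_bounded:
  "\<lbrakk>a \<in> carrier B; 1 \<le> q\<rbrakk> \<Longrightarrow>
    \<exists>C. \<forall>i\<in>I. cmod (\<tau> i ((invol (A i) (a i) \<otimes>\<^bsub>A i\<^esub> a i) [^]\<^bsub>A i\<^esub> (q::nat))) \<le> C"
  by (simp add: carrier_bounded_product moment_bounded_def)

lemma one_bounded_product: "\<one>\<^bsub>B\<^esub> \<in> carrier B"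
  unfolding bounded_product_simps
proof (rule bounded_productI)
  fix i assume "i \<in> I"
  then interpret tracial_star_algebra "A i" "\<tau> i" by (rule tracial)
  show "\<one>\<^bsub>A i\<^esub> \<in> carrier (A i)" by simp
next
  fix q :: nat
  have "cmod (\<tau> i ((invol (A i) \<one>\<^bsub>A i\<^esub> \<otimes>\<^bsub>A i\<^esub> \<one>\<^bsub>A i\<^esub>) [^]\<^bsub>A i\<^esub> q)) \<le> 1" if "i \<in> I" for i
  proof -
    interpret tracial_star_algebra "A i" "\<tau> i" using that by (rule tracial)
    show ?thesis by (simp add: trace_one)
  qed
  then show "\<exists>C. \<forall>i\<in>I. cmod (\<tau> i ((invol (A i) \<one>\<^bsub>A i\<^esub> \<otimes>\<^bsub>A i\<^esub> \<one>\<^bsub>A i\<^esub>) [^]\<^bsub>A i\<^esub> q)) \<le> C"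
    by blast
qed

lemma invol_bounded_product:
  assumes "a \<in> carrier B" shows "invol B a \<in> carrier B"
  unfolding bounded_product_simps
proof (rule bounded_productI)
  fix i assume i: "i \<in> I"
  then interpret tracial_star_algebra "A i" "\<tau> i" by (rule tracial)
  show "invol (A i) (a i) \<in> carrier (A i)" using assms i by simp
next
  fix q :: nat assume "1 \<le> q"
  have "\<tau> i ((invol (A i) (invol (A i) (a i)) \<otimes>\<^bsub>A i\<^esub> invol (A i) (a i)) [^]\<^bsub>A i\<^esub> q) =
      \<tau> i ((invol (A i) (a i) \<otimes>\<^bsub>A i\<^esub> a i) [^]\<^bsub>A i\<^esub> q)" if i: "i \<in> I" for i
  proof -
    interpret tracial_star_algebra "A i" "\<tau> i" using i by (rule tracial)
    show ?thesis using assms i by (simp add: trace_pow_mult_commute[of "a i"])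
  qed
  with moments_bounded[OF assms \<open>1 \<le> q\<close>]
  show "\<exists>C. \<forall>i\<in>I. cmod (\<tau> i ((invol (A i) (invol (A i) (a i)) \<otimes>\<^bsub>A i\<^esub> invol (A i) (a i)) [^]\<^bsub>A i\<^esub> q)) \<le> C"
    by simp
qed

text \<open>The q-th moment of a product is the trace of the q-fold repetition of b* a* a b, a word
  of length 4 q.\<close>

lemma mult_bounded_product:
  assumes "a \<in> carrier B" "b \<in> carrier B" shows "a \<otimes>\<^bsub>B\<^esub> b \<in> carrier B"
  unfolding bounded_product_simps
proof (rule bounded_productI)
  fix i assume i: "i \<in> I"
  then interpret tracial_star_algebra "A i" "\<tau> i" by (rule tracial)
  show "a i \<otimes>\<^bsub>A i\<^esub> b i \<in> carrier (A i)" using assms i by simp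
next
  fix q :: nat assume q: "1 \<le> q"
  obtain C where C: "\<And>i w. \<lbrakk>i \<in> I; w \<in> lists {a i, b i, invol (A i) (a i), invol (A i) (b i)};
      length w = 2 * (2 * q)\<rbrakk> \<Longrightarrow> cmod (\<tau> i (list_mult (A i) w)) \<le> C"
    by (rule words_bounded[OF assms, of "2 * q"]) (use q in auto)
  have "cmod (\<tau> i ((invol (A i) (a i \<otimes>\<^bsub>A i\<^esub> b i) \<otimes>\<^bsub>A i\<^esub> (a i \<otimes>\<^bsub>A i\<^esub> b i)) [^]\<^bsub>A i\<^esub> q)) \<le> C"
    if i: "i \<in> I" for i
  proof -
    interpret tracial_star_algebra "A i" "\<tau> i" using i by (rule tracial)
    have [simp]: "a i \<in> carrier (A i)" "b i \<in> carrier (A i)" using assms i by simp_all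
    define u where "u = [invol (A i) (b i), invol (A i) (a i), a i, b i]"
    have "invol (A i) (a i \<otimes>\<^bsub>A i\<^esub> b i) \<otimes>\<^bsub>A i\<^esub> (a i \<otimes>\<^bsub>A i\<^esub> b i) = list_mult (A i) u"
      by (simp add: u_def invol_mult m_assoc)
    moreover have "u \<in> lists (carrier (A i))" by (simp add: u_def)
    moreover have "cmod (\<tau> i (list_mult (A i) (concat (replicate q u)))) \<le> C"
    proof (rule C[OF i])
      show "concat (replicate q u) \<in> lists {a i, b i, invol (A i) (a i), invol (A i) (b i)}"
        by (induction q) (auto simp: u_def)
      show "length (concat (replicate q u)) = 2 * (2 * q)"
        by (simp add: length_concat sum_list_replicate u_def)
    qed
    ultimately show ?thesis by (simp add: list_mult_concat_replicate)
  qed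
  then show "\<exists>C. \<forall>i\<in>I.
      cmod (\<tau> i ((invol (A i) (a i \<otimes>\<^bsub>A i\<^esub> b i) \<otimes>\<^bsub>A i\<^esub> (a i \<otimes>\<^bsub>A i\<^esub> b i)) [^]\<^bsub>A i\<^esub> q)) \<le> C"
    by blast
qed

text \<open>Scaling is multiplication by the constant family c 1, whose q-th moment has modulus
  |c|^(2 q), so closure under products applies.\<close>

lemma scale_bounded_product:
  assumes "a \<in> carrier B" shows "c \<odot>\<^bsub>B\<^esub> a \<in> carrier B"
proof -
  have "(\<lambda>i\<in>I. c \<odot>\<^bsub>A i\<^esub> \<one>\<^bsub>A i\<^esub>) \<in> carrier B"
  proof (rule bounded_productI)
    fix i assume "i \<in> I"
    then interpret tracial_star_algebra "A i" "\<tau> i" by (rule tracial)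
    show "c \<odot>\<^bsub>A i\<^esub> \<one>\<^bsub>A i\<^esub> \<in> carrier (A i)" by simp
  next
    fix q :: nat
    have "cmod (\<tau> i ((invol (A i) (c \<odot>\<^bsub>A i\<^esub> \<one>\<^bsub>A i\<^esub>) \<otimes>\<^bsub>A i\<^esub> (c \<odot>\<^bsub>A i\<^esub> \<one>\<^bsub>A i\<^esub>)) [^]\<^bsub>A i\<^esub> q)) \<le>
        cmod ((cnj c * c) ^ q)" if "i \<in> I" for i
    proof -
      interpret tracial_star_algebra "A i" "\<tau> i" using that by (rule tracial)
      have 1: "(d \<odot>\<^bsub>A i\<^esub> \<one>\<^bsub>A i\<^esub>) [^]\<^bsub>A i\<^esub> q = d ^ q \<odot>\<^bsub>A i\<^esub> \<one>\<^bsub>A i\<^esub>" for d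
        by (induction q) (simp_all add: smult_mult_left smult_mult_right scale_one mult.commute
            flip: scale_scale)
      have "invol (A i) (c \<odot>\<^bsub>A i\<^esub> \<one>\<^bsub>A i\<^esub>) \<otimes>\<^bsub>A i\<^esub> (c \<odot>\<^bsub>A i\<^esub> \<one>\<^bsub>A i\<^esub>) = (cnj c * c) \<odot>\<^bsub>A i\<^esub> \<one>\<^bsub>A i\<^esub>"
        by (simp add: invol_smult smult_mult_left smult_mult_right mult.commute flip: scale_scale)
      then show ?thesis by (simp only: 1) (simp add: trace_smult trace_one)
    qed
    then show "\<exists>C. \<forall>i\<in>I. cmod (\<tau> i ((invol (A i) (c \<odot>\<^bsub>A i\<^esub> \<one>\<^bsub>A i\<^esub>) \<otimes>\<^bsub>A i\<^esub> (c \<odot>\<^bsub>A i\<^esub> \<one>\<^bsub>A i\<^esub>)) [^]\<^bsub>A i\<^esub> q)) \<le> C"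
      by blast
  qed
  from mult_bounded_product[OF this assms]
  have "(\<lambda>i\<in>I. (c \<odot>\<^bsub>A i\<^esub> \<one>\<^bsub>A i\<^esub>) \<otimes>\<^bsub>A i\<^esub> a i) \<in> carrier B"
    by (simp add: bounded_product_simps cong: restrict_cong)
  moreover have "(c \<odot>\<^bsub>A i\<^esub> \<one>\<^bsub>A i\<^esub>) \<otimes>\<^bsub>A i\<^esub> a i = c \<odot>\<^bsub>A i\<^esub> a i" if i: "i \<in> I" for i
  proof -
    interpret tracial_star_algebra "A i" "\<tau> i" using i by (rule tracial)
    show ?thesis using assms i by (intro scale_eq_mult[symmetric]) simp
  qed
  ultimately show ?thesis
    by (simp add: bounded_product_simps cong: restrict_cong)
qed

text \<open>Multiplying out the q-th moment of a + b yields 2^(2 q) words of length 2 q in the four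
  letters, and all of them obey the same bound.\<close>

lemma add_bounded_product:
  assumes "a \<in> carrier B" "b \<in> carrier B" shows "a \<oplus>\<^bsub>B\<^esub> b \<in> carrier B"
  unfolding bounded_product_simps
proof (rule bounded_productI)
  fix i assume i: "i \<in> I"
  then interpret tracial_star_algebra "A i" "\<tau> i" by (rule tracial)
  show "a i \<oplus>\<^bsub>A i\<^esub> b i \<in> carrier (A i)" using assms i by simp
next
  fix q :: nat assume q: "1 \<le> q"
  obtain C where C: "\<And>i w. \<lbrakk>i \<in> I; w \<in> lists {a i, b i, invol (A i) (a i), invol (A i) (b i)};
      length w = 2 * q\<rbrakk> \<Longrightarrow> cmod (\<tau> i (list_mult (A i) w)) \<le> C"
    by (rule words_bounded[OF assms q]) blast
  have "cmod (\<tau> i ((invol (A i) (a i \<oplus>\<^bsub>A i\<^esub> b i) \<otimes>\<^bsub>A i\<^esub> (a i \<oplus>\<^bsub>A i\<^esub> b i)) [^]\<^bsub>A i\<^esub> q)) \<le> 2 ^ (2 * q) * C"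
    if i: "i \<in> I" for i
  proof -
    interpret tracial_star_algebra "A i" "\<tau> i" using i by (rule tracial)
    have [simp]: "a i \<in> carrier (A i)" "b i \<in> carrier (A i)" using assms i by simp_all
    let ?F = "{a i, b i, invol (A i) (a i), invol (A i) (b i)}"
    define s where "s = a i \<oplus>\<^bsub>A i\<^esub> b i"
    have s [simp]: "s \<in> carrier (A i)" by (simp add: s_def)
    have sum: "\<exists>x\<in>?F. \<exists>y\<in>?F. z = x \<oplus>\<^bsub>A i\<^esub> y" if "z \<in> {s, invol (A i) s}" for z
      using that by (auto simp: s_def invol_add)
    have F: "lists ?F \<subseteq> lists (carrier (A i))" by (intro lists_mono) auto
    \<comment> \<open>Here u is the part already multiplied out and w the part in which a + b or its
      adjoint still stands at every place.\<close>
    have expand: "cmod (\<tau> i (list_mult (A i) (u @ w))) \<le> 2 ^ length w * C"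
      if "w \<in> lists {s, invol (A i) s}" "u \<in> lists ?F" "length u + length w = 2 * q" for u w
      using that
    proof (induction w arbitrary: u rule: list.induct)
      case Nil
      then show ?case using C[OF i, of u] by simp
    next
      case (Cons z w)
      have "z \<in> {s, invol (A i) s}" using Cons.prems(1) by simp
      from sum[OF this] obtain x y where x: "x \<in> ?F" and y: "y \<in> ?F"
        and z: "z = x \<oplus>\<^bsub>A i\<^esub> y" by blast
      have [simp]: "x \<in> carrier (A i)" "y \<in> carrier (A i)" using x y by auto
      have u [simp]: "u \<in> lists (carrier (A i))" using Cons.prems(2) F by blast
      have w [simp]: "w \<in> lists (carrier (A i))"
        using Cons.prems(1) by (auto simp: in_lists_conv_set)
      have [simp]: "list_mult (A i) u \<in> carrier (A i)" "list_mult (A i) w \<in> carrier (A i)"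
        using u w by blast+
      have *: "cmod (\<tau> i (list_mult (A i) ((u @ [v]) @ w))) \<le> 2 ^ length w * C" if "v \<in> ?F" for v
        by (rule Cons.IH) (use Cons.prems that in auto)
      have "\<tau> i (list_mult (A i) (u @ z # w)) =
          \<tau> i (list_mult (A i) ((u @ [x]) @ w)) + \<tau> i (list_mult (A i) ((u @ [y]) @ w))"
        by (simp add: list_mult_append z l_distr r_distr trace_add)
      then have "cmod (\<tau> i (list_mult (A i) (u @ z # w))) \<le> 2 ^ length w * C + 2 ^ length w * C"
        using norm_triangle_mono[OF *[OF x] *[OF y]] by simp
      then show ?case by (simp add: mult_ac)
    qed
    let ?w = "concat (replicate q [invol (A i) s, s])"
    have "?w \<in> lists {s, invol (A i) s}" by (induction q) auto
    moreover have len: "length ?w = 2 * q" by (simp add: length_concat sum_list_replicate)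
    ultimately have "cmod (\<tau> i (list_mult (A i) ?w)) \<le> 2 ^ (2 * q) * C"
      using expand[of ?w "[]"] by simp
    moreover have "list_mult (A i) ?w = (invol (A i) s \<otimes>\<^bsub>A i\<^esub> s) [^]\<^bsub>A i\<^esub> q"
      by (subst list_mult_concat_replicate) auto
    ultimately show ?thesis by (simp add: s_def)
  qed
  then show "\<exists>C. \<forall>i\<in>I.
      cmod (\<tau> i ((invol (A i) (a i \<oplus>\<^bsub>A i\<^esub> b i) \<otimes>\<^bsub>A i\<^esub> (a i \<oplus>\<^bsub>A i\<^esub> b i)) [^]\<^bsub>A i\<^esub> q)) \<le> C"
    by blast
qed

lemma zero_bounded_product: "\<zero>\<^bsub>B\<^esub> \<in> carrier B"
proof -
  have "0 \<odot>\<^bsub>A i\<^esub> \<one>\<^bsub>A i\<^esub> = \<zero>\<^bsub>A i\<^esub>" if "i \<in> I" for i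
  proof -
    interpret tracial_star_algebra "A i" "\<tau> i" using that by (rule tracial)
    show ?thesis by (simp add: scale_zero_left)
  qed
  then show ?thesis
    using scale_bounded_product[OF one_bounded_product, of 0]
    by (simp add: bounded_product_simps cong: restrict_cong)
qed

lemmas bounded_product_closed = one_bounded_product zero_bounded_product invol_bounded_product
  mult_bounded_product add_bounded_product scale_bounded_product

lemma star_algebra_bounded_product: "star_algebra B"
proof -
  have star: "star_algebra (A i)" if "i \<in> I" for i
    using tracial[OF that] by (rule tracial_star_algebra.axioms)
  have ring: "ring (A i)" if "i \<in> I" for i
    using star[OF that] by (rule star_algebra.axioms)
  note closed = bounded_product_closed
  note rules = ring.ring_simprules[OF ring] star_algebra.scale_add_left[OF star]
    star_algebra.scale_add_right[OF star] star_algebra.scale_scale[OF star]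
    star_algebra.scale_one[OF star] star_algebra.smult_mult_left[OF star]
    star_algebra.smult_mult_right[OF star] star_algebra.invol_invol[OF star]
    star_algebra.invol_add[OF star] star_algebra.invol_smult[OF star]
    star_algebra.invol_mult[OF star]
  show ?thesis
  proof (rule star_algebraI)
    show "ring B"
    proof (rule ringI)
      show "abelian_group B"
      proof (rule abelian_groupI)
        fix a assume a: "a \<in> carrier B"
        have "(- 1) \<odot>\<^bsub>B\<^esub> a \<oplus>\<^bsub>B\<^esub> a = \<zero>\<^bsub>B\<^esub>"
        proof (rule bounded_product_eqI)
          fix i assume i: "i \<in> I"
          interpret tracial_star_algebra "A i" "\<tau> i" using i by (rule tracial)
          show "((- 1) \<odot>\<^bsub>B\<^esub> a \<oplus>\<^bsub>B\<^esub> a) i = \<zero>\<^bsub>B\<^esub> i"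
            using a i by (simp add: bounded_product_simps l_neg flip: minus_eq_scale)
        qed (intro closed a)+
        then show "\<exists>b\<in>carrier B. b \<oplus>\<^bsub>B\<^esub> a = \<zero>\<^bsub>B\<^esub>"
          using closed(6)[OF a] by blast
      next
        fix a b c assume "a \<in> carrier B" "b \<in> carrier B" "c \<in> carrier B"
        then show "a \<oplus>\<^bsub>B\<^esub> b \<oplus>\<^bsub>B\<^esub> c = a \<oplus>\<^bsub>B\<^esub> (b \<oplus>\<^bsub>B\<^esub> c)"
          by (intro bounded_product_eqI closed) (simp_all add: bounded_product_simps rules)
      next
        fix a b assume "a \<in> carrier B" "b \<in> carrier B"
        then show "a \<oplus>\<^bsub>B\<^esub> b = b \<oplus>\<^bsub>B\<^esub> a"
          by (intro bounded_product_eqI closed) (simp_all add: bounded_product_simps rules)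
      next
        fix a assume "a \<in> carrier B"
        then show "\<zero>\<^bsub>B\<^esub> \<oplus>\<^bsub>B\<^esub> a = a"
          by (intro bounded_product_eqI closed) (simp_all add: bounded_product_simps rules)
      qed (intro closed; assumption)+
      show "Group.monoid B"
      proof (rule monoidI)
        fix a b c assume "a \<in> carrier B" "b \<in> carrier B" "c \<in> carrier B"
        then show "a \<otimes>\<^bsub>B\<^esub> b \<otimes>\<^bsub>B\<^esub> c = a \<otimes>\<^bsub>B\<^esub> (b \<otimes>\<^bsub>B\<^esub> c)"
          by (intro bounded_product_eqI closed) (simp_all add: bounded_product_simps rules)
      next
        fix a assume a: "a \<in> carrier B"
        then show "\<one>\<^bsub>B\<^esub> \<otimes>\<^bsub>B\<^esub> a = a"
          by (intro bounded_product_eqI closed) (simp_all add: bounded_product_simps rules)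
        from a show "a \<otimes>\<^bsub>B\<^esub> \<one>\<^bsub>B\<^esub> = a"
          by (intro bounded_product_eqI closed)
            (simp_all add: bounded_product_simps monoid.r_one[OF ring.is_monoid[OF ring]])
      qed (intro closed; assumption)+
      fix a b c assume *: "a \<in> carrier B" "b \<in> carrier B" "c \<in> carrier B"
      then show "(a \<oplus>\<^bsub>B\<^esub> b) \<otimes>\<^bsub>B\<^esub> c = a \<otimes>\<^bsub>B\<^esub> c \<oplus>\<^bsub>B\<^esub> b \<otimes>\<^bsub>B\<^esub> c"
        by (intro bounded_product_eqI closed) (simp_all add: bounded_product_simps rules)
      from * show "c \<otimes>\<^bsub>B\<^esub> (a \<oplus>\<^bsub>B\<^esub> b) = c \<otimes>\<^bsub>B\<^esub> a \<oplus>\<^bsub>B\<^esub> c \<otimes>\<^bsub>B\<^esub> b"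
        by (intro bounded_product_eqI closed) (simp_all add: bounded_product_simps rules)
    qed
  next
    fix x y assume x: "x \<in> carrier B" and y: "y \<in> carrier B"
    show "c \<odot>\<^bsub>B\<^esub> (x \<oplus>\<^bsub>B\<^esub> y) = c \<odot>\<^bsub>B\<^esub> x \<oplus>\<^bsub>B\<^esub> c \<odot>\<^bsub>B\<^esub> y" for c
      by (intro bounded_product_eqI closed x y) (simp_all add: x y bounded_product_simps rules)
    show "c \<odot>\<^bsub>B\<^esub> x \<otimes>\<^bsub>B\<^esub> y = c \<odot>\<^bsub>B\<^esub> (x \<otimes>\<^bsub>B\<^esub> y)" for c
      by (intro bounded_product_eqI closed x y) (simp_all add: x y bounded_product_simps rules)
    show "x \<otimes>\<^bsub>B\<^esub> (c \<odot>\<^bsub>B\<^esub> y) = c \<odot>\<^bsub>B\<^esub> (x \<otimes>\<^bsub>B\<^esub> y)" for c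
      by (intro bounded_product_eqI closed x y) (simp_all add: x y bounded_product_simps rules)
    show "invol B (x \<oplus>\<^bsub>B\<^esub> y) = invol B x \<oplus>\<^bsub>B\<^esub> invol B y"
      by (intro bounded_product_eqI closed x y) (simp_all add: x y bounded_product_simps rules)
    show "invol B (x \<otimes>\<^bsub>B\<^esub> y) = invol B y \<otimes>\<^bsub>B\<^esub> invol B x"
      by (intro bounded_product_eqI closed x y) (simp_all add: x y bounded_product_simps rules)
  next
    fix x assume x: "x \<in> carrier B"
    show "(a + b) \<odot>\<^bsub>B\<^esub> x = a \<odot>\<^bsub>B\<^esub> x \<oplus>\<^bsub>B\<^esub> b \<odot>\<^bsub>B\<^esub> x" for a b
      by (intro bounded_product_eqI closed x) (simp_all add: x bounded_product_simps rules)
    show "(a * b) \<odot>\<^bsub>B\<^esub> x = a \<odot>\<^bsub>B\<^esub> (b \<odot>\<^bsub>B\<^esub> x)" for a b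
      by (intro bounded_product_eqI closed x) (simp_all add: x bounded_product_simps rules)
    show "1 \<odot>\<^bsub>B\<^esub> x = x"
      by (intro bounded_product_eqI closed x) (simp_all add: x bounded_product_simps rules)
    show "invol B (invol B x) = x"
      by (intro bounded_product_eqI closed x) (simp_all add: x bounded_product_simps rules)
    show "invol B (c \<odot>\<^bsub>B\<^esub> x) = cnj c \<odot>\<^bsub>B\<^esub> invol B x" for c
      by (intro bounded_product_eqI closed x) (simp_all add: x bounded_product_simps rules)
  qed (intro closed; assumption)+
qed

text \<open>Cauchy-Schwarz against the unit reduces this to the moment q = 1, that is, to p =
  2.\<close>

lemma bounded_trace:
  assumes "a \<in> carrier B" shows "bounded ((\<lambda>i. \<tau> i (a i)) ` I)"
proof -
  obtain C where C: "\<And>i. i \<in> I \<Longrightarrow> cmod (\<tau> i (invol (A i) (a i) \<otimes>\<^bsub>A i\<^esub> a i)) \<le> C"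
  proof -
    obtain C where C: "\<And>i. i \<in> I \<Longrightarrow>
        cmod (\<tau> i ((invol (A i) (a i) \<otimes>\<^bsub>A i\<^esub> a i) [^]\<^bsub>A i\<^esub> (1::nat))) \<le> C"
      using moments_bounded[OF assms, of 1] by auto
    have "cmod (\<tau> i (invol (A i) (a i) \<otimes>\<^bsub>A i\<^esub> a i)) \<le> C" if i: "i \<in> I" for i
    proof -
      interpret tracial_star_algebra "A i" "\<tau> i" using i by (rule tracial)
      show ?thesis using C[OF i] assms i by simp
    qed
    then show ?thesis by (rule that)
  qed
  have "cmod (\<tau> i (a i)) \<le> sqrt C" if i: "i \<in> I" for i
  proof (rule real_le_rsqrt)
    interpret tracial_star_algebra "A i" "\<tau> i" using i by (rule tracial)
    have "(cmod (\<tau> i (a i)))\<^sup>2 \<le> Re (\<tau> i (invol (A i) (a i) \<otimes>\<^bsub>A i\<^esub> a i))"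
      using trace_Cauchy_Schwarz[of "\<one>\<^bsub>A i\<^esub>" "a i"] assms i by (simp add: trace_one)
    also have "\<dots> \<le> C" using C[OF i] complex_Re_le_cmod order_trans by blast
    finally show "(cmod (\<tau> i (a i)))\<^sup>2 \<le> C" .
  qed
  then show ?thesis by (auto simp: bounded_iff)
qed

text \<open>\<open>Lim\<close> carries information only once a limit is known to exist; boundedness
  provides one along an ultrafilter.\<close>

lemma tendsto_limit_trace:
  assumes \<omega>: "ultrafilter_on I \<omega>" and a: "a \<in> carrier B"
  shows "((\<lambda>i. \<tau> i (a i)) \<longlongrightarrow> limit_trace \<omega> \<tau> a) \<omega>"
proof -
  obtain l where l: "((\<lambda>i. \<tau> i (a i)) \<longlongrightarrow> l) \<omega>"
    using ultrafilter_on_tendsto[OF \<omega> bounded_trace[OF a]] .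
  have "\<omega> \<noteq> bot" using \<omega> by (simp add: ultrafilter_on_def)
  with l show ?thesis by (simp add: limit_trace_def tendsto_Lim)
qed

lemma limit_trace_eqI:
  assumes "ultrafilter_on I \<omega>" "((\<lambda>i. \<tau> i (a i)) \<longlongrightarrow> l) \<omega>"
  shows "limit_trace \<omega> \<tau> a = l"
  using assms by (simp add: limit_trace_def tendsto_Lim ultrafilter_on_def)

lemma tracial_star_algebra_bounded_product:
  assumes \<omega>: "ultrafilter_on I \<omega>"
  shows "tracial_star_algebra B (limit_trace \<omega> \<tau>)"
proof (intro tracial_star_algebra.intro star_algebra_bounded_product
    tracial_star_algebra_axioms.intro)
  note closed = bounded_product_closed
  note lim = tendsto_limit_trace[OF \<omega>]
  have ev: "\<forall>\<^sub>F i in \<omega>. i \<in> I" and nt: "\<omega> \<noteq> bot" using \<omega> by (auto simp: ultrafilter_on_def)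
  have cong: "(g \<longlongrightarrow> l) \<omega>" if "(f \<longlongrightarrow> l) \<omega>" "\<And>i. i \<in> I \<Longrightarrow> f i = g i" for f g :: "'i \<Rightarrow> complex" and l
    using that(1) by (rule Lim_transform_eventually) (rule eventually_mono[OF ev that(2)])
  note tr = tracial_star_algebra.trace_add[OF tracial] tracial_star_algebra.trace_smult[OF tracial]
    tracial_star_algebra.trace_one[OF tracial]
  fix x y assume x: "x \<in> carrier B" and y: "y \<in> carrier B"
  show "limit_trace \<omega> \<tau> (x \<oplus>\<^bsub>B\<^esub> y) = limit_trace \<omega> \<tau> x + limit_trace \<omega> \<tau> y"
    by (rule limit_trace_eqI[OF \<omega>], rule cong[OF tendsto_add[OF lim[OF x] lim[OF y]]])
      (simp add: bounded_product_simps tr x y)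
  show "limit_trace \<omega> \<tau> (c \<odot>\<^bsub>B\<^esub> x) = c * limit_trace \<omega> \<tau> x" for c
    by (rule limit_trace_eqI[OF \<omega>], rule cong[OF tendsto_mult_left[OF lim[OF x]]])
      (simp add: bounded_product_simps tr x)
  show "limit_trace \<omega> \<tau> (x \<otimes>\<^bsub>B\<^esub> y) = limit_trace \<omega> \<tau> (y \<otimes>\<^bsub>B\<^esub> x)"
    by (rule limit_trace_eqI[OF \<omega>], rule cong[OF lim[OF closed(4)[OF y x]]])
      (simp add: bounded_product_simps x y tracial_star_algebra.trace_commute[OF tracial, of _ "x _"])
  have t: "((\<lambda>i. \<tau> i (invol (A i) (x i) \<otimes>\<^bsub>A i\<^esub> x i)) \<longlongrightarrow>
      limit_trace \<omega> \<tau> (invol B x \<otimes>\<^bsub>B\<^esub> x)) \<omega>"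
    by (rule cong[OF lim[OF closed(4)[OF closed(3)[OF x] x]]]) (simp add: bounded_product_simps)
  have "\<forall>\<^sub>F i in \<omega>. \<tau> i (invol (A i) (x i) \<otimes>\<^bsub>A i\<^esub> x i) \<in> \<real>\<^sub>\<ge>\<^sub>0"
    using ev by eventually_elim
      (use x in \<open>auto intro: tracial_star_algebra.trace_pos[OF tracial]\<close>)
  then show "limit_trace \<omega> \<tau> (invol B x \<otimes>\<^bsub>B\<^esub> x) \<in> \<real>\<^sub>\<ge>\<^sub>0"
    by (rule Lim_in_closed_set[OF closed_nonneg_Reals_complex _ nt t])
next
  have ev: "\<forall>\<^sub>F i in \<omega>. i \<in> I" using \<omega> by (auto simp: ultrafilter_on_def)
  have "((\<lambda>i. \<tau> i (\<one>\<^bsub>B\<^esub> i)) \<longlongrightarrow> 1) \<omega>"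
    by (rule Lim_transform_eventually[OF tendsto_const])
      (use ev in eventually_elim, simp add: bounded_product_simps
        tracial_star_algebra.trace_one[OF tracial])
  then show "limit_trace \<omega> \<tau> \<one>\<^bsub>B\<^esub> = 1" by (rule limit_trace_eqI[OF \<omega>])
qed

end

section \<open>Noncommutative polynomials\<close>

lemma ncpoly_sum_single:
  fixes P :: ncpoly
  assumes "finite S" "Poly_Mapping.keys P \<subseteq> S"
  shows "P = (\<Sum>w\<in>S. Poly_Mapping.single w (Poly_Mapping.lookup P w))"
proof (rule poly_mapping_eqI)
  fix v
  have "(\<Sum>w\<in>S. Poly_Mapping.lookup (Poly_Mapping.single w (Poly_Mapping.lookup P w)) v) =
      (\<Sum>w\<in>S. if v = w then Poly_Mapping.lookup P v else 0)"
    by (intro sum.cong) (auto simp: lookup_single when_def)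
  then show "Poly_Mapping.lookup P v =
      Poly_Mapping.lookup (\<Sum>w\<in>S. Poly_Mapping.single w (Poly_Mapping.lookup P w)) v"
    using assms by (auto simp: lookup_sum in_keys_iff)
qed

text \<open>Monomials span. The zero polynomial is a monomial with coefficient 0 and therefore has
  no case of its own.\<close>

lemma ncpoly_induct [case_names single add]:
  fixes P :: ncpoly
  assumes single: "\<And>w c. R (Poly_Mapping.single w c)"
    and add: "\<And>P Q. \<lbrakk>R P; R Q\<rbrakk> \<Longrightarrow> R (P + Q)"
  shows "R P"
proof -
  have "R (\<Sum>w\<in>S. Poly_Mapping.single w (c w))" if "finite S" for S c
    using that
  proof (induction S rule: finite_induct)
    case empty
    then show ?case using single[of "[]" 0] by simp
  qed (simp add: assms)
  from this[of "Poly_Mapping.keys P" "Poly_Mapping.lookup P"] show ?thesis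
    by (simp flip: ncpoly_sum_single)
qed

lemma single_mult_single:
  "Poly_Mapping.single u a * Poly_Mapping.single v b = Poly_Mapping.single (u @ v) (a * b :: complex)"
  by (simp add: mult_single plus_list_def)

lemma ncpoly_one: "(1 :: ncpoly) = Poly_Mapping.single [] 1"
  by (simp add: zero_list_def[symmetric])

lemma scalar_commute: "P * Poly_Mapping.single [] c = Poly_Mapping.single [] c * (P :: ncpoly)"
  by (induction P rule: ncpoly_induct) (simp_all add: single_mult_single algebra_simps)

lemma lookup_ncpoly_star:
  "Poly_Mapping.lookup (ncpoly_star P) v = cnj (Poly_Mapping.lookup P (rev v))"
proof -
  have "Poly_Mapping.lookup (ncpoly_star P) v =
      (\<Sum>w\<in>Poly_Mapping.keys P. if rev v = w then cnj (Poly_Mapping.lookup P (rev v)) else 0)"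
    unfolding ncpoly_star_def lookup_sum
    by (intro sum.cong) (auto simp: lookup_single when_def)
  then show ?thesis by (auto simp: in_keys_iff)
qed

lemma ncpoly_star_add: "ncpoly_star (P + Q) = ncpoly_star P + ncpoly_star Q"
  by (rule poly_mapping_eqI) (simp add: lookup_ncpoly_star lookup_add)

lemma ncpoly_star_single:
  "ncpoly_star (Poly_Mapping.single w c) = Poly_Mapping.single (rev w) (cnj c)"
  by (rule poly_mapping_eqI) (auto simp: lookup_ncpoly_star lookup_single when_def)

lemma ncpoly_star_star: "ncpoly_star (ncpoly_star P) = P"
  by (rule poly_mapping_eqI) (simp add: lookup_ncpoly_star)

lemma ncpoly_star_mult: "ncpoly_star (P * Q) = ncpoly_star Q * ncpoly_star P"
proof (induction P rule: ncpoly_induct)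
  case (single u a)
  show ?case
    by (induction Q rule: ncpoly_induct)
      (simp_all add: single_mult_single ncpoly_star_single ncpoly_star_add algebra_simps)
qed (simp add: ncpoly_star_add algebra_simps)

lemma ncpoly_algebra_simps [simp]:
  "carrier ncpoly_algebra = UNIV"
  "P \<otimes>\<^bsub>ncpoly_algebra\<^esub> Q = P * Q" "P \<oplus>\<^bsub>ncpoly_algebra\<^esub> Q = P + Q"
  "\<one>\<^bsub>ncpoly_algebra\<^esub> = 1" "\<zero>\<^bsub>ncpoly_algebra\<^esub> = 0"
  "c \<odot>\<^bsub>ncpoly_algebra\<^esub> P = Poly_Mapping.single [] c * P"
  "invol ncpoly_algebra P = ncpoly_star P"
  by (simp_all add: ncpoly_algebra_def Ring.ring.defs)

lemma star_algebra_ncpoly: "star_algebra ncpoly_algebra"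
proof (rule star_algebraI)
  show "ring ncpoly_algebra"
  proof (rule ringI)
    show "abelian_group ncpoly_algebra"
      by (rule abelian_groupI) (auto simp: add.assoc add.commute intro: exI[of _ "- _"])
    show "Group.monoid ncpoly_algebra"
      by (rule monoidI) (auto simp: mult.assoc)
  qed (auto simp: algebra_simps)
next
  fix x :: ncpoly and a b
  show "(a + b) \<odot>\<^bsub>ncpoly_algebra\<^esub> x = a \<odot>\<^bsub>ncpoly_algebra\<^esub> x \<oplus>\<^bsub>ncpoly_algebra\<^esub> b \<odot>\<^bsub>ncpoly_algebra\<^esub> x"
    by (simp add: single_add algebra_simps)
  have "Poly_Mapping.single [] (a * b) * x = (Poly_Mapping.single [] a * Poly_Mapping.single [] b) * x"
    by (simp add: single_mult_single)
  then show "(a * b) \<odot>\<^bsub>ncpoly_algebra\<^esub> x = a \<odot>\<^bsub>ncpoly_algebra\<^esub> (b \<odot>\<^bsub>ncpoly_algebra\<^esub> x)"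
    by (simp add: mult.assoc)
  show "1 \<odot>\<^bsub>ncpoly_algebra\<^esub> x = x"
    by (simp flip: ncpoly_one)
  show "invol ncpoly_algebra (a \<odot>\<^bsub>ncpoly_algebra\<^esub> x) = cnj a \<odot>\<^bsub>ncpoly_algebra\<^esub> invol ncpoly_algebra x"
    by (simp add: ncpoly_star_mult ncpoly_star_single scalar_commute)
next
  fix x y :: ncpoly and c
  have "x * (Poly_Mapping.single [] c * y) = (x * Poly_Mapping.single [] c) * y"
    by (simp add: mult.assoc)
  then show "x \<otimes>\<^bsub>ncpoly_algebra\<^esub> (c \<odot>\<^bsub>ncpoly_algebra\<^esub> y) = c \<odot>\<^bsub>ncpoly_algebra\<^esub> (x \<otimes>\<^bsub>ncpoly_algebra\<^esub> y)"
    by (simp add: scalar_commute mult.assoc)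
qed (simp_all add: algebra_simps ncpoly_star_add ncpoly_star_mult ncpoly_star_star)

section \<open>Evaluation of polynomials at self-adjoint elements\<close>

locale evaluation = star_algebra A for A :: "'a star_algebra" (structure) +
  fixes x :: "nat \<Rightarrow> 'a"
  assumes x_closed [simp, intro]: "x i \<in> carrier A"
    and x_self_adjoint [simp]: "invol A (x i) = x i"
begin

abbreviation word :: "nat list \<Rightarrow> 'a" where "word w \<equiv> list_mult A (map x w)"

abbreviation eval :: "ncpoly \<Rightarrow> 'a" where "eval \<equiv> ncpoly_eval A x"

lemma word_in_lists [simp]: "map x w \<in> lists (carrier A)"
  by auto

lemma word_closed [simp, intro]: "word w \<in> carrier A"
  by (rule list_mult_closed) simp

lemma invol_word: "invol A (word w) = word (rev w)"
  by (simp add: invol_list_mult rev_map comp_def)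

text \<open>Any finite set containing the support is allowed, so that P, Q and P + Q can be summed
  over one index set although cancellation may shrink the support of P + Q.\<close>

lemma eval_eq:
  assumes "finite S" "Poly_Mapping.keys P \<subseteq> S"
  shows "eval P = (\<Oplus>w\<in>S. Poly_Mapping.lookup P w \<odot> word w)"
proof -
  have "foldr (\<lambda>i a. x i \<otimes> a) w \<one> = word w" for w
    by (simp add: list_mult_def foldr_map comp_def)
  then have "eval P = (\<Oplus>w\<in>Poly_Mapping.keys P. Poly_Mapping.lookup P w \<odot> word w)"
    by (simp add: ncpoly_eval_def)
  also have "\<dots> = (\<Oplus>w\<in>S. Poly_Mapping.lookup P w \<odot> word w)"
    using assms by (intro add.finprod_mono_neutral_cong_left)
      (auto simp: in_keys_iff scale_zero_left)
  finally show ?thesis .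
qed

lemma eval_closed [simp, intro]: "eval P \<in> carrier A"
  by (subst eval_eq[OF _ subset_refl]) (auto intro: finsum_closed)

lemma eval_single: "eval (Poly_Mapping.single w c) = c \<odot> word w"
  by (subst eval_eq[of "{w}"]) (auto simp: lookup_single)

lemma eval_add: "eval (P + Q) = eval P \<oplus> eval Q"
proof -
  let ?S = "Poly_Mapping.keys P \<union> Poly_Mapping.keys Q"
  have "eval (P + Q) = (\<Oplus>w\<in>?S. Poly_Mapping.lookup P w \<odot> word w \<oplus> Poly_Mapping.lookup Q w \<odot> word w)"
    using Poly_Mapping.keys_add[of P Q] by (subst eval_eq[of ?S]) (auto simp: lookup_add scale_add_left)
  also have "\<dots> = eval P \<oplus> eval Q"
    by (subst finsum_addf) (auto simp: eval_eq[of ?S])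
  finally show ?thesis .
qed

lemma eval_mult: "eval (P * Q) = eval P \<otimes> eval Q"
proof (induction P rule: ncpoly_induct)
  case (single u a)
  show ?case
  proof (induction Q rule: ncpoly_induct)
    case (single v b)
    show ?case
      by (simp add: single_mult_single eval_single list_mult_append smult_mult_left
          smult_mult_right mult.commute flip: scale_scale)
  qed (simp add: eval_add distrib_left r_distr)
qed (simp add: eval_add distrib_right l_distr)

lemma eval_one: "eval 1 = \<one>"
  by (simp add: ncpoly_one eval_single scale_one)

lemma eval_scale: "eval (Poly_Mapping.single [] c * P) = c \<odot> eval P"
  by (simp add: eval_mult eval_single smult_mult_left)

lemma eval_star: "eval (ncpoly_star P) = invol A (eval P)"
  by (induction P rule: ncpoly_induct)
    (simp_all add: ncpoly_star_single ncpoly_star_add eval_single eval_add invol_smult invol_word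
      invol_add)

lemma eval_zero: "eval 0 = \<zero>"
  using eval_single[of "[]" 0] by (simp add: scale_zero_left)

lemma tracial_hom_eval:
  assumes "tracial_star_algebra A \<tau>"
  shows "tracial_hom ncpoly_algebra (\<lambda>P. \<tau> (eval P)) A \<tau> eval"
proof -
  interpret T: tracial_star_algebra A \<tau> by fact
  show ?thesis
  proof (intro tracial_hom.intro tracial_hom_axioms.intro assms tracial_star_algebra.intro
      star_algebra_ncpoly tracial_star_algebra_axioms.intro)
    show "eval \<in> Ring.ring_hom ncpoly_algebra A"
      by (rule ring_hom_memI) (simp_all add: eval_add eval_mult eval_one)
    show "\<tau> (eval (P \<otimes>\<^bsub>ncpoly_algebra\<^esub> Q)) = \<tau> (eval (Q \<otimes>\<^bsub>ncpoly_algebra\<^esub> P))" for P Q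
      by (simp add: eval_mult T.trace_commute)
    show "\<tau> (eval (c \<odot>\<^bsub>ncpoly_algebra\<^esub> P)) = c * \<tau> (eval P)" for c P
      by (simp add: eval_scale T.trace_smult)
    show "eval (c \<odot>\<^bsub>ncpoly_algebra\<^esub> P) = c \<odot> eval P" for c P
      by (simp add: eval_scale)
  qed (simp_all add: eval_add eval_mult eval_one eval_star T.trace_add T.trace_one T.trace_pos)
qed

end

section \<open>Matrices\<close>

lemma matrix_algebra_simps [simp]:
  "carrier (matrix_algebra k) = carrier_mat k k"
  "M \<otimes>\<^bsub>matrix_algebra k\<^esub> N = M * N" "M \<oplus>\<^bsub>matrix_algebra k\<^esub> N = M + N"
  "\<one>\<^bsub>matrix_algebra k\<^esub> = 1\<^sub>m k" "\<zero>\<^bsub>matrix_algebra k\<^esub> = 0\<^sub>m k k"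
  "c \<odot>\<^bsub>matrix_algebra k\<^esub> M = c \<cdot>\<^sub>m M" "invol (matrix_algebra k) M = mat_adjoint M"
  by (simp_all add: matrix_algebra_def ring_mat_def)

lemma mat_adjoint_carrier [simp, intro]: "M \<in> carrier_mat n m \<Longrightarrow> mat_adjoint M \<in> carrier_mat m n"
  by (auto simp: mat_adjoint_def)

lemma mat_adjoint_dim [simp]: "dim_row (mat_adjoint M) = dim_col M" "dim_col (mat_adjoint M) = dim_row M"
  by (auto simp: mat_adjoint_def)

lemma mat_adjoint_index [simp]:
  "\<lbrakk>i < dim_col M; j < dim_row M\<rbrakk> \<Longrightarrow> mat_adjoint M $$ (i, j) = conjugate (M $$ (j, i))"
  by (simp add: mat_adjoint_def mat_of_rows_def)

lemma matrix_mult_index: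
  assumes "M \<in> carrier_mat k k" "N \<in> carrier_mat k k" "i < k" "j < k"
  shows "(M * N) $$ (i, j) = (\<Sum>l<k. M $$ (i, l) * N $$ (l, j))"
  using assms by (auto simp: times_mat_def scalar_prod_def atLeast0LessThan)

lemma star_algebra_matrix: "star_algebra (matrix_algebra k)"
proof (rule star_algebraI)
  show "ring (matrix_algebra k)"
    unfolding matrix_algebra_def by (rule ring_mat)
next
  fix M N assume "M \<in> carrier (matrix_algebra k)" "N \<in> carrier (matrix_algebra k)"
  then have M: "M \<in> carrier_mat k k" and N: "N \<in> carrier_mat k k" by simp_all
  have "mat_adjoint (M * N) = mat_adjoint N * mat_adjoint M"
  proof (rule eq_matI)
    fix i j assume "i < dim_row (mat_adjoint N * mat_adjoint M)" "j < dim_col (mat_adjoint N * mat_adjoint M)"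
    then have ij: "i < k" "j < k" using M N by auto
    then show "mat_adjoint (M * N) $$ (i, j) = (mat_adjoint N * mat_adjoint M) $$ (i, j)"
      using M N by (subst matrix_mult_index[of "mat_adjoint N" k])
        (auto simp: matrix_mult_index mult.commute simp del: index_mult_mat(1))
  qed (use M N in auto)
  then show "invol (matrix_algebra k) (M \<otimes>\<^bsub>matrix_algebra k\<^esub> N) =
      invol (matrix_algebra k) N \<otimes>\<^bsub>matrix_algebra k\<^esub> invol (matrix_algebra k) M"
    by simp
qed (auto simp: add_smult_distrib_left_mat add_smult_distrib_right_mat mult_smult_assoc_mat
    mult_smult_distrib intro!: eq_matI)

definition matrix_trace :: "nat \<Rightarrow> complex mat \<Rightarrow> complex"
  where "matrix_trace k M = (\<Sum>i<k. M $$ (i, i)) / of_nat k"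

text \<open>The right-hand side is the normalized squared Hilbert-Schmidt norm. It bounds every
  entry of M, which later turns traces into bounds on coefficients.\<close>

lemma matrix_trace_adjoint_mult:
  assumes "M \<in> carrier_mat k k"
  shows "matrix_trace k (mat_adjoint M * M) =
    of_real ((\<Sum>i<k. \<Sum>j<k. (cmod (M $$ (j, i)))\<^sup>2) / real k)"
proof -
  have "(mat_adjoint M * M) $$ (i, i) = of_real (\<Sum>j<k. (cmod (M $$ (j, i)))\<^sup>2)" if "i < k" for i
  proof -
    have "(mat_adjoint M * M) $$ (i, i) = (\<Sum>j<k. mat_adjoint M $$ (i, j) * M $$ (j, i))"
      using assms that by (intro matrix_mult_index) auto
    also have "\<dots> = (\<Sum>j<k. of_real ((cmod (M $$ (j, i)))\<^sup>2))"
      using assms that by (intro sum.cong)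
        (auto simp: complex_norm_square mult.commute simp del: of_real_power)
    finally show ?thesis by simp
  qed
  then show ?thesis by (simp add: matrix_trace_def)
qed

lemma tracial_matrix_algebra:
  assumes "1 \<le> k"
  shows "tracial_star_algebra (matrix_algebra k) (matrix_trace k)"
proof (intro tracial_star_algebra.intro star_algebra_matrix tracial_star_algebra_axioms.intro)
  fix M N assume "M \<in> carrier (matrix_algebra k)" "N \<in> carrier (matrix_algebra k)"
  then have M: "M \<in> carrier_mat k k" and N: "N \<in> carrier_mat k k" by simp_all
  show "matrix_trace k (M \<oplus>\<^bsub>matrix_algebra k\<^esub> N) = matrix_trace k M + matrix_trace k N"
    using M N by (simp add: matrix_trace_def sum.distrib add_divide_distrib)
  show "matrix_trace k (c \<odot>\<^bsub>matrix_algebra k\<^esub> M) = c * matrix_trace k M" for c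
    using M by (simp add: matrix_trace_def sum_distrib_left)
  show "matrix_trace k (invol (matrix_algebra k) M \<otimes>\<^bsub>matrix_algebra k\<^esub> M) \<in> \<real>\<^sub>\<ge>\<^sub>0"
    using matrix_trace_adjoint_mult[OF M]
    by (simp del: of_real_sum of_real_divide add: sum_nonneg nonneg_Reals_of_real_iff)
  have "(\<Sum>i<k. \<Sum>j<k. M $$ (i, j) * N $$ (j, i)) = (\<Sum>i<k. \<Sum>j<k. N $$ (i, j) * M $$ (j, i))"
    by (subst sum.swap) (simp add: mult.commute)
  then show "matrix_trace k (M \<otimes>\<^bsub>matrix_algebra k\<^esub> N) = matrix_trace k (N \<otimes>\<^bsub>matrix_algebra k\<^esub> M)"
    using M N by (simp add: matrix_trace_def matrix_mult_index del: index_mult_mat)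
next
  show "matrix_trace k \<one>\<^bsub>matrix_algebra k\<^esub> = 1"
    using assms by (simp add: matrix_trace_def)
qed

section \<open>Functionals on noncommutative polynomials and the weight grading\<close>

text \<open>Encoding a linear functional by its values on words allows it to be truncated and
  rescaled word by word.\<close>

definition word_functional :: "(nat list \<Rightarrow> complex) \<Rightarrow> ncpoly \<Rightarrow> complex"
  where "word_functional f P = (\<Sum>w\<in>Poly_Mapping.keys P. Poly_Mapping.lookup P w * f w)"

lemma word_functional_eq:
  assumes "finite S" "Poly_Mapping.keys P \<subseteq> S"
  shows "word_functional f P = (\<Sum>w\<in>S. Poly_Mapping.lookup P w * f w)"
  unfolding word_functional_def using assms
  by (intro sum.mono_neutral_left) (auto simp: in_keys_iff)

lemma word_functional_single: "word_functional f (Poly_Mapping.single w c) = c * f w"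
  by (subst word_functional_eq[of "{w}"]) auto

lemma word_functional_add: "word_functional f (P + Q) = word_functional f P + word_functional f Q"
proof -
  let ?S = "Poly_Mapping.keys P \<union> Poly_Mapping.keys Q"
  show ?thesis
    using Poly_Mapping.keys_add[of P Q]
    by (simp add: word_functional_eq[of ?S] lookup_add distrib_right sum.distrib)
qed

lemma word_functional_zero [simp]: "word_functional f 0 = 0"
  by (simp add: word_functional_def)

lemma word_functional_sum: "word_functional f (sum g I) = (\<Sum>i\<in>I. word_functional f (g i))"
  by (induction I rule: infinite_finite_induct) (simp_all add: word_functional_add)

lemma word_functional_scale:
  "word_functional f (Poly_Mapping.single [] c * P) = c * word_functional f P"
  by (induction P rule: ncpoly_induct)
    (simp_all add: single_mult_single word_functional_single word_functional_add distrib_left)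

lemma word_functional_mult_commute:
  assumes "\<And>u v. f (u @ v) = f (v @ u)"
  shows "word_functional f (P * Q) = word_functional f (Q * P)"
proof (induction P rule: ncpoly_induct)
  case (single u a)
  show ?case
    by (induction Q rule: ncpoly_induct)
      (simp_all add: single_mult_single word_functional_single word_functional_add distrib_left
        distrib_right assms[of u] mult.commute[of a])
qed (simp add: word_functional_add distrib_left distrib_right)

lemma word_functional_star:
  assumes "\<And>w. f (rev w) = cnj (f w)"
  shows "word_functional f (ncpoly_star P) = cnj (word_functional f P)"
  by (induction P rule: ncpoly_induct)
    (simp_all add: ncpoly_star_single ncpoly_star_add word_functional_single word_functional_add assms)

lemma word_functional_star_mult:
  "word_functional f (ncpoly_star P * Q) = (\<Sum>u\<in>Poly_Mapping.keys P. \<Sum>v\<in>Poly_Mapping.keys Q.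
    cnj (Poly_Mapping.lookup P u) * Poly_Mapping.lookup Q v * f (rev u @ v))"
proof -
  have "ncpoly_star P * Q = (\<Sum>u\<in>Poly_Mapping.keys P. \<Sum>v\<in>Poly_Mapping.keys Q.
      Poly_Mapping.single (rev u @ v) (cnj (Poly_Mapping.lookup P u) * Poly_Mapping.lookup Q v))"
    by (subst ncpoly_sum_single[of "Poly_Mapping.keys Q" Q])
      (simp_all add: ncpoly_star_def sum_product single_mult_single)
  then show ?thesis by (simp add: word_functional_sum word_functional_single)
qed

lemma tracial_word_functional:
  assumes one: "f [] = 1" and commute: "\<And>u v. f (u @ v) = f (v @ u)"
    and pos: "\<And>P. word_functional f (ncpoly_star P * P) \<in> \<real>\<^sub>\<ge>\<^sub>0"
  shows "tracial_star_algebra ncpoly_algebra (word_functional f)"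
proof (intro tracial_star_algebra.intro star_algebra_ncpoly tracial_star_algebra_axioms.intro)
  show "word_functional f (P \<otimes>\<^bsub>ncpoly_algebra\<^esub> Q) = word_functional f (Q \<otimes>\<^bsub>ncpoly_algebra\<^esub> P)"
    for P Q
    using word_functional_mult_commute[of f P Q, OF commute] by simp
qed (simp_all add: pos one word_functional_add word_functional_scale ncpoly_one word_functional_single)

lemma (in evaluation) trace_eval:
  assumes "tracial_star_algebra A \<tau>"
  shows "\<tau> (eval P) = word_functional (\<lambda>w. \<tau> (word w)) P"
proof -
  interpret T: tracial_star_algebra A \<tau> by fact
  show ?thesis
    by (induction P rule: ncpoly_induct)
      (simp_all add: eval_single eval_add T.trace_smult T.trace_add word_functional_single
        word_functional_add)
qed

text \<open>Weighting the letters by \<open>1, 2, \<dots>\<close> makes the homogeneous components finite-dimensional,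
  although there are infinitely many letters.\<close>

definition weight :: "nat list \<Rightarrow> nat"
  where "weight w = sum_list (map Suc w)"

lemma weight_simps [simp]:
  "weight [] = 0" "weight (i # w) = Suc i + weight w" "weight (u @ v) = weight u + weight v"
  "weight (rev w) = weight w"
  by (simp_all add: weight_def rev_map[symmetric])

lemma finite_weight_le: "finite {w. weight w \<le> d}"
proof (rule finite_subset)
  have "set w \<subseteq> {..d} \<and> length w \<le> d" if "weight w \<le> d" for w
    using that by (induction w arbitrary: d) fastforce+
  then show "{w. weight w \<le> d} \<subseteq> {w. set w \<subseteq> {..d} \<and> length w \<le> d}"
    by blast
qed (simp add: finite_lists_length_le)

definition homogeneous :: "nat \<Rightarrow> ncpoly \<Rightarrow> bool"
  where "homogeneous m P \<longleftrightarrow> (\<forall>w\<in>Poly_Mapping.keys P. weight w = m)"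

definition component :: "nat \<Rightarrow> ncpoly \<Rightarrow> ncpoly"
  where "component m P = (\<Sum>w\<in>{w \<in> Poly_Mapping.keys P. weight w = m}.
    Poly_Mapping.single w (Poly_Mapping.lookup P w))"

lemma lookup_component:
  "Poly_Mapping.lookup (component m P) v = (if weight v = m then Poly_Mapping.lookup P v else 0)"
proof -
  have "Poly_Mapping.lookup (component m P) v =
      (\<Sum>w\<in>{w \<in> Poly_Mapping.keys P. weight w = m}. if v = w then Poly_Mapping.lookup P v else 0)"
    unfolding component_def lookup_sum by (intro sum.cong) (auto simp: lookup_single when_def)
  then show ?thesis by (auto simp: in_keys_iff)
qed

lemma homogeneous_component: "homogeneous m (component m P)"
  by (auto simp: homogeneous_def in_keys_iff lookup_component split: if_splits)

lemma obtain_components: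
  obtains n where "P = (\<Sum>m\<le>n. component m P)"
proof -
  have "finite (weight ` Poly_Mapping.keys P)" by simp
  then obtain n where n: "\<And>w. w \<in> Poly_Mapping.keys P \<Longrightarrow> weight w \<le> n"
    by (auto simp: finite_nat_set_iff_bounded_le)
  have "P = (\<Sum>m\<le>n. component m P)"
  proof (rule poly_mapping_eqI)
    fix w
    have "(\<Sum>m\<le>n. Poly_Mapping.lookup (component m P) w) =
        (\<Sum>m\<le>n. if weight w = m then Poly_Mapping.lookup P w else 0)"
      by (simp add: lookup_component)
    also have "\<dots> = Poly_Mapping.lookup P w"
      using n[of w] by (auto simp: in_keys_iff)
    finally show "Poly_Mapping.lookup P w = Poly_Mapping.lookup (\<Sum>m\<le>n. component m P) w"
      by (simp add: lookup_sum)
  qed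
  then show ?thesis by (rule that)
qed

lemma homogeneous_star: "homogeneous m P \<Longrightarrow> homogeneous m (ncpoly_star P)"
  unfolding homogeneous_def
  by (metis complex_cnj_zero in_keys_iff lookup_ncpoly_star weight_simps(4))

lemma homogeneous_mult: "\<lbrakk>homogeneous i P; homogeneous j Q\<rbrakk> \<Longrightarrow> homogeneous (i + j) (P * Q)"
  unfolding homogeneous_def
proof
  fix w assume P: "\<forall>w\<in>Poly_Mapping.keys P. weight w = i"
    and Q: "\<forall>w\<in>Poly_Mapping.keys Q. weight w = j" and w: "w \<in> Poly_Mapping.keys (P * Q)"
  then obtain u v where "w = u @ v" "u \<in> Poly_Mapping.keys P" "v \<in> Poly_Mapping.keys Q"
    using Poly_Mapping.keys_mult[of P Q] by (auto simp: plus_list_def)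
  then show "weight w = i + j" using P Q by simp
qed

text \<open>Only words of weight m occur in P, so coefficients depending on the weight are constants
  here. The two terms fit a truncated trace plus a damped one.\<close>

lemma word_functional_homogeneous:
  assumes "homogeneous m P" "\<And>w. weight w = m \<Longrightarrow> f w = a * g w + b * h w"
  shows "word_functional f P = a * word_functional g P + b * word_functional h P"
proof -
  have "word_functional f P = (\<Sum>w\<in>Poly_Mapping.keys P.
      a * (Poly_Mapping.lookup P w * g w) + b * (Poly_Mapping.lookup P w * h w))"
    unfolding word_functional_def
  proof (rule sum.cong[OF refl])
    fix w assume "w \<in> Poly_Mapping.keys P"
    then have "f w = a * g w + b * h w" using assms by (simp add: homogeneous_def)
    then show "Poly_Mapping.lookup P w * f w =
        a * (Poly_Mapping.lookup P w * g w) + b * (Poly_Mapping.lookup P w * h w)"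
      by (simp add: algebra_simps)
  qed
  then show ?thesis by (simp add: word_functional_def sum.distrib sum_distrib_left)
qed

section \<open>Polynomial identities of matrices\<close>

lemma evaluation_matrix:
  assumes "\<And>i. x i \<in> carrier_mat k k \<and> mat_adjoint (x i) = x i"
  shows "evaluation (matrix_algebra k) x"
  by (intro evaluation.intro star_algebra_matrix evaluation_axioms.intro) (use assms in auto)

lemma star_ideal_matrix_identities: "star_ideal ncpoly_algebra (matrix_identities k)"
proof -
  interpret P: star_algebra ncpoly_algebra by (rule star_algebra_ncpoly)
  have ev: "evaluation (matrix_algebra k) x"
    if "\<forall>i. x i \<in> carrier_mat k k \<and> mat_adjoint (x i) = x i" for x
    using that by (intro evaluation_matrix) auto
  note rules = evaluation.eval_add[OF ev] evaluation.eval_mult[OF ev] evaluation.eval_star[OF ev]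
    evaluation.eval_zero[OF ev] evaluation.eval_scale[OF ev]
  have closed: "ncpoly_eval (matrix_algebra k) x P \<in> carrier_mat k k"
    if "\<forall>i. x i \<in> carrier_mat k k \<and> mat_adjoint (x i) = x i" for x P
    using evaluation.eval_closed[OF ev[OF that], of P] by simp
  have mem: "ncpoly_eval (matrix_algebra k) x P = 0\<^sub>m k k"
    if "P \<in> matrix_identities k" "\<forall>i. x i \<in> carrier_mat k k \<and> mat_adjoint (x i) = x i" for x P
    using that by (auto simp: matrix_identities_def)
  have left: "Q * P \<in> matrix_identities k" and right: "P * Q \<in> matrix_identities k"
    if P: "P \<in> matrix_identities k" for P Q
    unfolding matrix_identities_def
    by (auto simp: rules mem[OF P] left_mult_zero_mat[OF closed] right_mult_zero_mat[OF closed])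
  show ?thesis
  proof (intro star_ideal.intro P.star_algebra_axioms idealI P.ring_axioms star_ideal_axioms.intro)
    show "subgroup (matrix_identities k) (add_monoid ncpoly_algebra)"
    proof (rule subgroup.intro)
      show "matrix_identities k \<subseteq> carrier (add_monoid ncpoly_algebra)"
        "\<one>\<^bsub>add_monoid ncpoly_algebra\<^esub> \<in> matrix_identities k"
        by (simp_all add: matrix_identities_def rules)
      show "P \<otimes>\<^bsub>add_monoid ncpoly_algebra\<^esub> Q \<in> matrix_identities k"
        if "P \<in> matrix_identities k" "Q \<in> matrix_identities k" for P Q
        using that by (simp add: matrix_identities_def rules)
      show "inv\<^bsub>add_monoid ncpoly_algebra\<^esub> P \<in> matrix_identities k"
        if P: "P \<in> matrix_identities k" for P
      proof -
        have "\<ominus>\<^bsub>ncpoly_algebra\<^esub> P \<in> matrix_identities k"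
          using left[OF P] by (simp add: P.minus_eq_scale)
        then show ?thesis by (simp add: a_inv_def)
      qed
    qed
    fix P Q assume P: "P \<in> matrix_identities k"
    show "Q \<otimes>\<^bsub>ncpoly_algebra\<^esub> P \<in> matrix_identities k"
      "P \<otimes>\<^bsub>ncpoly_algebra\<^esub> Q \<in> matrix_identities k"
      using left[OF P] right[OF P] by simp_all
    have "mat_adjoint (0\<^sub>m k k :: complex mat) = 0\<^sub>m k k"
      by (rule eq_matI) auto
    then show "invol ncpoly_algebra P \<in> matrix_identities k"
      unfolding matrix_identities_def by (auto simp: rules mem[OF P])
  qed
qed

abbreviation matrix_word :: "nat \<Rightarrow> (nat \<Rightarrow> complex mat) \<Rightarrow> nat list \<Rightarrow> complex mat"
  where "matrix_word k x w \<equiv> list_mult (matrix_algebra k) (map x w)"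

context
  fixes k :: nat and x :: "nat \<Rightarrow> complex mat"
  assumes x: "\<And>i. x i \<in> carrier_mat k k \<and> mat_adjoint (x i) = x i"
begin

interpretation evaluation "matrix_algebra k" x using x by (rule evaluation_matrix)

lemma word_carrier_mat [simp]: "matrix_word k x w \<in> carrier_mat k k"
  using word_closed[of w] by simp

lemma eval_index:
  assumes "a < k" "b < k"
  shows "ncpoly_eval (matrix_algebra k) x P $$ (a, b) = word_functional (\<lambda>w. matrix_word k x w $$ (a, b)) P"
proof (induction P rule: ncpoly_induct)
  case (single w c)
  then show ?case using assms carrier_matD[OF word_carrier_mat[of w]]
    by (simp add: eval_single word_functional_single)
next
  case (add P Q)
  then show ?case using assms eval_closed[of P] eval_closed[of Q]
    by (simp add: eval_add word_functional_add)
qed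

lemma scaled_word:
  "list_mult (matrix_algebra k) (map (\<lambda>i. t ^ Suc i \<cdot>\<^sub>m x i) w) = t ^ weight w \<cdot>\<^sub>m matrix_word k x w"
proof (induction w)
  case (Cons i w)
  have xi: "x i \<in> carrier_mat k k" using x by blast
  have "list_mult (matrix_algebra k) (map (\<lambda>i. t ^ Suc i \<cdot>\<^sub>m x i) (i # w)) =
      (t ^ Suc i \<cdot>\<^sub>m x i) * (t ^ weight w \<cdot>\<^sub>m matrix_word k x w)"
    using Cons by simp
  also have "\<dots> = t ^ Suc i \<cdot>\<^sub>m (x i * (t ^ weight w \<cdot>\<^sub>m matrix_word k x w))"
    by (rule mult_smult_assoc_mat[OF xi smult_carrier_mat[OF word_carrier_mat]])
  also have "x i * (t ^ weight w \<cdot>\<^sub>m matrix_word k x w) = t ^ weight w \<cdot>\<^sub>m (x i * matrix_word k x w)"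
    by (rule mult_smult_distrib[OF xi word_carrier_mat])
  finally have "matrix_word k (\<lambda>i. t ^ Suc i \<cdot>\<^sub>m x i) (i # w) =
      t ^ Suc i \<cdot>\<^sub>m (t ^ weight w \<cdot>\<^sub>m matrix_word k x (i # w))"
    by simp
  also have "\<dots> = t ^ weight (i # w) \<cdot>\<^sub>m matrix_word k x (i # w)"
    by (rule eq_matI) (auto simp: power_add)
  finally show ?case .
qed auto

end

text \<open>Replacing each \<open>X\<^sub>i\<close> by \<open>t\<^sup>i\<^sup>+\<^sup>1 X\<^sub>i\<close> for real \<open>t\<close> and comparing coefficients of \<open>t\<close>.\<close>

lemma component_matrix_identities:
  assumes P: "P \<in> matrix_identities k"
  shows "component m P \<in> matrix_identities k"
proof -
  have "ncpoly_eval (matrix_algebra k) x (component m P) = 0\<^sub>m k k"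
    if x: "\<And>i. x i \<in> carrier_mat k k \<and> mat_adjoint (x i) = x i" for x
  proof -
    interpret evaluation "matrix_algebra k" x using x by (rule evaluation_matrix)
    obtain n0 where n0: "P = (\<Sum>m\<le>n0. component m P)" by (rule obtain_components)
    have "word_functional (\<lambda>w. matrix_word k x w $$ (a, b)) (component m P) = 0" if ab: "a < k" "b < k" for a b
    proof (cases "m \<le> n0")
      case True
      define c where "c = (\<lambda>m. word_functional (\<lambda>w. matrix_word k x w $$ (a, b)) (component m P))"
      \<comment> \<open>A fixed matrix entry of P at the rescaled letters is a polynomial in t with
        coefficients c m. Real t keeps the rescaled matrices self-adjoint, so they may be
        substituted into an identity.\<close>
      have zero: "(\<Sum>m\<le>n0. c m * (of_real t) ^ m) = 0" for t :: real
      proof -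
        let ?y = "\<lambda>i. complex_of_real t ^ Suc i \<cdot>\<^sub>m x i"
        have y: "?y i \<in> carrier_mat k k \<and> mat_adjoint (?y i) = ?y i" for i
        proof
          have xi: "x i \<in> carrier_mat k k" "mat_adjoint (x i) = x i" using x by blast+
          show "?y i \<in> carrier_mat k k" using xi by simp
          show "mat_adjoint (?y i) = ?y i"
            using invol_smult[of "x i" "complex_of_real t ^ Suc i"] xi by simp
        qed
        have word_y: "matrix_word k ?y w $$ (a, b) =
            of_real t ^ weight w * matrix_word k x w $$ (a, b)" for w
          using scaled_word[OF x, where t = "of_real t" and w = w] carrier_matD[OF word_carrier_mat[OF x]] ab
          by simp
        have "0 = ncpoly_eval (matrix_algebra k) ?y P $$ (a, b)"
          using P y ab by (simp add: matrix_identities_def)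
        also have "\<dots> = word_functional (\<lambda>w. of_real t ^ weight w * matrix_word k x w $$ (a, b)) P"
          by (subst eval_index[OF y ab]) (simp only: word_y)
        also have "\<dots> = (\<Sum>m\<le>n0. word_functional (\<lambda>w. of_real t ^ weight w * matrix_word k x w $$ (a, b))
            (component m P))"
          by (subst n0) (simp only: word_functional_sum)
        also have "\<dots> = (\<Sum>m\<le>n0. c m * of_real t ^ m)"
        proof (rule sum.cong[OF refl])
          fix m
          have "word_functional (\<lambda>w. of_real t ^ weight w * matrix_word k x w $$ (a, b)) (component m P) =
              of_real t ^ m * word_functional (\<lambda>w. matrix_word k x w $$ (a, b)) (component m P) +
              0 * word_functional (\<lambda>w. 0) (component m P)"
            by (rule word_functional_homogeneous[OF homogeneous_component]) simp
          then show "word_functional (\<lambda>w. of_real t ^ weight w * matrix_word k x w $$ (a, b)) (component m P) =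
              c m * of_real t ^ m"
            by (simp add: c_def)
        qed
        finally show ?thesis by simp
      qed
      \<comment> \<open>The polynomial has all real numbers among its roots, hence infinitely many,
        so its coefficients vanish.\<close>
      have "range complex_of_real \<subseteq> {z. (\<Sum>m\<le>n0. c m * z ^ m) = 0}"
        using zero by auto
      moreover have "infinite (range complex_of_real)"
        using finite_imageD[of complex_of_real UNIV] infinite_UNIV_char_0[where 'a = real]
        by (auto simp: inj_on_def)
      ultimately have "infinite {z. (\<Sum>m\<le>n0. c m * z ^ m) = 0}"
        using infinite_super by blast
      then have "c m = 0" using True polyfun_finite_roots[of c n0] by blast
      then show ?thesis by (simp add: c_def)
    next
      case False
      have "Poly_Mapping.lookup P w = 0" if "weight w = m" for w
      proof -
        have "Poly_Mapping.lookup P w = (\<Sum>i\<le>n0. Poly_Mapping.lookup (component i P) w)"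
          by (subst n0) (simp add: lookup_sum)
        also have "\<dots> = 0" using that False by (intro sum.neutral) (auto simp: lookup_component)
        finally show ?thesis .
      qed
      then have "component m P = 0"
        by (intro poly_mapping_eqI) (simp add: lookup_component)
      then show ?thesis by simp
    qed
    then show ?thesis
      using eval_closed[of "component m P"] by (intro eq_matI) (auto simp: eval_index[OF x])
  qed
  then show ?thesis by (simp add: matrix_identities_def)
qed

section \<open>Positive extensions of truncated traces\<close>

text \<open>The subtracted power carries the induction; the resulting bound 2 matches the factor 1 /
  2 in the dominance criterion below.\<close>

lemma sum_quarter_powers_le: "(\<Sum>i\<le>n. (1 / 4 :: real) ^ i) \<le> 2 - (1 / 4) ^ n"
proof (induction n)
  case (Suc n)
  have "0 \<le> (1 / 4 :: real) ^ n" by simp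
  with Suc have "(\<Sum>i\<le>n. (1 / 4 :: real) ^ i) + 1 / 4 * (1 / 4) ^ n \<le> 2 - 1 / 4 * (1 / 4) ^ n"
    by linarith
  then show ?case by simp
qed simp

text \<open>Cauchy-Schwarz with the weights 2^(-i) bounds the sum of the majorants by half the sum
  of 4^(-i) times the sum of the diagonal, hence by the diagonal itself. The decay of the weights
  makes the criterion independent of n, the number of components.\<close>

lemma diagonally_dominant_nonneg:
  fixes E :: "nat \<Rightarrow> nat \<Rightarrow> real"
  assumes diag: "\<And>i. E i i = (b i)\<^sup>2"
    and off_diag: "\<And>i j. i \<noteq> j \<Longrightarrow> \<bar>E i j\<bar> \<le> 1 / 2 * ((1 / 2) ^ i * b i) * ((1 / 2) ^ j * b j)"
  shows "0 \<le> (\<Sum>i\<le>n. \<Sum>j\<le>n. E i j)"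
proof -
  define h where "h = (\<lambda>i. (1 / 2 :: real) ^ i)"
  have E: "(if j = i then (b i)\<^sup>2 else 0) - 1 / 2 * (h i * b i) * (h j * b j) \<le> E i j" for i j
  proof (cases "i = j")
    case True
    have "1 / 2 * (h i * b i) * (h j * b j) = 1 / 2 * (h i * b i)\<^sup>2"
      unfolding True by (simp only: power2_eq_square mult.assoc)
    moreover have "0 \<le> (h i * b i)\<^sup>2" by (rule zero_le_power2)
    ultimately show ?thesis using diag[of i] True by simp
  next
    case False
    then show ?thesis using off_diag[OF False] by (simp add: h_def)
  qed
  have "(\<Sum>i\<le>n. h i * b i)\<^sup>2 \<le> (\<Sum>i\<le>n. (h i)\<^sup>2) * (\<Sum>i\<le>n. (b i)\<^sup>2)"
    by (rule Cauchy_Schwarz_ineq_sum)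
  also have "(\<Sum>i\<le>n. (h i)\<^sup>2) = (\<Sum>i\<le>n. (1 / 4) ^ i)"
    unfolding h_def power_even_eq[symmetric] power_mult by (simp add: power2_eq_square)
  also have "\<dots> * (\<Sum>i\<le>n. (b i)\<^sup>2) \<le> 2 * (\<Sum>i\<le>n. (b i)\<^sup>2)"
    using sum_quarter_powers_le[of n]
    by (intro mult_right_mono sum_nonneg) (auto intro: order_trans)
  finally have "0 \<le> (\<Sum>i\<le>n. (b i)\<^sup>2) - 1 / 2 * (\<Sum>i\<le>n. h i * b i)\<^sup>2" by simp
  also have "1 / 2 * (\<Sum>i\<le>n. h i * b i)\<^sup>2 = (\<Sum>i\<le>n. \<Sum>j\<le>n. 1 / 2 * (h i * b i) * (h j * b j))"
    by (subst power2_eq_square, subst sum_product) (simp only: sum_distrib_left mult.assoc)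
  also have "(\<Sum>i\<le>n. (b i)\<^sup>2) - \<dots> = (\<Sum>i\<le>n. \<Sum>j\<le>n.
      (if j = i then (b i)\<^sup>2 else 0) - 1 / 2 * (h i * b i) * (h j * b j))"
    by (simp add: sum_subtractf)
  also have "\<dots> \<le> (\<Sum>i\<le>n. \<Sum>j\<le>n. E i j)"
    by (intro sum_mono E)
  finally show ?thesis .
qed

text \<open>The difference 4 i^3 + 4 j^3 - (i + j)^3 equals 3 (i + j) (i - j)^2, which is at least 3
  (i + j). This is the reason for cubes: with squares in the exponent the gap would be (i - j)^2,
  which does not grow with i + j and could not absorb the factor 2^(i + j).\<close>

lemma cube_exponent_gap:
  fixes i j :: nat
  assumes "i \<noteq> j"
  shows "(i + j) ^ 3 + (2 + i + j) \<le> 4 * i ^ 3 + 4 * j ^ 3"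
proof -
  have *: "(i + j) ^ 3 + (2 + i + j) \<le> 4 * i ^ 3 + 4 * j ^ 3" if ij: "i < j" for i j :: nat
  proof -
    obtain k where j: "j = Suc (i + k)" using less_imp_Suc_add[OF ij] by blast
    define X where "X = 3 * (i + j) * (k + 1) ^ 2"
    have "4 * i ^ 3 + 4 * j ^ 3 = (i + j) ^ 3 + X"
      unfolding X_def j power3_eq_cube power2_eq_square
      by (simp only: Suc_eq_plus1 distrib_left distrib_right mult_1_left mult_1_right) simp
    moreover have "3 * (i + j) * 1 \<le> X"
      unfolding X_def by (intro mult_le_mono2) simp
    moreover have "1 \<le> i + j" using j by simp
    ultimately show ?thesis by simp
  qed
  show ?thesis
  proof (cases "i < j")
    case False
    with assms have "j < i" by simp
    have "(i + j) ^ 3 + (2 + i + j) = (j + i) ^ 3 + (2 + j + i)" by (simp only: add_ac)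
    also have "\<dots> \<le> 4 * j ^ 3 + 4 * i ^ 3" by (rule *) fact
    also have "\<dots> = 4 * i ^ 3 + 4 * j ^ 3" by (rule add.commute)
    finally show ?thesis .
  qed (rule *)
qed

text \<open>The truncation of \<open>\<sigma>\<close> to weight \<open>\<le> d\<close> is not positive. The coefficients below grow so
  rapidly, and jump so much beyond weight \<open>d\<close>, that \<open>damped_trace\<close> dominates the cross terms which
  the truncation produces.\<close>

definition damping :: "nat \<Rightarrow> real \<Rightarrow> real \<Rightarrow> nat \<Rightarrow> real"
  where "damping d s r m = s\<^sup>2 * 2 ^ (m ^ 3) * r ^ (2 * (m - d))"

text \<open>The square root of \<open>damping\<close> at weight 2 * i, which is the coefficient of
  the i-th diagonal entry. Subtraction is truncated, so r enters only for 2 * i > d: s controls the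
  size of the perturbation up to weight d, and r remains free to outweigh \<sigma> beyond
  it.\<close>

definition damping_root :: "nat \<Rightarrow> real \<Rightarrow> real \<Rightarrow> nat \<Rightarrow> real"
  where "damping_root d s r i = s * 2 ^ (4 * i ^ 3) * r ^ (2 * i - d)"

definition damped_trace ::
    "(nat list \<Rightarrow> complex) \<Rightarrow> (nat list \<Rightarrow> complex) \<Rightarrow> nat \<Rightarrow> real \<Rightarrow> real \<Rightarrow> nat list \<Rightarrow> complex"
  where "damped_trace \<sigma> \<rho> d s r w =
    (if weight w \<le> d then \<sigma> w else 0) + of_real (damping d s r (weight w)) * \<rho> w"

context
  fixes \<sigma> \<rho> :: "nat list \<Rightarrow> complex" and d :: nat and C s r :: real
  assumes S: "tracial_star_algebra ncpoly_algebra (word_functional \<sigma>)"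
    and R: "tracial_star_algebra ncpoly_algebra (word_functional \<rho>)"
    and C: "\<And>i j P Q. \<lbrakk>homogeneous i P; homogeneous j Q; i \<le> d; j \<le> d\<rbrakk> \<Longrightarrow>
      cmod (word_functional \<sigma> (ncpoly_star P * Q)) \<le>
        C * sqrt (Re (word_functional \<rho> (ncpoly_star P * P)))
          * sqrt (Re (word_functional \<rho> (ncpoly_star Q * Q)))"
    and s: "0 < s" and r: "1 \<le> r" and C_le: "0 \<le> C" "C \<le> s\<^sup>2 * r"
begin

interpretation S: tracial_star_algebra ncpoly_algebra "word_functional \<sigma>" by (rule S)
interpretation R: tracial_star_algebra ncpoly_algebra "word_functional \<rho>" by (rule R)

lemma damping_diag: "damping d s r (2 * i) = (damping_root d s r i)\<^sup>2"
proof -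
  have "(2 * i) ^ 3 = 2 * (4 * i ^ 3)" by (simp add: power3_eq_cube)
  then show ?thesis
    by (simp add: damping_def damping_root_def power_mult_distrib power_mult[symmetric] mult.commute)
qed

text \<open>In 4 * 2^(i + j), the power provides the weights of the dominance criterion, one factor
  2 its constant 1 / 2, and the other shares the bound between the \<sigma>-part and the \<rho>-part
  of an entry. The exponents of r compare because i \<mapsto> 2 i - d is convex even with truncated
  subtraction.\<close>

lemma damping_off_diag:
  assumes "i \<noteq> j"
  shows "4 * 2 ^ (i + j) * damping d s r (i + j) \<le> damping_root d s r i * damping_root d s r j"
proof -
  have "4 * 2 ^ (i + j) * damping d s r (i + j) = s\<^sup>2 * 2 ^ ((i + j) ^ 3 + (2 + i + j)) * r ^ (2 * (i + j - d))"
    by (simp add: damping_def power_add)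
  also have "\<dots> \<le> s\<^sup>2 * 2 ^ (4 * i ^ 3 + 4 * j ^ 3) * r ^ ((2 * i - d) + (2 * j - d))"
    using cube_exponent_gap[OF assms] r
    by (intro mult_mono[OF mult_left_mono[OF power_increasing] power_increasing]) auto
  also have "\<dots> = damping_root d s r i * damping_root d s r j"
    by (simp add: damping_root_def power_add power2_eq_square)
  finally show ?thesis .
qed

text \<open>As soon as 2 i or 2 j exceeds d, the right-hand side contains at least one factor r, and
  s^2 r dominates C.\<close>

lemma damping_cross:
  assumes "i \<noteq> j" "d < 2 * i \<or> d < 2 * j"
  shows "4 * 2 ^ (i + j) * C \<le> damping_root d s r i * damping_root d s r j"
proof -
  have "4 * 2 ^ (i + j) * C \<le> 4 * 2 ^ (i + j) * (s\<^sup>2 * r)"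
    using C_le(2) by (intro mult_left_mono) auto
  also have "\<dots> = s\<^sup>2 * 2 ^ (2 + i + j) * r ^ 1"
    by (simp add: power_add)
  also have "\<dots> \<le> s\<^sup>2 * 2 ^ (4 * i ^ 3 + 4 * j ^ 3) * r ^ ((2 * i - d) + (2 * j - d))"
    using cube_exponent_gap[OF assms(1)] assms(2) r
    by (intro mult_mono[OF mult_left_mono[OF power_increasing] power_increasing]) auto
  also have "\<dots> = damping_root d s r i * damping_root d s r j"
    by (simp add: damping_root_def power_add power2_eq_square)
  finally show ?thesis .
qed

lemma Re_damped_trace_nonneg: "0 \<le> Re (word_functional (damped_trace \<sigma> \<rho> d s r) (ncpoly_star P * P))"
proof -
  obtain n where n: "P = (\<Sum>m\<le>n. component m P)" by (rule obtain_components)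
  define q where "q = (\<lambda>m. component m P)"
  have q: "homogeneous m (q m)" for m unfolding q_def by (rule homogeneous_component)
  have P: "P = (\<Sum>m\<le>n. q m)" using n by (simp only: q_def)
  define f where "f = (\<lambda>i j. ncpoly_star (q i) * q j)"
  have star_sum: "ncpoly_star (sum g I) = (\<Sum>i\<in>I. ncpoly_star (g i))" for g :: "nat \<Rightarrow> ncpoly" and I
    by (induction I rule: infinite_finite_induct)
      (simp_all add: ncpoly_star_add ncpoly_star_single[of "[]" 0, simplified])
  have expand: "ncpoly_star (sum q I) * sum q I = (\<Sum>i\<in>I. \<Sum>j\<in>I. f i j)" for I
    by (simp add: star_sum sum_product f_def)
  define low where "low = {i. i \<le> n \<and> 2 * i \<le> d}"
  define Sr where "Sr = (\<lambda>i j. Re (word_functional \<sigma> (f i j)))"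
  define Rr where "Rr = (\<lambda>i j. Re (word_functional \<rho> (f i j)))"
  define a where "a = (\<lambda>i. sqrt (Rr i i))"
  have Rr_nonneg: "0 \<le> Rr i i" for i
    using R.trace_pos_Re[of "q i"] by (simp add: Rr_def f_def)
  then have a: "0 \<le> a i" "Rr i i = (a i)\<^sup>2" for i by (simp_all add: a_def)
  have R_CS: "\<bar>Rr i j\<bar> \<le> a i * a j" for i j
  proof -
    have "(cmod (word_functional \<rho> (f i j)))\<^sup>2 \<le> Rr i i * Rr j j"
      using R.trace_Cauchy_Schwarz[of "q i" "q j"] by (simp add: Rr_def f_def)
    also have "\<dots> = (a i * a j)\<^sup>2" by (simp add: a(2) power_mult_distrib)
    finally have "cmod (word_functional \<rho> (f i j)) \<le> a i * a j"
      by (rule power2_le_imp_le) (simp add: a(1))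
    then show ?thesis
      using abs_Re_le_cmod[of "word_functional \<rho> (f i j)"] by (simp add: Rr_def)
  qed
  have S_CS: "\<bar>Sr i j\<bar> \<le> C * (a i * a j)" if "i \<le> d" "j \<le> d" for i j
    using C[OF q q that] abs_Re_le_cmod[of "word_functional \<sigma> (f i j)"]
    by (simp add: Sr_def a_def Rr_def f_def mult.assoc)
  have damped: "Re (word_functional (damped_trace \<sigma> \<rho> d s r) (f i j)) =
      (if i + j \<le> d then Sr i j else 0) + damping d s r (i + j) * Rr i j" for i j
  proof -
    have "homogeneous (i + j) (f i j)"
      unfolding f_def by (intro homogeneous_mult homogeneous_star q)
    then have "word_functional (damped_trace \<sigma> \<rho> d s r) (f i j) =
        of_bool (i + j \<le> d) * word_functional \<sigma> (f i j) +
        of_real (damping d s r (i + j)) * word_functional \<rho> (f i j)"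
      by (rule word_functional_homogeneous) (simp add: damped_trace_def)
    then show ?thesis by (simp add: Sr_def Rr_def)
  qed
  \<comment> \<open>The Gram matrix of the damped trace with the \<sigma>-block 2 i, 2 j \<le> d
    taken out. The \<sigma>-entries that remain are off the diagonal, since i = j and i + j \<le> d
    would put the entry into the block.\<close>
  define E where "E = (\<lambda>i j. (if i + j \<le> d \<and> \<not> (2 * i \<le> d \<and> 2 * j \<le> d) then Sr i j else 0)
    + damping d s r (i + j) * Rr i j)"
  define b where "b = (\<lambda>i. damping_root d s r i * a i)"
  have root_nonneg: "0 \<le> damping_root d s r i" for i
    using s r by (simp add: damping_root_def)
  have "0 \<le> (\<Sum>i\<le>n. \<Sum>j\<le>n. E i j)"
  proof (rule diagonally_dominant_nonneg)
    show "E i i = (b i)\<^sup>2" for i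
      using damping_diag[of i] by (simp add: E_def b_def a(2) power_mult_distrib mult_2)
  next
    fix i j :: nat assume ij: "i \<noteq> j"
    let ?N = "4 * 2 ^ (i + j) :: real"
    have aa: "0 \<le> a i * a j" by (simp add: a(1))
    have 1: "?N * \<bar>damping d s r (i + j) * Rr i j\<bar> \<le> damping_root d s r i * damping_root d s r j * (a i * a j)"
    proof -
      have "0 \<le> damping d s r (i + j)" using r by (simp add: damping_def)
      then have "?N * \<bar>damping d s r (i + j) * Rr i j\<bar> \<le> ?N * damping d s r (i + j) * (a i * a j)"
        using R_CS[of i j] by (simp add: abs_mult mult.assoc mult_left_mono)
      also have "\<dots> \<le> damping_root d s r i * damping_root d s r j * (a i * a j)"
        by (intro mult_right_mono damping_off_diag ij aa)
      finally show ?thesis .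
    qed
    define X where "X = (if i + j \<le> d \<and> \<not> (2 * i \<le> d \<and> 2 * j \<le> d) then Sr i j else 0)"
    define Z where "Z = damping_root d s r i * damping_root d s r j * (a i * a j)"
    have Z: "0 \<le> Z" unfolding Z_def by (intro mult_nonneg_nonneg root_nonneg aa)
    have 2: "?N * \<bar>X\<bar> \<le> Z"
    proof (cases "i + j \<le> d \<and> \<not> (2 * i \<le> d \<and> 2 * j \<le> d)")
      case True
      have "?N * \<bar>Sr i j\<bar> \<le> ?N * C * (a i * a j)"
        using S_CS[of i j] True by (simp add: mult.assoc)
      also have "\<dots> \<le> Z"
        unfolding Z_def using True by (intro mult_right_mono damping_cross ij aa) auto
      finally show ?thesis unfolding X_def if_P[OF True] .
    next
      case False
      show ?thesis using Z unfolding X_def if_not_P[OF False] by simp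
    qed
    have "\<bar>E i j\<bar> \<le> \<bar>X\<bar> + \<bar>damping d s r (i + j) * Rr i j\<bar>"
      unfolding E_def X_def by (rule abs_triangle_ineq)
    then have "?N * \<bar>E i j\<bar> \<le> ?N * (\<bar>X\<bar> + \<bar>damping d s r (i + j) * Rr i j\<bar>)"
      by (rule mult_left_mono) simp
    also have "\<dots> \<le> 2 * Z"
      using add_mono[OF 2 1[folded Z_def]] by (simp only: distrib_left mult_2)
    finally have "\<bar>E i j\<bar> \<le> 2 * Z / ?N"
      by (simp add: pos_le_divide_eq mult.commute)
    also have "\<dots> = 1 / 2 * ((1 / 2) ^ i * b i) * ((1 / 2) ^ j * b j)"
      by (simp add: Z_def b_def power_add power_one_over mult_ac)
    finally show "\<bar>E i j\<bar> \<le> 1 / 2 * ((1 / 2) ^ i * b i) * ((1 / 2) ^ j * b j)" .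
  qed
  \<comment> \<open>The block taken out satisfies i + j \<le> d throughout, so truncation leaves it
    intact: it is the full \<sigma>-square of the sum of the components in \<open>low\<close>, hence
    nonnegative.\<close>
  also have "(\<Sum>i\<le>n. \<Sum>j\<le>n. E i j) =
    (\<Sum>i\<le>n. \<Sum>j\<le>n. Re (word_functional (damped_trace \<sigma> \<rho> d s r) (f i j))) - (\<Sum>i\<in>low. \<Sum>j\<in>low. Sr i j)"
  proof -
    have low: "low = {..n} \<inter> {i. 2 * i \<le> d}" by (auto simp: low_def)
    have "(\<Sum>i\<in>low. \<Sum>j\<in>low. Sr i j) =
        (\<Sum>i\<le>n. \<Sum>j\<le>n. if 2 * i \<le> d \<and> 2 * j \<le> d then Sr i j else 0)"
      unfolding low by (subst (1 2) sum.inter_restrict) (auto intro!: sum.cong)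
    moreover have "Re (word_functional (damped_trace \<sigma> \<rho> d s r) (f i j)) =
        E i j + (if 2 * i \<le> d \<and> 2 * j \<le> d then Sr i j else 0)" for i j
      by (auto simp: damped E_def)
    ultimately show ?thesis by (simp add: sum.distrib)
  qed
  also have "(\<Sum>i\<in>low. \<Sum>j\<in>low. Sr i j) =
      Re (word_functional \<sigma> (ncpoly_star (sum q low) * sum q low))"
    by (simp add: expand word_functional_sum Sr_def)
  finally have "Re (word_functional \<sigma> (ncpoly_star (sum q low) * sum q low)) \<le>
      (\<Sum>i\<le>n. \<Sum>j\<le>n. Re (word_functional (damped_trace \<sigma> \<rho> d s r) (f i j)))"
    by simp
  moreover have "0 \<le> Re (word_functional \<sigma> (ncpoly_star (sum q low) * sum q low))"
    using S.trace_pos_Re[of "sum q low"] by simp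
  moreover have "Re (word_functional (damped_trace \<sigma> \<rho> d s r) (ncpoly_star P * P)) =
      (\<Sum>i\<le>n. \<Sum>j\<le>n. Re (word_functional (damped_trace \<sigma> \<rho> d s r) (f i j)))"
    unfolding P expand by (simp add: word_functional_sum)
  ultimately show ?thesis by simp
qed

text \<open>The value at the empty word is 1 + s^2, which explains the normalization. Truncation and
  damping depend on the weight alone, which is invariant under rotation and reversal, so cyclicity
  and hermitian symmetry are inherited; the latter makes the values on P* P real.\<close>

lemma tracial_damped_trace:
  "tracial_star_algebra ncpoly_algebra (word_functional (\<lambda>w. damped_trace \<sigma> \<rho> d s r w / of_real (1 + s\<^sup>2)))"
proof (rule tracial_word_functional)
  have pos: "0 < 1 + s\<^sup>2" by (simp add: add_pos_nonneg)
  have "\<sigma> [] = 1" "\<rho> [] = 1"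
    using S.trace_one R.trace_one by (simp_all add: ncpoly_one word_functional_single)
  then have "damped_trace \<sigma> \<rho> d s r [] = of_real (1 + s\<^sup>2)"
    by (simp add: damped_trace_def damping_def)
  moreover have "complex_of_real (1 + s\<^sup>2) \<noteq> 0" using pos by (simp only: of_real_eq_0_iff)
  ultimately show "damped_trace \<sigma> \<rho> d s r [] / of_real (1 + s\<^sup>2) = 1" by simp
  have comm: "\<sigma> (u @ v) = \<sigma> (v @ u)" "\<rho> (u @ v) = \<rho> (v @ u)" for u v
    using S.trace_commute[of "Poly_Mapping.single u 1" "Poly_Mapping.single v 1"]
      R.trace_commute[of "Poly_Mapping.single u 1" "Poly_Mapping.single v 1"]
    by (simp_all add: single_mult_single word_functional_single)
  show "damped_trace \<sigma> \<rho> d s r (u @ v) / of_real (1 + s\<^sup>2) = damped_trace \<sigma> \<rho> d s r (v @ u) / of_real (1 + s\<^sup>2)" for u v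
    by (simp add: damped_trace_def comm[of u v] add.commute)
  have star: "\<sigma> (rev w) = cnj (\<sigma> w)" "\<rho> (rev w) = cnj (\<rho> w)" for w
    using S.trace_invol[of "Poly_Mapping.single w 1"] R.trace_invol[of "Poly_Mapping.single w 1"]
    by (simp_all add: ncpoly_star_single word_functional_single)
  fix P
  have "word_functional (damped_trace \<sigma> \<rho> d s r) (ncpoly_star (ncpoly_star P * P)) =
      cnj (word_functional (damped_trace \<sigma> \<rho> d s r) (ncpoly_star P * P))"
    by (rule word_functional_star) (simp add: damped_trace_def star)
  then have "Im (word_functional (damped_trace \<sigma> \<rho> d s r) (ncpoly_star P * P)) = 0"
    by (simp add: ncpoly_star_mult ncpoly_star_star complex_eq_iff)
  moreover have "word_functional (\<lambda>w. damped_trace \<sigma> \<rho> d s r w / of_real (1 + s\<^sup>2)) Q =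
      word_functional (damped_trace \<sigma> \<rho> d s r) Q / of_real (1 + s\<^sup>2)" for Q
    by (simp add: word_functional_def sum_divide_distrib)
  ultimately show "word_functional (\<lambda>w. damped_trace \<sigma> \<rho> d s r w / of_real (1 + s\<^sup>2)) (ncpoly_star P * P) \<in> \<real>\<^sub>\<ge>\<^sub>0"
    using Re_damped_trace_nonneg[of P] pos
    by (simp only: complex_nonneg_Reals_iff Re_divide_of_real Im_divide_of_real) simp
qed

end

section \<open>Matrices without identities of small weight\<close>

text \<open>Truncations of the operators \<open>l\<^sub>i + l\<^sub>i\<^sup>*\<close> on the full Fock space with basis the words, where
  \<open>l\<^sub>i\<close> prepends the letter \<open>i\<close>. Applied to the vacuum, a word yields itself plus words of
  smaller weight.\<close>

definition fock_matrix :: "nat \<Rightarrow> nat \<Rightarrow> complex mat"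
  where "fock_matrix k i = mat k k (\<lambda>(r, c).
    if list_decode r = i # list_decode c \<or> list_decode c = i # list_decode r then 1 else 0)"

lemma fock_matrix_self_adjoint:
  "fock_matrix k i \<in> carrier_mat k k \<and> mat_adjoint (fock_matrix k i) = fock_matrix k i"
  by (auto simp: fock_matrix_def intro!: eq_matI)

text \<open>The truncated Fock space is spanned by the first k words in the order of
  \<open>list_encode\<close>, not by all words up to some weight; this condition says that no word
  of weight up to d is lost.\<close>

definition codes_below :: "nat \<Rightarrow> nat \<Rightarrow> bool"
  where "codes_below k d \<longleftrightarrow> (\<forall>w. weight w \<le> d \<longrightarrow> list_encode w < k)"

text \<open>Column 0 is the vacuum because \<open>list_encode [] = 0\<close>. In the rows considered
  only the leading term is visible: a row at least as heavy as i # v can be reached by the i-th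
  operator from the column of v only by creation.\<close>

lemma fock_word_column:
  assumes "codes_below k d" "weight v \<le> d" "r < k" "weight v \<le> weight (list_decode r)"
  shows "matrix_word k (fock_matrix k) v $$ (r, 0) = (if r = list_encode v then 1 else 0)"
  using assms(2-4)
proof (induction v arbitrary: r)
  case Nil
  then show ?case by auto
next
  case (Cons i v)
  have v: "weight v \<le> d" using Cons.prems by simp
  have vk: "list_encode v < k" using assms(1) v by (simp add: codes_below_def)
  have k0: "0 < k" using Cons.prems(2) by simp
  have "matrix_word k (fock_matrix k) (i # v) $$ (r, 0) =
      (\<Sum>c<k. fock_matrix k i $$ (r, c) * matrix_word k (fock_matrix k) v $$ (c, 0))"
    using matrix_mult_index[of "fock_matrix k i" k "matrix_word k (fock_matrix k) v" r 0]
      fock_matrix_self_adjoint word_carrier_mat[OF fock_matrix_self_adjoint] Cons.prems(2) k0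
    by simp
  also have "\<dots> = (\<Sum>c<k. if c = list_encode v then if r = list_encode (i # v) then 1 else 0 else 0)"
  proof (rule sum.cong[OF refl])
    fix c assume "c \<in> {..<k}"
    then have c: "c < k" by simp
    have index: "fock_matrix k i $$ (r, c) =
        (if list_decode r = i # list_decode c \<or> list_decode c = i # list_decode r then 1 else 0)"
      using c Cons.prems(2) by (simp add: fock_matrix_def)
    show "fock_matrix k i $$ (r, c) * matrix_word k (fock_matrix k) v $$ (c, 0) =
        (if c = list_encode v then if r = list_encode (i # v) then 1 else 0 else 0)"
    proof (cases "weight v \<le> weight (list_decode c)")
      case True
      then have IH: "matrix_word k (fock_matrix k) v $$ (c, 0) = (if c = list_encode v then 1 else 0)"
        by (rule Cons.IH[OF v c])
      show ?thesis
      proof (cases "c = list_encode v")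
        case c: True
        have "v \<noteq> i # list_decode r"
        proof
          assume "v = i # list_decode r"
          then have "weight v = weight (i # list_decode r)" by (rule arg_cong)
          then show False using Cons.prems(3) by simp
        qed
        moreover have "list_decode r = i # v \<longleftrightarrow> r = list_encode (i # v)"
          by (metis list_decode_inverse list_encode_inverse)
        ultimately have "fock_matrix k i $$ (r, c) = (if r = list_encode (i # v) then 1 else 0)"
          unfolding index unfolding c list_encode_inverse by simp
        then show ?thesis unfolding IH by (simp only: c refl if_True mult_1_right)
      next
        case False
        then show ?thesis by (simp add: IH)
      qed
    next
      case False
      \<comment> \<open>The induction hypothesis says nothing about c lighter than v, but then the
        entry (r, c) is 0: creation from c does not reach the weight of r, and annihilation only
        lowers it.\<close>
      have "list_decode r \<noteq> i # list_decode c"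
      proof
        assume "list_decode r = i # list_decode c"
        then have "weight (list_decode r) = weight (i # list_decode c)" by (rule arg_cong)
        then show False using Cons.prems(3) False by simp
      qed
      moreover have "list_decode c \<noteq> i # list_decode r"
      proof
        assume "list_decode c = i # list_decode r"
        then have "weight (list_decode c) = weight (i # list_decode r)" by (rule arg_cong)
        then show False using Cons.prems(3) False by simp
      qed
      moreover have "c \<noteq> list_encode v" using False by auto
      ultimately show ?thesis by (simp add: index)
    qed
  qed
  also have "\<dots> = (if r = list_encode (i # v) then 1 else 0)"
    using vk by simp
  finally show ?case .
qed

definition fock_trace :: "nat \<Rightarrow> nat list \<Rightarrow> complex"
  where "fock_trace k w = matrix_trace k (matrix_word k (fock_matrix k) w)"

abbreviation fock_eval :: "nat \<Rightarrow> ncpoly \<Rightarrow> complex mat"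
  where "fock_eval k \<equiv> ncpoly_eval (matrix_algebra k) (fock_matrix k)"

lemma evaluation_fock: "evaluation (matrix_algebra k) (fock_matrix k)"
  by (rule evaluation_matrix) (rule fock_matrix_self_adjoint)

lemma fock_trace_eval:
  assumes "1 \<le> k"
  shows "word_functional (fock_trace k) P = matrix_trace k (fock_eval k P)"
  using evaluation.trace_eval[OF evaluation_fock tracial_matrix_algebra[OF assms], of P]
  by (simp add: fock_trace_def[abs_def])

lemma tracial_fock_trace:
  assumes "1 \<le> k"
  shows "tracial_star_algebra ncpoly_algebra (word_functional (fock_trace k))"
proof -
  interpret tracial_hom ncpoly_algebra "\<lambda>P. matrix_trace k (fock_eval k P)" "matrix_algebra k"
    "matrix_trace k" "fock_eval k"
    by (rule evaluation.tracial_hom_eval[OF evaluation_fock tracial_matrix_algebra[OF assms]])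
  have "word_functional (fock_trace k) = (\<lambda>P. matrix_trace k (fock_eval k P))"
    by (rule ext) (rule fock_trace_eval[OF assms])
  then show ?thesis using A.tracial_star_algebra_axioms by simp
qed

text \<open>Words of equal weight do not interfere in the rows of that weight, so the vacuum column
  displays the coefficients. In particular a homogeneous identity of weight at most d is
  zero.\<close>

lemma fock_eval_column:
  assumes "codes_below k d" "homogeneous m P" "m \<le> d" "weight w = m"
  shows "fock_eval k P $$ (list_encode w, 0) = Poly_Mapping.lookup P w"
proof -
  have w: "list_encode w < k" using assms by (simp add: codes_below_def)
  have "fock_eval k P $$ (list_encode w, 0) =
      (\<Sum>v\<in>Poly_Mapping.keys P. Poly_Mapping.lookup P v *
        matrix_word k (fock_matrix k) v $$ (list_encode w, 0))"
    using eval_index[OF fock_matrix_self_adjoint w, where b = 0 and P = P] w by (simp add: word_functional_def)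
  also have "\<dots> = (\<Sum>v\<in>Poly_Mapping.keys P. if v = w then Poly_Mapping.lookup P w else 0)"
  proof (rule sum.cong[OF refl])
    fix v assume "v \<in> Poly_Mapping.keys P"
    then have v: "weight v = m" using assms(2) by (simp add: homogeneous_def)
    have "list_encode w = list_encode v \<longleftrightarrow> v = w" by (metis list_encode_inverse)
    then show "Poly_Mapping.lookup P v * matrix_word k (fock_matrix k) v $$ (list_encode w, 0) =
        (if v = w then Poly_Mapping.lookup P w else 0)"
      using fock_word_column[OF assms(1) _ w, of v] v assms(3,4) by simp
  qed
  also have "\<dots> = Poly_Mapping.lookup P w" by (auto simp: in_keys_iff)
  finally show ?thesis .
qed

text \<open>The coefficient is a matrix entry, bounded by the Hilbert-Schmidt norm; sqrt k undoes
  the normalization of the trace.\<close>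

lemma lookup_le_fock_norm:
  assumes "codes_below k d" "homogeneous m P" "m \<le> d"
  shows "cmod (Poly_Mapping.lookup P w) \<le>
    sqrt (real k) * sqrt (Re (word_functional (fock_trace k) (ncpoly_star P * P)))"
proof (cases "w \<in> Poly_Mapping.keys P")
  case True
  then have w: "weight w = m" using assms(2) by (simp add: homogeneous_def)
  have wk: "list_encode w < k" using assms(1,3) w by (simp add: codes_below_def)
  then have k: "1 \<le> k" by simp
  interpret evaluation "matrix_algebra k" "fock_matrix k" by (rule evaluation_fock)
  have M: "fock_eval k P \<in> carrier_mat k k" using eval_closed[of P] by simp
  have "word_functional (fock_trace k) (ncpoly_star P * P) =
      matrix_trace k (mat_adjoint (fock_eval k P) * fock_eval k P)"
    by (simp add: fock_trace_eval[OF k] eval_mult eval_star)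
  also have "Re \<dots> = (\<Sum>i<k. \<Sum>j<k. (cmod (fock_eval k P $$ (j, i)))\<^sup>2) / real k"
    by (simp only: matrix_trace_adjoint_mult[OF M] Re_complex_of_real)
  finally have *: "real k * Re (word_functional (fock_trace k) (ncpoly_star P * P)) =
      (\<Sum>i<k. \<Sum>j<k. (cmod (fock_eval k P $$ (j, i)))\<^sup>2)"
    using k by simp
  have "(cmod (Poly_Mapping.lookup P w))\<^sup>2 = (cmod (fock_eval k P $$ (list_encode w, 0)))\<^sup>2"
    by (simp add: fock_eval_column[OF assms w])
  also have "\<dots> \<le> (\<Sum>j<k. (cmod (fock_eval k P $$ (j, 0)))\<^sup>2)"
    using wk by (intro member_le_sum[of _ _ "\<lambda>j. (cmod (fock_eval k P $$ (j, 0)))\<^sup>2"]) auto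
  also have "\<dots> \<le> (\<Sum>i<k. \<Sum>j<k. (cmod (fock_eval k P $$ (j, i)))\<^sup>2)"
    using k by (intro member_le_sum[of _ _ "\<lambda>i. \<Sum>j<k. (cmod (fock_eval k P $$ (j, i)))\<^sup>2"])
      (auto intro: sum_nonneg)
  finally show ?thesis
    unfolding *[symmetric] real_sqrt_mult[symmetric] by (rule real_le_rsqrt)
next
  case False
  then have "Poly_Mapping.lookup P w = 0" by (simp add: in_keys_iff)
  moreover have "1 \<le> k"
    using assms(1) unfolding codes_below_def by (metis One_nat_def Suc_leI gr_zeroI le0 not_less0 weight_simps(1))
  then have "0 \<le> Re (word_functional (fock_trace k) (ncpoly_star P * P))"
    using tracial_star_algebra.trace_pos_Re[OF tracial_fock_trace, of k P] by simp
  ultimately show ?thesis by simp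
qed

section \<open>Traces on generic matrices\<close>

lemma exists_approximate_trace:
  assumes S: "tracial_star_algebra ncpoly_algebra (word_functional \<sigma>)"
    and codes: "codes_below k d" and k: "1 \<le> k" and \<epsilon>: "0 < \<epsilon>"
  obtains L where "tracial_star_algebra ncpoly_algebra (word_functional L)"
    "\<And>P. P \<in> matrix_identities k \<Longrightarrow> word_functional L P = 0"
    "\<And>w. weight w \<le> d \<Longrightarrow> cmod (L w - \<sigma> w) \<le> \<epsilon>"
proof -
  define K where "K = {w. weight w \<le> d}"
  define \<rho> where "\<rho> = fock_trace k"
  have finK: "finite K" unfolding K_def by (rule finite_weight_le)
  \<comment> \<open>Each of the two coefficients in the expansion of P* Q costs a factor sqrt
    k.\<close>
  define C where "C = real k * (\<Sum>u\<in>K. \<Sum>v\<in>K. cmod (\<sigma> (rev u @ v)))"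
  \<comment> \<open>Up to weight d, \<open>damping\<close> is at most s^2 * 2^(d^3), so s^2 * D
    bounds the error made on any word there, including the one from the normalization.\<close>
  define D where "D = (\<Sum>w\<in>K. 2 ^ (d ^ 3) * cmod (\<rho> w) + cmod (\<sigma> w))"
  define s where "s = sqrt (\<epsilon> / (1 + D))"
  \<comment> \<open>Chosen after s, since r acts only above weight d and leaves the approximation
    error alone.\<close>
  define r where "r = max 1 (C / s\<^sup>2)"
  have D0: "0 \<le> D" unfolding D_def by (intro sum_nonneg) auto
  have C0: "0 \<le> C" unfolding C_def by (intro mult_nonneg_nonneg sum_nonneg) auto
  have s: "0 < s" and s2: "s\<^sup>2 = \<epsilon> / (1 + D)" using \<epsilon> D0 by (simp_all add: s_def)
  have r: "1 \<le> r" by (simp add: r_def)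
  have Cr: "C \<le> s\<^sup>2 * r"
  proof -
    have "C = s\<^sup>2 * (C / s\<^sup>2)" using s by simp
    also have "\<dots> \<le> s\<^sup>2 * r" unfolding r_def by (intro mult_left_mono) auto
    finally show ?thesis .
  qed
  have R: "tracial_star_algebra ncpoly_algebra (word_functional \<rho>)"
    unfolding \<rho>_def by (rule tracial_fock_trace[OF k])
  have bound: "cmod (word_functional \<sigma> (ncpoly_star P * Q)) \<le>
      C * sqrt (Re (word_functional \<rho> (ncpoly_star P * P)))
        * sqrt (Re (word_functional \<rho> (ncpoly_star Q * Q)))"
    if P: "homogeneous i P" and Q: "homogeneous j Q" and ij: "i \<le> d" "j \<le> d" for i j P Q
  proof -
    define p where "p = sqrt (Re (word_functional \<rho> (ncpoly_star P * P)))"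
    define q where "q = sqrt (Re (word_functional \<rho> (ncpoly_star Q * Q)))"
    have le: "cmod (Poly_Mapping.lookup P u) \<le> sqrt (real k) * p"
      "cmod (Poly_Mapping.lookup Q u) \<le> sqrt (real k) * q" for u
      using lookup_le_fock_norm[OF codes P ij(1)] lookup_le_fock_norm[OF codes Q ij(2)]
      by (simp_all add: p_def q_def \<rho>_def)
    then have nonneg: "0 \<le> sqrt (real k) * p" "0 \<le> sqrt (real k) * q"
      using norm_ge_zero order_trans by blast+
    have keys: "Poly_Mapping.keys P \<subseteq> K" "Poly_Mapping.keys Q \<subseteq> K"
      using P Q ij by (auto simp: homogeneous_def K_def)
    have "cmod (word_functional \<sigma> (ncpoly_star P * Q)) \<le>
        (\<Sum>u\<in>Poly_Mapping.keys P. \<Sum>v\<in>Poly_Mapping.keys Q.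
          cmod (cnj (Poly_Mapping.lookup P u) * Poly_Mapping.lookup Q v * \<sigma> (rev u @ v)))"
      unfolding word_functional_star_mult by (intro sum_norm_le norm_sum)
    also have "\<dots> \<le> (\<Sum>u\<in>Poly_Mapping.keys P. \<Sum>v\<in>Poly_Mapping.keys Q.
        (sqrt (real k) * p) * (sqrt (real k) * q) * cmod (\<sigma> (rev u @ v)))"
      using le nonneg by (intro sum_mono) (simp add: norm_mult mult_mono mult_right_mono)
    also have "\<dots> \<le> (\<Sum>u\<in>K. \<Sum>v\<in>K. (sqrt (real k) * p) * (sqrt (real k) * q) * cmod (\<sigma> (rev u @ v)))"
    proof -
      have nn: "0 \<le> (sqrt (real k) * p) * (sqrt (real k) * q) * cmod (\<sigma> w)" for w
        by (intro mult_nonneg_nonneg nonneg norm_ge_zero)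
      have "(\<Sum>u\<in>Poly_Mapping.keys P. \<Sum>v\<in>Poly_Mapping.keys Q.
          (sqrt (real k) * p) * (sqrt (real k) * q) * cmod (\<sigma> (rev u @ v))) \<le>
          (\<Sum>u\<in>Poly_Mapping.keys P. \<Sum>v\<in>K.
          (sqrt (real k) * p) * (sqrt (real k) * q) * cmod (\<sigma> (rev u @ v)))"
        by (intro sum_mono sum_mono2 finK keys nn)
      also have "\<dots> \<le> (\<Sum>u\<in>K. \<Sum>v\<in>K. (sqrt (real k) * p) * (sqrt (real k) * q) * cmod (\<sigma> (rev u @ v)))"
        by (intro sum_mono2 finK keys sum_nonneg nn)
      finally show ?thesis .
    qed
    also have "\<dots> = (sqrt (real k) * p) * (sqrt (real k) * q) * (\<Sum>u\<in>K. \<Sum>v\<in>K. cmod (\<sigma> (rev u @ v)))"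
      by (simp only: sum_distrib_left)
    also have "\<dots> = C * p * q"
      by (simp add: C_def mult_ac flip: mult.assoc[of "sqrt (real k)" "sqrt (real k)"])
    finally show ?thesis unfolding p_def q_def .
  qed
  note damped = S R bound s r C0 Cr
  define L where "L = (\<lambda>w. damped_trace \<sigma> \<rho> d s r w / of_real (1 + s\<^sup>2))"
  have pos: "0 < 1 + s\<^sup>2" by (simp add: add_pos_nonneg)
  show ?thesis
  proof (rule that)
    show "tracial_star_algebra ncpoly_algebra (word_functional L)"
      unfolding L_def by (rule tracial_damped_trace[OF damped])
  next
    fix P assume P: "P \<in> matrix_identities k"
    obtain n where n: "P = (\<Sum>m\<le>n. component m P)" by (rule obtain_components)
    \<comment> \<open>Components of identities are identities. Above weight d, L is a multiple of
      \<rho>, a trace of matrices substituted into the component; up to weight d the component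
      itself is zero.\<close>
    have "word_functional L (component m P) = 0" for m
    proof -
      have "component m P \<in> matrix_identities k" using P by (rule component_matrix_identities)
      then have ev: "fock_eval k (component m P) = 0\<^sub>m k k"
        using fock_matrix_self_adjoint by (auto simp: matrix_identities_def)
      have 1: "word_functional \<rho> (component m P) = 0"
        by (simp add: \<rho>_def fock_trace_eval[OF k] ev matrix_trace_def)
      have 2: "component m P = 0" if "m \<le> d"
      proof (rule poly_mapping_eqI)
        fix w
        show "Poly_Mapping.lookup (component m P) w = Poly_Mapping.lookup 0 w"
        proof (cases "weight w = m")
          case True
          then have "list_encode w < k" using codes that by (simp add: codes_below_def)
          then show ?thesis
            using fock_eval_column[OF codes homogeneous_component that True, of P] ev by simp
        qed (simp add: lookup_component)
      qed
      show ?thesis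
      proof (cases "m \<le> d")
        case False
        have "word_functional L (component m P) =
            of_real (damping d s r m / (1 + s\<^sup>2)) * word_functional \<rho> (component m P) +
            0 * word_functional \<rho> (component m P)"
          by (rule word_functional_homogeneous[OF homogeneous_component])
            (use False in \<open>simp add: L_def damped_trace_def\<close>)
        then show ?thesis using 1 by simp
      qed (simp add: 2)
    qed
    then show "word_functional L P = 0"
      by (subst n) (simp add: word_functional_sum)
  next
    fix w assume w: "weight w \<le> d"
    then have wK: "w \<in> K" by (simp add: K_def)
    define c where "c = damping d s r (weight w)"
    have c0: "0 \<le> c" using r by (simp add: c_def damping_def)
    have c: "c \<le> s\<^sup>2 * 2 ^ (d ^ 3)"
      using w by (simp add: c_def damping_def power_mono power_increasing mult_left_mono)
    have "L w - \<sigma> w = (of_real c * \<rho> w - of_real (s\<^sup>2) * \<sigma> w) / of_real (1 + s\<^sup>2)"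
    proof -
      have "complex_of_real (1 + s\<^sup>2) \<noteq> 0" using pos by (simp only: of_real_eq_0_iff)
      then show ?thesis
        using w by (simp add: L_def damped_trace_def c_def divide_simps) (simp add: algebra_simps)
    qed
    then have "cmod (L w - \<sigma> w) = cmod (of_real c * \<rho> w - of_real (s\<^sup>2) * \<sigma> w) / (1 + s\<^sup>2)"
      using pos by (simp only: norm_divide norm_of_real abs_of_pos)
    also have "\<dots> \<le> cmod (of_real c * \<rho> w - of_real (s\<^sup>2) * \<sigma> w) / 1"
      using pos by (intro divide_left_mono) auto
    also have "\<dots> \<le> c * cmod (\<rho> w) + s\<^sup>2 * cmod (\<sigma> w)"
      using norm_triangle_ineq4[of "of_real c * \<rho> w" "of_real (s\<^sup>2) * \<sigma> w"] c0
      by (simp add: norm_mult norm_power)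
    also have "\<dots> \<le> s\<^sup>2 * 2 ^ (d ^ 3) * cmod (\<rho> w) + s\<^sup>2 * cmod (\<sigma> w)"
      using c by (intro add_right_mono mult_right_mono) auto
    also have "\<dots> = s\<^sup>2 * (2 ^ (d ^ 3) * cmod (\<rho> w) + cmod (\<sigma> w))"
      by (simp add: distrib_left mult.assoc)
    also have "\<dots> \<le> s\<^sup>2 * D"
      unfolding D_def
      by (intro mult_left_mono member_le_sum[OF wK _ finK, of "\<lambda>w. 2 ^ (d ^ 3) * cmod (\<rho> w) + cmod (\<sigma> w)"])
        auto
    also have "\<dots> \<le> \<epsilon>"
      using D0 \<epsilon> by (simp add: s2 divide_simps)
    finally show "cmod (L w - \<sigma> w) \<le> \<epsilon>" .
  qed
qed

text \<open>Take the largest admissible weight; the clause \<open>d \<le> k\<close> makes the set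
  evidently finite. Weight 0 is admissible for k \<ge> 1 because the empty word has code 0, and any
  given weight is admissible for large k because it bounds only finitely many words.\<close>

lemma exists_codes_below:
  obtains d where "\<And>k. 1 \<le> k \<Longrightarrow> codes_below k (d k)" "filterlim d at_top sequentially"
proof -
  define Ds where "Ds = (\<lambda>k. {d. d \<le> k \<and> codes_below k d})"
  have fin: "finite (Ds k)" for k by (rule finite_subset[of _ "{..k}"]) (auto simp: Ds_def)
  have "list_encode w < k" if "1 \<le> k" "weight w \<le> 0" for k w
    using that by (cases w) auto
  then have "0 \<in> Ds k" if "1 \<le> k" for k
    using that unfolding Ds_def codes_below_def by blast
  then have Max: "Max (Ds k) \<in> Ds k" if "1 \<le> k" for k
    using that fin[of k] by (intro Max_in) auto
  have "filterlim (\<lambda>k. Max (Ds k)) at_top sequentially"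
    unfolding filterlim_at_top
  proof
    fix D :: nat
    define N where "N = Max (insert D (list_encode ` {w. weight w \<le> D}))"
    have N: "D \<le> N" "\<And>w. weight w \<le> D \<Longrightarrow> list_encode w \<le> N"
      using finite_weight_le[of D] by (auto simp: N_def)
    show "\<forall>\<^sub>F k in sequentially. D \<le> Max (Ds k)"
    proof (rule eventually_sequentiallyI)
      fix k assume k: "Suc N \<le> k"
      then have "D \<in> Ds k" using N by (fastforce simp: Ds_def codes_below_def)
      then show "D \<le> Max (Ds k)" using fin by (rule Max_ge[rotated])
    qed
  qed
  with Max show ?thesis by (intro that[of "\<lambda>k. Max (Ds k)"]) (auto simp: Ds_def)
qed

text \<open>A diagonal choice: size k gets truncation weight d k and error 1 / k, so every fixed
  word is eventually covered.\<close>

lemma exists_trace_sequence: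
  assumes S: "tracial_star_algebra ncpoly_algebra (word_functional \<sigma>)"
  obtains L where
    "\<And>k. 1 \<le> k \<Longrightarrow> tracial_star_algebra ncpoly_algebra (word_functional (L k))"
    "\<And>k P. \<lbrakk>1 \<le> k; P \<in> matrix_identities k\<rbrakk> \<Longrightarrow> word_functional (L k) P = 0"
    "\<And>P. (\<lambda>k. word_functional (L k) P) \<longlonglongrightarrow> word_functional \<sigma> P"
proof -
  obtain d where d: "\<And>k. 1 \<le> k \<Longrightarrow> codes_below k (d k)" and d_lim: "filterlim d at_top sequentially"
    by (rule exists_codes_below) blast
  have "\<exists>L. 1 \<le> k \<longrightarrow> tracial_star_algebra ncpoly_algebra (word_functional L) \<and>
      (\<forall>P\<in>matrix_identities k. word_functional L P = 0) \<and>
      (\<forall>w. weight w \<le> d k \<longrightarrow> cmod (L w - \<sigma> w) \<le> 1 / real k)" for k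
  proof (cases "1 \<le> k")
    case True
    then have "0 < 1 / real k" by simp
    from exists_approximate_trace[OF S d[OF True] True this] show ?thesis by metis
  qed simp
  then obtain L where L: "\<And>k. 1 \<le> k \<Longrightarrow> tracial_star_algebra ncpoly_algebra (word_functional (L k))"
      "\<And>k P. \<lbrakk>1 \<le> k; P \<in> matrix_identities k\<rbrakk> \<Longrightarrow> word_functional (L k) P = 0"
      "\<And>k w. \<lbrakk>1 \<le> k; weight w \<le> d k\<rbrakk> \<Longrightarrow> cmod (L k w - \<sigma> w) \<le> 1 / real k"
    by metis
  have "(\<lambda>k. L k w) \<longlonglongrightarrow> \<sigma> w" for w
  proof -
    have "\<forall>\<^sub>F k in sequentially. weight w \<le> d k"
      using d_lim by (simp add: filterlim_at_top)
    then have "\<forall>\<^sub>F k in sequentially. norm (L k w - \<sigma> w) \<le> 1 / real k"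
      using eventually_ge_at_top[of 1] by eventually_elim (rule L(3))
    then have "(\<lambda>k. L k w - \<sigma> w) \<longlonglongrightarrow> 0"
      by (rule Lim_null_comparison) (rule lim_1_over_n)
    then show ?thesis by (rule LIM_zero_cancel)
  qed
  then have "(\<lambda>k. word_functional (L k) P) \<longlonglongrightarrow> word_functional \<sigma> P" for P
    unfolding word_functional_def by (intro tendsto_sum tendsto_mult tendsto_const)
  with L(1,2) show ?thesis by (rule that)
qed

section \<open>The embedding\<close>

text \<open>A generator s is replaced by two self-adjoint elements: s + s* at an even letter, and i
  times the difference of s and s* at the next odd one. Half the first minus i / 2 times the second
  recovers s.\<close>

lemma countably_generated_evaluation:
  assumes "star_algebra A" "countably_generated A"
  obtains x where "evaluation A x" "ncpoly_eval A x ` UNIV = carrier A"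
proof -
  interpret star_algebra A by fact
  obtain S where S: "countable S" "S \<subseteq> carrier A" "generate_star_algebra A S = carrier A"
    using assms(2) by (auto simp: countably_generated_def)
  \<comment> \<open>Adding the unit makes the set nonempty, as the enumeration requires.\<close>
  define s where "s = from_nat_into (insert \<one>\<^bsub>A\<^esub> S)"
  have s_range: "range s = insert \<one>\<^bsub>A\<^esub> S"
    unfolding s_def using S(1) by (intro range_from_nat_into) auto
  have s [simp]: "s j \<in> carrier A" for j
    using rangeI[of s j] S(2) unfolding s_range by auto
  define x where "x = (\<lambda>n. if even n then s (n div 2) \<oplus>\<^bsub>A\<^esub> invol A (s (n div 2))
    else \<i> \<odot>\<^bsub>A\<^esub> s (n div 2) \<oplus>\<^bsub>A\<^esub> (- \<i>) \<odot>\<^bsub>A\<^esub> invol A (s (n div 2)))"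
  have "evaluation A x"
  proof (intro evaluation.intro assms(1) evaluation_axioms.intro)
    show "x n \<in> carrier A" for n by (simp add: x_def)
    show "invol A (x n) = x n" for n
      by (cases "even n") (simp_all add: x_def invol_add invol_smult a_comm)
  qed
  then interpret evaluation A x .
  have s_eval: "s j \<in> range eval" for j
  proof -
    have "eval (Poly_Mapping.single [2 * j] (1 / 2) + Poly_Mapping.single [2 * j + 1] (- \<i> / 2)) =
        (1 / 2) \<odot>\<^bsub>A\<^esub> x (2 * j) \<oplus>\<^bsub>A\<^esub> (- \<i> / 2) \<odot>\<^bsub>A\<^esub> x (2 * j + 1)"
      by (simp add: eval_add eval_single)
    also have "x (2 * j) = s j \<oplus>\<^bsub>A\<^esub> invol A (s j)" by (simp add: x_def)
    also have "x (2 * j + 1) = \<i> \<odot>\<^bsub>A\<^esub> s j \<oplus>\<^bsub>A\<^esub> (- \<i>) \<odot>\<^bsub>A\<^esub> invol A (s j)" by (simp add: x_def)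
    also have "(1 / 2) \<odot>\<^bsub>A\<^esub> (s j \<oplus>\<^bsub>A\<^esub> invol A (s j)) \<oplus>\<^bsub>A\<^esub>
        (- \<i> / 2) \<odot>\<^bsub>A\<^esub> (\<i> \<odot>\<^bsub>A\<^esub> s j \<oplus>\<^bsub>A\<^esub> (- \<i>) \<odot>\<^bsub>A\<^esub> invol A (s j)) =
        ((1 / 2) \<odot>\<^bsub>A\<^esub> s j \<oplus>\<^bsub>A\<^esub> (1 / 2) \<odot>\<^bsub>A\<^esub> invol A (s j)) \<oplus>\<^bsub>A\<^esub>
        ((1 / 2) \<odot>\<^bsub>A\<^esub> s j \<oplus>\<^bsub>A\<^esub> (- 1 / 2) \<odot>\<^bsub>A\<^esub> invol A (s j))"
      by (simp add: scale_add_right scale_scale[symmetric])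
    also have "\<dots> = ((1 / 2) \<odot>\<^bsub>A\<^esub> s j \<oplus>\<^bsub>A\<^esub> (1 / 2) \<odot>\<^bsub>A\<^esub> s j) \<oplus>\<^bsub>A\<^esub>
        ((1 / 2) \<odot>\<^bsub>A\<^esub> invol A (s j) \<oplus>\<^bsub>A\<^esub> (- 1 / 2) \<odot>\<^bsub>A\<^esub> invol A (s j))"
      by (simp add: a_ac)
    also have "\<dots> = s j"
      by (simp add: scale_add_left[symmetric] scale_one scale_zero_left)
    finally show ?thesis by (metis rangeI)
  qed
  have "carrier A \<subseteq> range eval"
  proof
    fix a assume "a \<in> carrier A"
    then have "a \<in> generate_star_algebra A S" by (simp add: S(3))
    then show "a \<in> range eval"
    proof induction
      case one
      show ?case by (rule range_eqI[of _ _ 1]) (simp add: eval_one)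
    next
      case (incl a)
      then obtain j where "a = s j" using s_range by blast
      then show ?case using s_eval by simp
    next
      case (add a b)
      then obtain P Q where "a = eval P" "b = eval Q" by blast
      then show ?case by (intro range_eqI[of _ _ "P + Q"]) (simp add: eval_add)
    next
      case (smult a c)
      then obtain P where "a = eval P" by blast
      then show ?case
        by (intro range_eqI[of _ _ "Poly_Mapping.single [] c * P"]) (simp add: eval_scale)
    next
      case (mult a b)
      then obtain P Q where "a = eval P" "b = eval Q" by blast
      then show ?case by (intro range_eqI[of _ _ "P * Q"]) (simp add: eval_mult)
    next
      case (invol a)
      then obtain P where "a = eval P" by blast
      then show ?case by (intro range_eqI[of _ _ "ncpoly_star P"]) (simp add: eval_star)
    qed
  qed
  then have "eval ` UNIV = carrier A" by auto
  with \<open>evaluation A x\<close> show ?thesis by (rule that)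
qed

text \<open>An ultrafilter containing a singleton is principal, so each k \<ge> 1 is avoided and
  thus each initial segment. The index 0 is avoided because the filter lives on
  \<open>{1..}\<close>.\<close>

lemma nonprincipal_le_sequentially:
  assumes "ultrafilter_on {1..} \<omega>" "nonprincipal_on {1..} \<omega>"
  shows "\<omega> \<le> (sequentially :: nat filter)"
proof (rule filter_leI)
  have ne: "\<omega> \<noteq> bot" and I: "\<forall>\<^sub>F i in \<omega>. i \<in> {1..}"
    and ultra: "\<And>P. (\<forall>\<^sub>F i in \<omega>. P i) \<or> (\<forall>\<^sub>F i in \<omega>. \<not> P i)"
    using assms(1) by (auto simp: ultrafilter_on_def)
  have neq: "\<forall>\<^sub>F i in \<omega>. i \<noteq> k" if k: "k \<in> {1..}" for k
  proof (rule ccontr)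
    assume "\<not> (\<forall>\<^sub>F i in \<omega>. i \<noteq> k)"
    then have ev: "\<forall>\<^sub>F i in \<omega>. i = k" using ultra[of "\<lambda>i. i = k"] by blast
    have "\<omega> = principal {k}"
    proof (rule antisym)
      show "\<omega> \<le> principal {k}" using ev by (simp add: le_principal)
      show "principal {k} \<le> \<omega>"
      proof (rule filter_leI)
        fix P assume "eventually P \<omega>"
        then have "\<forall>\<^sub>F i in \<omega>. P k" using ev by eventually_elim simp
        then have "P k" by (rule eventually_happens'[OF ne, THEN exE])
        then show "eventually P (principal {k})" by (simp add: eventually_principal)
      qed
    qed
    moreover have "\<omega> \<noteq> principal {k}"
      using assms(2) k unfolding nonprincipal_on_def by (rule bspec)
    ultimately show False by (rule notE[rotated])
  qed
  have large: "\<forall>\<^sub>F i in \<omega>. N < i" for N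
  proof (induction N)
    case 0
    show ?case using I by eventually_elim simp
  next
    case (Suc N)
    have "\<forall>\<^sub>F i in \<omega>. i \<noteq> Suc N" by (rule neq) simp
    with Suc show ?case by eventually_elim simp
  qed
  fix P :: "nat \<Rightarrow> bool" assume "eventually P sequentially"
  then obtain N where N: "\<And>n. N \<le> n \<Longrightarrow> P n" unfolding eventually_sequentially by blast
  show "eventually P \<omega>" using large[of N] by eventually_elim (rule N, simp)
qed

theorem theorem3p2:
  fixes A :: "'a star_algebra" and \<tau> :: "'a \<Rightarrow> complex" and \<omega> :: "nat filter"
  assumes "tracial_star_algebra A \<tau>"
    and "countably_generated A"
    and "ultrafilter_on {1..} \<omega>"
    and "nonprincipal_on {1..} \<omega>"
  shows "\<exists>\<tau>' :: nat \<Rightarrow> ncpoly set \<Rightarrow> complex.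
    (\<forall>k\<ge>1. tracial_star_algebra (generic_matrix_algebra k) (\<tau>' k)) \<and>
    (\<exists>\<phi>. tracial_hom A \<tau>
      (metric_ultraproduct {1..} \<omega> generic_matrix_algebra \<tau>')
      (metric_ultraproduct_trace \<omega> \<tau>') \<phi>)"
proof -
  interpret A: tracial_star_algebra A \<tau> by fact
  obtain x where x: "evaluation A x" and surj: "ncpoly_eval A x ` UNIV = carrier A"
    using countably_generated_evaluation[OF A.star_algebra_axioms assms(2)] by blast
  interpret x: evaluation A x by (rule x)
  define \<sigma> where "\<sigma> = (\<lambda>w. \<tau> (list_mult A (map x w)))"
  have \<sigma>_eval: "\<tau> (ncpoly_eval A x P) = word_functional \<sigma> P" for P
    unfolding \<sigma>_def by (rule x.trace_eval[OF assms(1)])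
  have hom_A: "tracial_hom ncpoly_algebra (word_functional \<sigma>) A \<tau> (ncpoly_eval A x)"
    using x.tracial_hom_eval[OF assms(1)] by (simp add: \<sigma>_eval)
  then interpret hA: tracial_hom ncpoly_algebra "word_functional \<sigma>" A \<tau> "ncpoly_eval A x" .
  have S: "tracial_star_algebra ncpoly_algebra (word_functional \<sigma>)"
    by (rule hA.A.tracial_star_algebra_axioms)
  obtain L where L: "\<And>k. 1 \<le> k \<Longrightarrow> tracial_star_algebra ncpoly_algebra (word_functional (L k))"
    and L_zero: "\<And>k P. \<lbrakk>1 \<le> k; P \<in> matrix_identities k\<rbrakk> \<Longrightarrow> word_functional (L k) P = 0"
    and L_lim: "\<And>P. (\<lambda>k. word_functional (L k) P) \<longlonglongrightarrow> word_functional \<sigma> P"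
    by (rule exists_trace_sequence[OF S]) blast
  define \<tau>' where "\<tau>' = (\<lambda>k. quotient_trace (word_functional (L k)))"
  define \<pi> where "\<pi> = (\<lambda>k P. matrix_identities k +>\<^bsub>ncpoly_algebra\<^esub> P)"
  define G where "G = generic_matrix_algebra"
  have G: "G k = quotient_star_algebra ncpoly_algebra (matrix_identities k)" for k
    by (simp add: G_def generic_matrix_algebra_def)
  note J = star_ideal_matrix_identities
  have L_cong: "word_functional (L k) P = word_functional (L k) Q"
    if "1 \<le> k" "P \<ominus>\<^bsub>ncpoly_algebra\<^esub> Q \<in> matrix_identities k" for k P Q
  proof -
    have "P = (P \<ominus>\<^bsub>ncpoly_algebra\<^esub> Q) + Q"
      using hA.A.minus_eq_scale[of Q] by (simp add: a_minus_def single_uminus flip: ncpoly_one)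
    then have "word_functional (L k) P =
        word_functional (L k) (P \<ominus>\<^bsub>ncpoly_algebra\<^esub> Q) + word_functional (L k) Q"
      by (metis word_functional_add)
    then show ?thesis using L_zero[OF that] by simp
  qed
  have tracial: "tracial_star_algebra (G k) (\<tau>' k)" if "1 \<le> k" for k
    unfolding G \<tau>'_def
    by (rule star_ideal.tracial_star_algebra_quotient[OF J L[OF that] L_cong[OF that]])
  have \<pi>_hom: "\<pi> k P \<in> carrier (G k)" "\<pi> k (P * Q) = \<pi> k P \<otimes>\<^bsub>G k\<^esub> \<pi> k Q"
    "\<pi> k (P + Q) = \<pi> k P \<oplus>\<^bsub>G k\<^esub> \<pi> k Q" "\<pi> k 1 = \<one>\<^bsub>G k\<^esub>"
    "\<pi> k (Poly_Mapping.single [] c * P) = c \<odot>\<^bsub>G k\<^esub> \<pi> k P"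
    "\<pi> k (ncpoly_star P) = invol (G k) (\<pi> k P)"
    "\<pi> k (P [^]\<^bsub>ncpoly_algebra\<^esub> q) = \<pi> k P [^]\<^bsub>G k\<^esub> q" for k P Q c and q :: nat
    unfolding \<pi>_def G
    by (simp_all add: star_ideal.coset_simps[OF J] star_ideal.carrier_quotient[OF J]
        star_ideal.coset_pow[OF J])
  have \<tau>'_\<pi>: "\<tau>' k (\<pi> k P) = word_functional (L k) P" if "1 \<le> k" for k P
    unfolding \<tau>'_def \<pi>_def
    by (rule star_ideal.quotient_trace_coset[OF J _ L_cong[OF that]]) simp_all
  interpret fam: tracial_family "{1..}" G \<tau>'
    by (rule tracial_family.intro) (simp add: tracial)
  define \<psi> where "\<psi> = (\<lambda>P. \<lambda>k\<in>{1..}. \<pi> k P)"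
  have \<psi>_closed: "\<psi> P \<in> carrier fam.B" for P
    unfolding \<psi>_def
  proof (rule fam.bounded_productI)
    fix q :: nat
    let ?R = "(ncpoly_star P * P) [^]\<^bsub>ncpoly_algebra\<^esub> q"
    \<comment> \<open>The moment of \<open>\<psi> P\<close> at k is the value of \<open>L k\<close>
      at a polynomial independent of k; these values converge, hence are bounded.\<close>
    have "Bseq (\<lambda>k. word_functional (L k) ?R)"
      using L_lim by (intro convergent_imp_Bseq convergentI)
    then obtain C where "\<And>k. cmod (word_functional (L k) ?R) \<le> C"
      by (auto simp: Bseq_def)
    then show "\<exists>C. \<forall>k\<in>{1..}. cmod (\<tau>' k ((invol (G k) (\<pi> k P) \<otimes>\<^bsub>G k\<^esub> \<pi> k P) [^]\<^bsub>G k\<^esub> q)) \<le> C"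
      by (auto simp: \<tau>'_\<pi> simp flip: \<pi>_hom)
  qed (rule \<pi>_hom)
  have le: "\<omega> \<le> sequentially"
    by (rule nonprincipal_le_sequentially[OF assms(3,4)])
  have I: "\<forall>\<^sub>F k in \<omega>. k \<in> {1..}" using assms(3) by (simp add: ultrafilter_on_def)
  have \<psi>_trace: "limit_trace \<omega> \<tau>' (\<psi> P) = word_functional \<sigma> P" for P
  proof (rule fam.limit_trace_eqI[OF assms(3)])
    \<comment> \<open>Convergence of the whole sequence passes to \<omega>, which is finer than the
      filter of cofinite sets.\<close>
    have "((\<lambda>k. word_functional (L k) P) \<longlongrightarrow> word_functional \<sigma> P) \<omega>"
      using L_lim by (rule tendsto_mono[OF le])
    then show "((\<lambda>k. \<tau>' k (\<psi> P k)) \<longlongrightarrow> word_functional \<sigma> P) \<omega>"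
      by (rule Lim_transform_eventually) (use I in eventually_elim, simp add: \<psi>_def \<tau>'_\<pi>)
  qed
  note tracial_B = fam.tracial_star_algebra_bounded_product[OF assms(3)]
  have hom_B: "tracial_hom ncpoly_algebra (word_functional \<sigma>) fam.B (limit_trace \<omega> \<tau>') \<psi>"
  proof (intro tracial_hom.intro tracial_hom_axioms.intro S tracial_B)
    note simps = fam.bounded_product_simps \<psi>_def
    show "\<psi> \<in> Ring.ring_hom ncpoly_algebra fam.B"
    proof (rule ring_hom_memI)
      show "\<psi> P \<in> carrier fam.B" for P by (rule \<psi>_closed)
      show "\<psi> (P \<otimes>\<^bsub>ncpoly_algebra\<^esub> Q) = \<psi> P \<otimes>\<^bsub>fam.B\<^esub> \<psi> Q"
        "\<psi> (P \<oplus>\<^bsub>ncpoly_algebra\<^esub> Q) = \<psi> P \<oplus>\<^bsub>fam.B\<^esub> \<psi> Q"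
        "\<psi> \<one>\<^bsub>ncpoly_algebra\<^esub> = \<one>\<^bsub>fam.B\<^esub>" for P Q
        by (simp_all add: simps \<pi>_hom(2-4) del: One_nat_def cong: restrict_cong)
    qed
    show "\<psi> (c \<odot>\<^bsub>ncpoly_algebra\<^esub> P) = c \<odot>\<^bsub>fam.B\<^esub> \<psi> P" for c P
      by (simp add: simps \<pi>_hom(5) del: One_nat_def cong: restrict_cong)
    show "\<psi> (invol ncpoly_algebra P) = invol fam.B (\<psi> P)" for P
      by (simp add: simps \<pi>_hom(6) del: One_nat_def cong: restrict_cong)
  qed (rule \<psi>_trace)
  from tracial_hom_factor[OF assms(1) tracial_B hom_A hom_B] surj
  have "\<exists>\<phi>. tracial_hom A \<tau> (metric_ultraproduct {1..} \<omega> G \<tau>') (metric_ultraproduct_trace \<omega> \<tau>') \<phi>"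
    by (simp add: metric_ultraproduct_def metric_ultraproduct_trace_def)
  with tracial show ?thesis unfolding G_def by blast
qed

end
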